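(* Let $\mathfrak g$ be a finite-dimensional complex reductive Lie algebra, with $\mathfrak j_0,\mathfrak b_0,\mathfrak b_0',\mathfrak p=\mathfrak l\oplus\mathfrak n,\mathfrak p'=\mathfrak l'\oplus\mathfrak n'$ as in the context. Let $B$ be a Manin form on $\mathfrak g$ and let $\mathfrak i,\mathfrak i'$ be Lagrangian subalgebras of $\mathfrak g$ for $B$, with $\mathfrak i$ under $\mathfrak p$ and $\mathfrak i'$ under $\mathfrak p'$. Put $\mathfrak m=[\mathfrak l,\mathfrak l]$, $\mathfrak m'=[\mathfrak l',\mathfrak l']$, $\mathfrak h=\mathfrak i\cap\mathfrak m$, $\mathfrak h'=\mathfrak i'\cap\mathfrak m'$, $\tilde{\mathfrak h}=\mathfrak i\cap\mathfrak l$, $\tilde{\mathfrak h}'=\mathfrak i'\cap\mathfrak l'$. Then the following conditions (i) and (ii) are equivalent: (i) $(B,\mathfrak i,\mathfrak i')$ is a Manin triple. (ii) With $\mathfrak i_1:=p^{\mathfrak n'}(\tilde{\mathfrak h}\cap\mathfrak p')$ and $\mathfrak i'_1:=p^{\mathfrak n}(\tilde{\mathfrak h}'\cap\mathfrak p)$: (a) $\mathfrak i_1$ and $\mathfrak i_1'$ are contained in $\mathfrak l\cap\mathfrak l'$, and $(B_1,\mathfrak i_1,\mathfrak i_1')$ is a Manin triple in $\mathfrak l\cap\mathfrak l'$, where $B_1$ is the restriction of $B$ to $\mathfrak l\cap\mathfrak l'$; (b) $\mathfrak n\cap\mathfrak h'=\{0\}$ and $\mathfrak n'\cap\mathfrak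 h=\{0\}$.
   Context: Manin forms and triples (for any complex reductive Lie algebra $\mathfrak g$): a Manin form is a symmetric, $\mathfrak g$-invariant, $\mathbb R$-bilinear form $B:\mathfrak g\times\mathfrak g\to\mathbb R$ of signature $(\dim_{\mathbb C}\mathfrak g,\dim_{\mathbb C}\mathfrak g)$. A Lagrangian subalgebra for $B$ is a real Lie subalgebra isotropic for $B$ of real dimension $\dim_{\mathbb C}\mathfrak g$. A Manin triple in $\mathfrak g$ is $(B,\mathfrak i,\mathfrak i')$ with $B$ a Manin form and $\mathfrak i,\mathfrak i'$ real Lie subalgebras isotropic for $B$ with $\mathfrak g=\mathfrak i\oplus\mathfrak i'$. A Lagrangian subalgebra $\mathfrak i$ is under $\mathfrak p$ if $\mathfrak p$ is the normalizer in $\mathfrak g$ of the nilpotent radical of $\mathfrak i$; then $\mathfrak p$ is parabolic with the same nilpotent radical as $\mathfrak i$. The nilpotent radical of a Lie algebra is the largest ideal all of whose elements act nilpotently in every finite-dimensional representation. Setting: $\mathfrak j_0$ is a Cartan subalgebra of $\mathfrak g$, $\mathfrak b_0\supset\mathfrak j_0$ a Borel subalgebra, $\mathfrak b'_0$ the Borel subalgebra opposite to $\mathfrak b_0$ with respect to $\mathfrak j_0$; $\mathfrak p\supset\mathfrak b_0$ and $\mathfrak p'\supset\mathfrak b_0'$ are parabolic subalgebras of $\mathfrak g$; $\mathfrak p=\mathfrak l\oplus\mathfrak n$ and $\mathfrak p'=\mathfrak l'\oplus\mathfrak n'$ are the Langlands decompositions ($\mathfrak n,\mathfrak n'$ the nilpotent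 radicals, $\mathfrak l,\mathfrak l'$ complex subalgebras reductive in $\mathfrak g$) with $\mathfrak j_0\subset\mathfrak l$ and $\mathfrak j_0\subset\mathfrak l'$. For $V=\mathfrak n$ or $\mathfrak n'$, $p^{V}:\mathfrak g\to\mathfrak g$ denotes the projection with kernel $V$ onto the unique $\mathfrak j_0$-invariant complement of $V$ in $\mathfrak g$ (the sum of the weight spaces of $\mathfrak j_0$ in $\mathfrak g$ not contained in $V$). When these conditions hold, $(B_1,\mathfrak i_1,\mathfrak i_1')$ is called the predecessor of $(B,\mathfrak i,\mathfrak i')$. *)

theory Defs
  imports Complex_Main "Jordan_Normal_Form.Matrix"
begin

definition direct_sum_of :: "'a::ab_group_add set \<Rightarrow> 'a set \<Rightarrow> 'a set \<Rightarrow> bool" where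
  "direct_sum_of U V W \<longleftrightarrow> U \<inter> V = {0} \<and> W = {u + v | u v. u \<in> U \<and> v \<in> V}"

definition proj_along :: "'a::ab_group_add set \<Rightarrow> 'a set \<Rightarrow> 'a \<Rightarrow> 'a" where
  "proj_along V W x = (THE w. w \<in> W \<and> x - w \<in> V)"

text \<open>
  The ambient Lie algebra is the whole type; its subalgebras are sets. The locale is generic in
  the field because the same notions are needed for complex subalgebras and, after restriction
  of scalars, for real ones.
\<close>

locale lie_algebra = vector_space scale
  for scale :: "'k::field \<Rightarrow> 'a::ab_group_add \<Rightarrow> 'a" +
  fixes bracket :: "'a \<Rightarrow> 'a \<Rightarrow> 'a"
  assumes bracket_add_left: "bracket (x + y) z = bracket x z + bracket y z"
    and bracket_add_right: "bracket x (y + z) = bracket x y + bracket x z"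
    and bracket_scale_left: "bracket (scale c x) y = scale c (bracket x y)"
    and bracket_scale_right: "bracket x (scale c y) = scale c (bracket x y)"
    and bracket_self: "bracket x x = 0"
    and jacobi: "bracket x (bracket y z) + bracket y (bracket z x) + bracket z (bracket x y) = 0"
begin

definition subalgebra :: "'a set \<Rightarrow> bool" where
  "subalgebra L \<longleftrightarrow> subspace L \<and> (\<forall>x\<in>L. \<forall>y\<in>L. bracket x y \<in> L)"

definition stable :: "'a set \<Rightarrow> 'a set \<Rightarrow> bool" where
  "stable L W \<longleftrightarrow> (\<forall>x\<in>L. \<forall>w\<in>W. bracket x w \<in> W)"

definition ideal_in :: "'a set \<Rightarrow> 'a set \<Rightarrow> bool" where
  "ideal_in I L \<longleftrightarrow> subspace I \<and> I \<subseteq> L \<and> stable L I"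

definition brackets :: "'a set \<Rightarrow> 'a set \<Rightarrow> 'a set" where
  "brackets U V = span {bracket u v | u v. u \<in> U \<and> v \<in> V}"

definition normalizer :: "'a set \<Rightarrow> 'a set" where
  "normalizer U = {x. \<forall>u\<in>U. bracket x u \<in> U}"

definition solvable :: "'a set \<Rightarrow> bool" where
  "solvable L \<longleftrightarrow> (\<exists>k. ((\<lambda>U. brackets U U) ^^ k) L = {0})"

definition nilpotent :: "'a set \<Rightarrow> bool" where
  "nilpotent L \<longleftrightarrow> (\<exists>k. ((\<lambda>U. brackets L U) ^^ k) L = {0})"

definition completely_reducible :: "'a set \<Rightarrow> 'a set \<Rightarrow> bool" where
  "completely_reducible L V \<longleftrightarrow>
     (\<forall>W. subspace W \<and> W \<subseteq> V \<and> stable L W \<longrightarrow>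
        (\<exists>W'. subspace W' \<and> stable L W' \<and> direct_sum_of W W' V))"

text \<open>Reductive: the adjoint representation is semisimple. Reductive in the ambient
  algebra: the restriction of its adjoint representation to \<open>L\<close> is semisimple.\<close>

definition reductive :: "'a set \<Rightarrow> bool" where
  "reductive L \<longleftrightarrow> subalgebra L \<and> completely_reducible L L"

definition reductive_in_ambient :: "'a set \<Rightarrow> bool" where
  "reductive_in_ambient L \<longleftrightarrow> subalgebra L \<and> completely_reducible L UNIV"

text \<open>Finite-dimensional representations are taken in matrix form, over the base field.\<close>

definition representation_on :: "'a set \<Rightarrow> nat \<Rightarrow> ('a \<Rightarrow> 'k mat) \<Rightarrow> bool" where
  "representation_on L n \<rho> \<longleftrightarrow>
     (\<forall>x\<in>L. \<rho> x \<in> carrier_mat n n) \<and>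
     (\<forall>x\<in>L. \<forall>y\<in>L. \<rho> (x + y) = \<rho> x + \<rho> y) \<and>
     (\<forall>c. \<forall>x\<in>L. \<rho> (scale c x) = c \<cdot>\<^sub>m \<rho> x) \<and>
     (\<forall>x\<in>L. \<forall>y\<in>L. \<rho> (bracket x y) = \<rho> x * \<rho> y - \<rho> y * \<rho> x)"

definition acts_nilpotently :: "'a set \<Rightarrow> 'a \<Rightarrow> bool" where
  "acts_nilpotently L x \<longleftrightarrow>
     (\<forall>n \<rho>. representation_on L n \<rho> \<longrightarrow> (\<exists>k. \<rho> x ^\<^sub>m k = 0\<^sub>m n n))"

definition nilpotent_radical :: "'a set \<Rightarrow> 'a set" where
  "nilpotent_radical L = (GREATEST I. ideal_in I L \<and> (\<forall>x\<in>I. acts_nilpotently L x))"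

definition cartan :: "'a set \<Rightarrow> bool" where
  "cartan H \<longleftrightarrow> subalgebra H \<and> nilpotent H \<and> normalizer H = H"

definition borel :: "'a set \<Rightarrow> bool" where
  "borel b \<longleftrightarrow> subalgebra b \<and> solvable b \<and>
     (\<forall>c. subalgebra c \<and> solvable c \<and> b \<subseteq> c \<longrightarrow> c = b)"

definition parabolic :: "'a set \<Rightarrow> bool" where
  "parabolic p \<longleftrightarrow> subalgebra p \<and> (\<exists>b. borel b \<and> b \<subseteq> p)"

text \<open>Only the values of \<open>\<alpha>\<close> on \<open>H\<close> matter. True eigenspaces suffice: a Cartan
  subalgebra of a reductive Lie algebra in characteristic 0 acts diagonalizably when the
  field is algebraically closed.\<close>

definition weight_space :: "'a set \<Rightarrow> ('a \<Rightarrow> 'k) \<Rightarrow> 'a set" where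
  "weight_space H \<alpha> = {x. \<forall>h\<in>H. bracket h x = scale (\<alpha> h) x}"

text \<open>Opposite with respect to \<open>H\<close>: the weights are negated. The weight 0 contributes
  \<open>H\<close> itself, and functionals that are not weights contribute \<open>{0}\<close>.\<close>

definition opposite_borel :: "'a set \<Rightarrow> 'a set \<Rightarrow> 'a set \<Rightarrow> bool" where
  "opposite_borel H b b' \<longleftrightarrow> borel b' \<and>
     b' = span (\<Union>{weight_space H (\<lambda>h. - \<alpha> h) | \<alpha>.
                   weight_space H \<alpha> \<noteq> {0} \<and> weight_space H \<alpha> \<subseteq> b})"

definition weight_complement :: "'a set \<Rightarrow> 'a set \<Rightarrow> 'a set" where
  "weight_complement H V = span (\<Union>{weight_space H \<alpha> | \<alpha>. \<not> weight_space H \<alpha> \<subseteq> V})"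

definition weight_proj :: "'a set \<Rightarrow> 'a set \<Rightarrow> 'a \<Rightarrow> 'a" where
  "weight_proj H V = proj_along V (weight_complement H V)"

definition langlands_decomposition :: "'a set \<Rightarrow> 'a set \<Rightarrow> 'a set \<Rightarrow> bool" where
  "langlands_decomposition p l n \<longleftrightarrow>
     n = nilpotent_radical p \<and> reductive_in_ambient l \<and> direct_sum_of l n p"

end

locale fd_complex_lie_algebra = lie_algebra scale bracket
  for scale :: "complex \<Rightarrow> 'a::ab_group_add \<Rightarrow> 'a" and bracket :: "'a \<Rightarrow> 'a \<Rightarrow> 'a" +
  assumes finite_dim: "\<exists>S. finite S \<and> span S = UNIV"
begin

sublocale re: lie_algebra "\<lambda>r. scale (complex_of_real r)" bracket
  by unfold_locales
    (simp_all add: scale_right_distrib scale_left_distrib bracket_add_left bracket_add_right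
      bracket_scale_left bracket_scale_right bracket_self jacobi)

text \<open>Sylvester: \<open>p\<close> positive and \<open>q\<close> negative entries in some orthogonal real basis
  of \<open>L\<close>.\<close>

definition has_signature :: "'a set \<Rightarrow> ('a \<Rightarrow> 'a \<Rightarrow> real) \<Rightarrow> nat \<Rightarrow> nat \<Rightarrow> bool" where
  "has_signature L B p q \<longleftrightarrow>
     (\<exists>E. \<not> re.dependent E \<and> re.span E = L \<and>
        (\<forall>e\<in>E. \<forall>f\<in>E. e \<noteq> f \<longrightarrow> B e f = 0) \<and>
        card {e\<in>E. B e e > 0} = p \<and> card {e\<in>E. B e e < 0} = q)"

text \<open>Everything below looks at \<open>B\<close> on \<open>L \<times> L\<close> only, so that \<open>B\<close> also stands for its
  restriction to \<open>L\<close>. Linearity in the second argument follows from symmetry.\<close>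

definition manin_form :: "'a set \<Rightarrow> ('a \<Rightarrow> 'a \<Rightarrow> real) \<Rightarrow> bool" where
  "manin_form L B \<longleftrightarrow>
     (\<forall>x\<in>L. \<forall>y\<in>L. \<forall>z\<in>L. B (x + y) z = B x z + B y z) \<and>
     (\<forall>r. \<forall>x\<in>L. \<forall>y\<in>L. B (scale (complex_of_real r) x) y = r * B x y) \<and>
     (\<forall>x\<in>L. \<forall>y\<in>L. B x y = B y x) \<and>
     (\<forall>x\<in>L. \<forall>y\<in>L. \<forall>z\<in>L. B (bracket x y) z = - B y (bracket x z)) \<and>
     has_signature L B (dim L) (dim L)"

definition isotropic :: "('a \<Rightarrow> 'a \<Rightarrow> real) \<Rightarrow> 'a set \<Rightarrow> bool" where
  "isotropic B i \<longleftrightarrow> (\<forall>x\<in>i. \<forall>y\<in>i. B x y = 0)"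

definition lagrangian :: "('a \<Rightarrow> 'a \<Rightarrow> real) \<Rightarrow> 'a set \<Rightarrow> bool" where
  "lagrangian B i \<longleftrightarrow> re.subalgebra i \<and> isotropic B i \<and> re.dim i = dim UNIV"

definition manin_triple :: "'a set \<Rightarrow> ('a \<Rightarrow> 'a \<Rightarrow> real) \<Rightarrow> 'a set \<Rightarrow> 'a set \<Rightarrow> bool" where
  "manin_triple L B i i' \<longleftrightarrow> manin_form L B \<and>
     re.subalgebra i \<and> re.subalgebra i' \<and> isotropic B i \<and> isotropic B i' \<and>
     direct_sum_of i i' L"

text \<open>The nilpotent radical of \<open>i\<close> is that of a real Lie algebra.\<close>

definition under :: "'a set \<Rightarrow> 'a set \<Rightarrow> bool" where
  "under i p \<longleftrightarrow> p = normalizer (re.nilpotent_radical i)"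

end

end

theory Submission
  imports Defs "HOL-Library.Function_Algebras" "HOL-Computational_Algebra.Fundamental_Theorem_Algebra"
begin

text \<open>
  The equivalence itself is linear algebra in the intersection of the two parabolic subalgebras. Once it
  is known that \<open>p \<inter> p'\<close> is the direct sum of \<open>l \<inter> l'\<close>, \<open>l \<inter> n'\<close> and \<open>n \<inter> l'\<close>, and that \<open>i\<close> lies between \<open>n\<close> and \<open>p\<close>
  and \<open>i'\<close> between \<open>n'\<close> and \<open>p'\<close>, an element \<open>a + c + d\<close> of \<open>i \<inter> i'\<close> has \<open>a + c\<close> in \<open>i\<close> and \<open>a + d\<close> in \<open>i'\<close>. Thus \<open>a\<close> lies
  in both predecessors, and if \<open>a\<close> vanishes then \<open>c\<close> lies in \<open>n' \<inter> h\<close> and \<open>d\<close> in \<open>n \<inter> h'\<close>. This gives one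
  direction, as \<open>i \<inter> i' = {0}\<close> suffices by dimension (\<open>triple_iff_Int\<close>). In the other, the decomposition of
  an element of \<open>l \<inter> l'\<close> along \<open>i\<close> and \<open>i'\<close> projects to one along the predecessors (\<open>predecessor_sum\<close>). The
  signature of \<open>B\<close> on \<open>l \<inter> l'\<close> is then forced, because a nondegenerate form with two complementary isotropic
  subspaces is split (\<open>hyperbolic_signature\<close>).
  
  As \<open>p\<close> is the normalizer of the nilpotent radical of \<open>i\<close>, the inclusion of \<open>i\<close> in \<open>p\<close> means that this radical
  is an ideal of \<open>i\<close>. That a greatest ideal of this kind exists is an application of Engel's theorem in
  Jacobson's form (\<open>nil_weakly_closed\<close>). The inclusion of \<open>n\<close> in
  \<open>i\<close> follows from \<open>B n p = 0\<close> (\<open>ideal_orthogonal\<close>) and maximality of \<open>i\<close> among isotropic subspaces.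
  
  Most of the work is the root decomposition of the ambient algebra under \<open>j0\<close>, a self-normalizing nilpotent
  subalgebra. It is obtained without the Killing form, whose role is taken by \<open>B\<close>. The existence
  of a Borel subalgebra \<open>b0'\<close> spanned by weight vectors makes \<open>j0\<close> abelian (\<open>cartan_in_opposite_borel\<close>). A
  maximality argument shows that the orthogonal of \<open>b0'\<close> is contained in \<open>b0'\<close> (\<open>complex_orth_subset\<close>). Therefore an
  ad-nilpotent element of \<open>j0\<close> has square zero under \<open>ad\<close>, and in a reductive algebra such a sandwich element is
  central (\<open>sandwich_central\<close>). This excludes degenerate roots, and a lowest weight argument then
  shows that generalized weight spaces for nonzero weights are lines (\<open>gw_line\<close>). So \<open>p\<close>, \<open>l\<close>, \<open>n\<close> and their primed
  counterparts are sums of weight spaces, and \<open>complex_orth_subset\<close> for \<open>b0\<close> gives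
  \<open>n \<inter> n' = {0}\<close> (\<open>opposite_nilradicals_Int\<close>).
\<close>

section \<open>Nilpotency of weakly closed sets of operators\<close>


locale fd_lie_algebra = lie_algebra scale bracket
  for scale :: "'k::field \<Rightarrow> 'a::ab_group_add \<Rightarrow> 'a" and bracket :: "'a \<Rightarrow> 'a \<Rightarrow> 'a" +
  assumes finite_span: "\<exists>S. finite S \<and> span S = UNIV"
begin

definition some_basis :: "'a set" where
  "some_basis = (SOME S. finite S \<and> independent S \<and> span S = UNIV)"

lemma some_basis: "finite some_basis \<and> independent some_basis \<and> span some_basis = UNIV"
  unfolding some_basis_def
proof (rule someI_ex)
  obtain S where S: "finite S" "span S = UNIV" using finite_span by auto
  obtain T where "T \<subseteq> S" "independent T" "S \<subseteq> span T"
    using maximal_independent_subset[of S] by auto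
  then show "\<exists>S. finite S \<and> independent S \<and> span S = UNIV"
    using S by (metis finite_subset span_mono span_span top.extremum_uniqueI)
qed

sublocale finite_dimensional_vector_space scale some_basis
  using some_basis by unfold_locales auto

end

context lie_algebra
begin

lemma bracket_zero_left [simp]: "bracket 0 x = 0"
  using bracket_add_left[of 0 0 x] by simp

lemma bracket_zero_right [simp]: "bracket x 0 = 0"
  using bracket_add_right[of x 0 0] by simp

lemma bracket_minus_left: "bracket (- x) y = - bracket x y"
  using bracket_add_left[of x "- x" y] by (simp add: eq_neg_iff_add_eq_0 add.commute)

lemma bracket_minus_right: "bracket x (- y) = - bracket x y"
  using bracket_add_right[of x y "- y"] by (simp add: eq_neg_iff_add_eq_0 add.commute)

lemma bracket_diff_left: "bracket (x - y) z = bracket x z - bracket y z"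
  using bracket_add_left[of x "- y" z] by (simp add: bracket_minus_left)

lemma bracket_diff_right: "bracket x (y - z) = bracket x y - bracket x z"
  using bracket_add_right[of x y "- z"] by (simp add: bracket_minus_right)

lemma bracket_swap: "bracket x y = - bracket y x"
proof -
  have "bracket x y + bracket y x = bracket (x + y) (x + y)"
    unfolding bracket_add_left bracket_add_right by (simp add: bracket_self)
  then show ?thesis by (simp add: bracket_self eq_neg_iff_add_eq_0)
qed

lemma leibniz: "bracket x (bracket y z) = bracket (bracket x y) z + bracket y (bracket x z)"
proof -
  have "bracket x (bracket y z) = - bracket y (bracket z x) - bracket z (bracket x y)"
    using jacobi[of x y z] by (simp add: algebra_simps eq_neg_iff_add_eq_0)
  moreover have "- bracket y (bracket z x) = bracket y (bracket x z)"
    by (metis bracket_minus_right bracket_swap)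
  moreover have "- bracket z (bracket x y) = bracket (bracket x y) z"
    by (metis bracket_swap)
  ultimately show ?thesis by (metis add.commute diff_conv_add_uminus)
qed

lemma subspace_bracket_vimage:
  assumes "subspace W" shows "subspace {y. bracket x y \<in> W}"
  using assms
  by (auto simp: subspace_def bracket_add_right bracket_scale_right)

lemma subspace_bracket_vimage_left:
  assumes "subspace W" shows "subspace {x. bracket x y \<in> W}"
  using assms
  by (auto simp: subspace_def bracket_add_left bracket_scale_left)

lemma bracket_span_right:
  assumes "subspace W" "\<And>y. y \<in> Y \<Longrightarrow> bracket x y \<in> W" "y \<in> span Y"
  shows "bracket x y \<in> W"
  using span_minimal[of Y "{y. bracket x y \<in> W}"] subspace_bracket_vimage[OF assms(1)] assms
  by auto

lemma bracket_span_left: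
  assumes "subspace W" "\<And>x. x \<in> X \<Longrightarrow> bracket x y \<in> W" "x \<in> span X"
  shows "bracket x y \<in> W"
  using span_minimal[of X "{x. bracket x y \<in> W}"] subspace_bracket_vimage_left[OF assms(1)] assms
  by auto

lemma bracket_span:
  assumes "subspace W" "\<And>x y. x \<in> X \<Longrightarrow> y \<in> Y \<Longrightarrow> bracket x y \<in> W" "x \<in> span X" "y \<in> span Y"
  shows "bracket x y \<in> W"
  by (rule bracket_span_left[OF assms(1) _ assms(3)], rule bracket_span_right[OF assms(1) _ assms(4)])
     (use assms in auto)

end

text \<open>
  Everything about nilpotent actions is done for one operator family \<open>act\<close>, because it is needed
  both for the adjoint representation and for arbitrary matrix representations of a subalgebra. The
  module may be infinite-dimensional: all the finiteness comes from the Lie algebra.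
\<close>

locale lie_module = fd_lie_algebra scale bracket + V: vector_space scaleV
  for scale :: "'k::field \<Rightarrow> 'a::ab_group_add \<Rightarrow> 'a" and bracket :: "'a \<Rightarrow> 'a \<Rightarrow> 'a"
    and scaleV :: "'k \<Rightarrow> 'v::ab_group_add \<Rightarrow> 'v" +
  fixes L :: "'a set" and act :: "'a \<Rightarrow> 'v \<Rightarrow> 'v"
  assumes L: "subalgebra L"
    and act_add: "x \<in> L \<Longrightarrow> act x (u + v) = act x u + act x v"
    and act_scale: "x \<in> L \<Longrightarrow> act x (scaleV c v) = scaleV c (act x v)"
    and add_act: "x \<in> L \<Longrightarrow> y \<in> L \<Longrightarrow> act (x + y) v = act x v + act y v"
    and scale_act: "x \<in> L \<Longrightarrow> act (scale c x) v = scaleV c (act x v)"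
    and act_bracket: "x \<in> L \<Longrightarrow> y \<in> L \<Longrightarrow> act (bracket x y) v = act x (act y v) - act y (act x v)"
begin

text \<open>
  Subspaces are used here instead of single products of operators, because the condition that all long
  products vanish then passes from \<open>M\<close> to its span.
\<close>

primrec words :: "'a set \<Rightarrow> nat \<Rightarrow> 'v set" where
  "words M 0 = UNIV"
| "words M (Suc k) = V.span {act m v | m v. m \<in> M \<and> v \<in> words M k}"

lemma subspace_L: "subspace L" using L by (simp add: subalgebra_def)
lemma act_zero_right [simp]: "x \<in> L \<Longrightarrow> act x 0 = 0"
  using act_scale[of x 0 0] by simp

lemma act_zero_left [simp]: "act 0 v = 0"
  using scale_act[of 0 0 v] subspace_0[OF subspace_L] by simp

lemma subspace_words: "V.subspace (words M k)"
  by (cases k) (auto simp: V.subspace_UNIV)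

lemma subspace_act_vimage: "x \<in> L \<Longrightarrow> V.subspace W \<Longrightarrow> V.subspace {v. act x v \<in> W}"
  by (auto simp: V.subspace_def act_add act_scale)

lemma words_act: "m \<in> M \<Longrightarrow> v \<in> words M k \<Longrightarrow> act m v \<in> words M (Suc k)"
  by (auto intro: V.span_base)

lemma words_Suc_subsetI:
  assumes "V.subspace W" "\<And>m v. m \<in> M \<Longrightarrow> v \<in> words M k \<Longrightarrow> act m v \<in> W"
  shows "words M (Suc k) \<subseteq> W"
  unfolding words.simps by (rule V.span_minimal[OF _ assms(1)]) (use assms(2) in blast)

lemma words_span_act:
  assumes "M \<subseteq> L" "x \<in> span M" "v \<in> words M k"
  shows "act x v \<in> words M (Suc k)"
proof -
  have "x \<in> L \<and> act x v \<in> words M (Suc k)"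
    using assms(2)
  proof (induction rule: span_induct_alt)
    case base
    then show ?case using subspace_0[OF subspace_L] V.subspace_0[OF subspace_words, of M "Suc k"] by (simp del: words.simps)
  next
    case (step c x y)
    have x: "x \<in> L" using step assms(1) by auto
    have "act x v \<in> words M (Suc k)" using step.hyps(1) assms(3) by (rule words_act)
    then have "act (scale c x + y) v \<in> words M (Suc k)"
      using step x subspace_scale[OF subspace_L x, of c]
        V.subspace_add[OF subspace_words V.subspace_scale[OF subspace_words]]
      by (simp add: add_act scale_act del: words.simps)
    then show ?case
      using step x by (metis subspace_L subspace_add subspace_scale)
  qed
  then show ?thesis ..
qed

lemma words_Suc_subset:
  assumes "M \<subseteq> L" shows "words M (Suc k) \<subseteq> words M k"
proof (induction k)
  case (Suc k)
  have "V.span {act m v | m v. m \<in> M \<and> v \<in> words M (Suc k)}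
      \<subseteq> V.span {act m v | m v. m \<in> M \<and> v \<in> words M k}"
    using Suc by (intro V.span_mono) blast
  then show ?case by simp
qed simp

lemma words_le: "M \<subseteq> L \<Longrightarrow> j \<le> k \<Longrightarrow> words M k \<subseteq> words M j"
proof (induction k rule: nat_induct)
  case (Suc k)
  then show ?case by (metis le_Suc_eq order.refl order.trans words_Suc_subset)
qed simp

lemma words_mono_span:
  assumes "N \<subseteq> L" "M \<subseteq> span N" shows "words M k \<subseteq> words N k"
proof (induction k)
  case (Suc k)
  show ?case
    by (intro words_Suc_subsetI subspace_words) (use words_span_act[OF assms(1)] assms(2) Suc in blast)
qed simp

lemma words_power:
  assumes "M \<subseteq> L" "x \<in> span M" shows "(act x ^^ k) v \<in> words M k"
  by (induction k) (use words_span_act[OF assms] in \<open>auto simp del: words.simps(2)\<close>)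

definition nil :: "'a set \<Rightarrow> bool" where
  "nil M \<longleftrightarrow> (\<exists>k. words M k = {0})"

lemma words_zero_in: "0 \<in> words M k" by (rule V.subspace_0[OF subspace_words])

lemma nilI: "words M k \<subseteq> {0} \<Longrightarrow> nil M"
  unfolding nil_def using words_zero_in by blast

lemma words_invariant:
  assumes "I \<subseteq> L" "j \<in> L" "\<And>i. i \<in> I \<Longrightarrow> bracket j i \<in> span I" "v \<in> words I r"
  shows "act j v \<in> words I r"
  using assms(4)
proof (induction r arbitrary: v)
  case (Suc r)
  have "act j (act i w) \<in> words I (Suc r)" if "i \<in> I" "w \<in> words I r" for i w
  proof -
    have "act (bracket j i) w = act j (act i w) - act i (act j w)"
      using that assms by (intro act_bracket) auto
    moreover have "act (bracket j i) w \<in> words I (Suc r)"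
      using words_span_act[OF assms(1)] assms(3) that by auto
    moreover have "act i (act j w) \<in> words I (Suc r)" using Suc.IH that words_act by blast
    ultimately have "act j (act i w) = act (bracket j i) w + act i (act j w)" by simp
    then show ?thesis
      using \<open>act (bracket j i) w \<in> _\<close> \<open>act i (act j w) \<in> _\<close> V.subspace_add[OF subspace_words] by metis
  qed
  then have "words I (Suc r) \<subseteq> {v. act j v \<in> words I (Suc r)}"
    by (intro words_Suc_subsetI subspace_act_vimage subspace_words assms(2)) blast
  then show ?case using Suc.prems by blast
qed simp

text \<open>
  The subspaces \<open>words I r\<close> are stable under \<open>J\<close>. A word of length \<open>N\<close> in \<open>I \<union> J\<close> lowers this
  filtration: if it has a letter from \<open>I\<close> that letter does it, and otherwise it is a word in \<open>J\<close> alone,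
  which vanishes. So words of length \<open>k * N\<close> vanish.
\<close>

lemma nil_union:
  assumes IJ: "I \<subseteq> L" "J \<subseteq> L" and nor: "\<And>j i. j \<in> J \<Longrightarrow> i \<in> I \<Longrightarrow> bracket j i \<in> span I"
    and nil: "nil I" "nil J"
  shows "nil (I \<union> J)"
proof -
  obtain k N where k: "words I k = {0}" and N: "words J N = {0}" using nil by (auto simp: nil_def)
  define P where "P r s = words I r \<inter> {a + b | a b. a \<in> words J s \<and> b \<in> words I (Suc r)}" for r s
  have subP: "V.subspace (P r s)" for r s
    unfolding P_def by (intro V.subspace_inter V.subspace_sums subspace_words)
  have step: "words (I \<union> J) (Suc n) \<subseteq> P r (Suc s)" if n: "words (I \<union> J) n \<subseteq> P r s" for n r s
  proof -
    have "act x v \<in> P r (Suc s)" if x: "x \<in> I \<union> J" and v: "v \<in> words (I \<union> J) n" for x v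
    proof -
      have "v \<in> P r s" using v n by auto
      then obtain a b where ab: "v = a + b" "a \<in> words J s" "b \<in> words I (Suc r)" and vr: "v \<in> words I r"
        by (auto simp: P_def simp del: words.simps)
      show ?thesis
      proof (cases "x \<in> J")
        case True
        have xL: "x \<in> L" using True IJ by auto
        have "act x v \<in> words I r" using words_invariant[OF IJ(1) xL _ vr] nor True by auto
        moreover have "act x v = act x a + act x b" using ab xL by (simp add: act_add)
        moreover have "act x a \<in> words J (Suc s)" using words_act True ab by blast
        moreover have "act x b \<in> words I (Suc r)" using words_invariant[OF IJ(1) xL _ ab(3)] nor True by auto
        ultimately show ?thesis by (auto simp: P_def simp del: words.simps)
      next
        case False
        then have "x \<in> I" using x by auto
        then have "act x v \<in> words I (Suc r)" using vr words_act by blast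
        moreover from this have "act x v \<in> words I r" using words_Suc_subset[OF IJ(1)] by blast
        moreover have "act x v = 0 + act x v" by simp
        ultimately show ?thesis unfolding P_def using words_zero_in[of J "Suc s"] by blast
      qed
    qed
    then show ?thesis using words_Suc_subsetI[OF subP] by blast
  qed
  have iter: "words (I \<union> J) (n + s) \<subseteq> P r s" if "words (I \<union> J) n \<subseteq> words I r" for n r s
  proof (induction s)
    case 0
    show ?case
    proof
      fix v assume "v \<in> words (I \<union> J) (n + 0)"
      then have "v \<in> words I r" using that by auto
      moreover have "v = v + 0" "v \<in> words J 0" "0 \<in> words I (Suc r)" by (simp, simp, rule words_zero_in)
      ultimately show "v \<in> P r 0" unfolding P_def by blast
    qed
  next
    case (Suc s)
    then show ?case using step by (metis add_Suc_right)
  qed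
  have PN: "P r N \<subseteq> words I (Suc r)" for r by (auto simp: P_def N simp del: words.simps)
  have "words (I \<union> J) (r * N) \<subseteq> words I r" for r
  proof (induction r)
    case (Suc r)
    then show ?case using iter[of "r * N" r N] PN[of r] by (simp add: add.commute del: words.simps)
  qed simp
  from this[of k] show ?thesis unfolding k by (rule nilI)
qed

lemma nil_singleton:
  assumes "x \<in> L" "\<And>v. (act x ^^ N) v = 0"
  shows "nil {x}"
proof -
  have "words {x} s \<subseteq> range (act x ^^ s)" for s
  proof (induction s)
    case (Suc s)
    have add: "(act x ^^ n) (u + v) = (act x ^^ n) u + (act x ^^ n) v" for n u v
      by (induction n) (simp_all add: act_add assms(1))
    have sc: "(act x ^^ n) (scaleV c v) = scaleV c ((act x ^^ n) v)" for n c v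
      by (induction n) (simp_all add: act_scale assms(1))
    have "V.subspace (range (act x ^^ Suc s))"
      unfolding V.subspace_def
    proof (intro conjI ballI allI)
      show "0 \<in> range (act x ^^ Suc s)" using sc[of "Suc s" 0 0] by (auto intro!: image_eqI[of _ _ 0])
    next
      fix u v assume "u \<in> range (act x ^^ Suc s)" "v \<in> range (act x ^^ Suc s)"
      then obtain u' v' where "u = (act x ^^ Suc s) u'" "v = (act x ^^ Suc s) v'" by blast
      then show "u + v \<in> range (act x ^^ Suc s)" by (intro image_eqI[of _ _ "u' + v'"]) (simp_all only: add UNIV_I)
    next
      fix c v assume "v \<in> range (act x ^^ Suc s)"
      then obtain v' where "v = (act x ^^ Suc s) v'" by blast
      then show "scaleV c v \<in> range (act x ^^ Suc s)"
        by (intro image_eqI[of _ _ "scaleV c v'"]) (simp_all only: sc UNIV_I)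
    qed
    moreover have "act m v \<in> range (act x ^^ Suc s)" if m: "m \<in> {x}" and v: "v \<in> words {x} s" for m v
    proof -
      obtain w where "v = (act x ^^ s) w" using v Suc by blast
      then show ?thesis using m by (intro image_eqI[of _ _ w]) auto
    qed
    ultimately show ?case by (rule words_Suc_subsetI)
  qed simp
  from this[of N] show ?thesis using assms(2) by (intro nilI) auto
qed

lemma nil_mono_span: "N \<subseteq> L \<Longrightarrow> M \<subseteq> span N \<Longrightarrow> nil N \<Longrightarrow> nil M"
  using words_mono_span unfolding nil_def by (metis nilI nil_def)

text \<open>
  Expanding the iterated commutators, \<open>act (x j)\<close> is a combination of \<open>W (act (x 0)) W'\<close> with words
  \<open>W\<close>, \<open>W'\<close> in \<open>M\<close> of total length \<open>j\<close>, and one of the two is long when \<open>j\<close> is. The subspaces \<open>E j\<close>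
  of the proof contain the values of all these products.
\<close>

lemma nil_bracket_chain:
  assumes M: "M \<subseteq> L" "nil M" and x: "\<And>j. x j \<in> L"
    and m: "\<And>j. m j \<in> M" and step: "\<And>j. x (Suc j) = bracket (m j) (x j)"
  shows "\<exists>j. \<forall>v. act (x j) v = 0"
proof -
  obtain k where k: "words M k = {0}" using M(2) by (auto simp: nil_def)
  define E where "E = rec_nat (V.span (range (act (x 0))))
     (\<lambda>n A. V.span ({act u v | u v. u \<in> M \<and> v \<in> A} \<union> act (x 0) ` words M (Suc n)))"
  have E0: "E 0 = V.span (range (act (x 0)))"
    and ES: "E (Suc n) = V.span ({act u v | u v. u \<in> M \<and> v \<in> E n} \<union> act (x 0) ` words M (Suc n))" for n
    by (simp_all add: E_def)
  have subE: "V.subspace (E n)" for n by (cases n) (auto simp: E0 ES)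
  have x0E: "act (x 0) v \<in> E r" if "v \<in> words M r" for v r
    using that by (cases r) (auto simp: E0 ES simp del: words.simps intro: V.span_base)
  have mE: "act u v \<in> E (Suc n)" if "u \<in> M" "v \<in> E n" for u v n
    unfolding ES using that by (intro V.span_base) auto
  have main: "act (x j) v \<in> E (j + r)" if "v \<in> words M r" for j v r
    using that
  proof (induction j arbitrary: v r)
    case 0 then show ?case using x0E by simp
  next
    case (Suc j)
    have "act (x (Suc j)) v = act (m j) (act (x j) v) - act (x j) (act (m j) v)"
      unfolding step using M m x by (intro act_bracket) auto
    moreover have "act (m j) (act (x j) v) \<in> E (Suc (j + r))" using Suc m mE by blast
    moreover have "act (x j) (act (m j) v) \<in> E (j + Suc r)"
      using Suc.IH[OF words_act[OF m Suc.prems]] .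
    ultimately show ?case using V.subspace_diff[OF subE] by simp
  qed
  have "E (k + s) \<subseteq> words M s" for s
  proof (induction s)
    case (Suc s)
    have "words M (Suc (k + s)) = {0}" using words_le[OF M(1), of k "Suc (k+s)"] k words_zero_in[of M "Suc (k+s)"] by auto
    then have "act (x 0) ` words M (Suc (k + s)) \<subseteq> words M (Suc s)" using x words_zero_in[of M "Suc s"] by (simp del: words.simps)
    moreover have "{act u v | u v. u \<in> M \<and> v \<in> E (k + s)} \<subseteq> words M (Suc s)" using Suc words_act by blast
    ultimately show ?case unfolding add_Suc_right ES by (intro V.span_minimal subspace_words Un_least)
  qed simp
  from this[of k] have "E (k + k) \<subseteq> {0}" using k by simp
  then have "\<forall>v. act (x (k + k)) v = 0" using main[of _ 0 "k + k"] by auto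
  then show ?thesis ..
qed

text \<open>
  Jacobson's form of Engel's theorem. Choose a closed nil subset \<open>M\<close> of \<open>S\<close> with span of maximal
  dimension. If \<open>S\<close> is not contained in \<open>span M\<close>, bracketing an element of \<open>S\<close> outside \<open>span M\<close> repeatedly with
  \<open>M\<close> leads either to an element that normalizes \<open>M\<close>, or, by the preceding lemma, to one that acts as
  zero; both can be added to \<open>M\<close>.
\<close>

theorem nil_weakly_closed:
  assumes S: "S \<subseteq> L" and closed: "\<And>x y. x \<in> S \<Longrightarrow> y \<in> S \<Longrightarrow> bracket x y \<in> S"
    and nilp: "\<And>x. x \<in> S \<Longrightarrow> \<exists>k. \<forall>v. (act x ^^ k) v = 0"
  shows "nil S"
proof -
  define good where "good M \<longleftrightarrow> M \<subseteq> S \<and> (\<forall>x\<in>M. \<forall>y\<in>M. bracket x y \<in> M) \<and> nil M" for M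
  have "words {} 1 = {0}" by (simp)
  then have "good {}" unfolding good_def by (metis empty_subsetI empty_iff nil_def)
  then have "\<exists>M. good M \<and> (\<forall>M'. good M' \<longrightarrow> dim (span M') \<le> dim (span M))"
    using ex_has_greatest_nat[of good "{}" "\<lambda>M. dim (span M)" "Suc dimension"]
    dim_subset_UNIV[of "span _"] by (meson le_imp_less_Suc)
  then obtain M where M: "good M" and maxd: "\<And>M'. good M' \<Longrightarrow> dim (span M') \<le> dim (span M)" by blast
  have brM: "bracket x y \<in> span M" if "x \<in> span M" "y \<in> span M" for x y
    by (rule bracket_span[OF subspace_span _ that]) (use M in \<open>auto simp: good_def intro: span_base\<close>)
  have M_L: "M \<subseteq> L" using M S by (auto simp: good_def)
  define M1 where "M1 = S \<inter> span M"
  have M1: "good M1"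
    unfolding good_def M1_def
    using brM closed nil_mono_span[OF M_L, of "S \<inter> span M"] M by (auto simp: good_def)
  have M1_L: "M1 \<subseteq> L" using S by (auto simp: M1_def)
  have span_M1: "span M1 = span M"
    using M by (intro span_eq[THEN iffD2]) (auto simp: M1_def good_def intro: span_base)
  have sub: "S \<subseteq> span M"
  proof (rule ccontr)
    assume "\<not> S \<subseteq> span M"
    then obtain s where s: "s \<in> S" "s \<notin> span M" by auto
    have no_ext: "False" if "good M2" "M1 \<subseteq> M2" "z \<in> M2" "z \<notin> span M" for M2 z
    proof -
      have "span M1 \<subset> span M2" using that span_M1 span_mono[OF that(2)] span_base by blast
      then have "dim (span M1) < dim (span M2)"
        using dim_psubset[of "span M1" "span M2"] by (simp add: span_span)
      then show False using maxd[OF that(1)] span_M1 by simp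
    qed
    show False
    proof (cases "\<exists>x\<in>S - span M. \<forall>m\<in>M1. bracket m x \<in> span M")
      case True
      then obtain x where x: "x \<in> S" "x \<notin> span M" and xm: "\<And>m. m \<in> M1 \<Longrightarrow> bracket m x \<in> span M" by auto
      have mx: "bracket m x \<in> M1" if "m \<in> M1" for m
        using xm[OF that] that closed x by (auto simp: M1_def)
      have xm': "bracket x m \<in> M1" if "m \<in> M1" for m
      proof -
        have "bracket x m \<in> span M" using xm[OF that] bracket_swap[of x m] span_neg by simp
        then show ?thesis using that closed x by (auto simp: M1_def)
      qed
      have "0 \<in> M1" using closed[OF x(1) x(1)] span_zero by (simp add: M1_def bracket_self)
      obtain N where N: "\<And>v. (act x ^^ N) v = 0" using nilp x by blast
      have xL: "x \<in> L" using x S by auto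
      have "nil (M1 \<union> {x})"
        using M1_L xL M1 xm' nil_singleton[OF xL N] by (intro nil_union) (auto simp: good_def intro: span_base)
      moreover have "\<forall>a\<in>M1 \<union> {x}. \<forall>b\<in>M1 \<union> {x}. bracket a b \<in> M1 \<union> {x}"
        using M1 mx xm' \<open>0 \<in> M1\<close> by (auto simp: good_def bracket_self)
      ultimately have "good (M1 \<union> {x})" using M1 x by (auto simp: good_def)
      then show False using no_ext[of "M1 \<union> {x}" x] x by auto
    next
      case False
      then have "\<forall>x. \<exists>m. x \<in> S - span M \<longrightarrow> m \<in> M1 \<and> bracket m x \<in> S - span M"
        using closed by (auto simp: M1_def) blast
      then obtain f where f: "\<And>x. x \<in> S - span M \<Longrightarrow> f x \<in> M1 \<and> bracket (f x) x \<in> S - span M" by metis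
      define y where "y = rec_nat s (\<lambda>n z. bracket (f z) z)"
      have y0: "y 0 = s" and yS: "\<And>n. y (Suc n) = bracket (f (y n)) (y n)" by (simp_all add: y_def)
      have y: "y n \<in> S - span M" for n by (induction n) (use s f in \<open>auto simp: y0 yS\<close>)
      have "\<exists>j. \<forall>v. act (y j) v = 0"
        by (rule nil_bracket_chain[OF M1_L, of _ "\<lambda>n. f (y n)"])
           (use M1 y f S yS in \<open>auto simp: good_def\<close>)
      then obtain j where j: "\<And>v. act (y j) v = 0" by auto
      define S0 where "S0 = {x\<in>S. \<forall>v. act x v = 0}"
      have S0: "S0 \<subseteq> L" using S by (auto simp: S0_def)
      have br0: "bracket a b \<in> S0" "bracket b a \<in> S0" if "a \<in> S" "b \<in> S0" for a b
      proof -
        have "a \<in> L" "b \<in> L" "b \<in> S" and b: "\<And>v. act b v = 0" using that S by (auto simp: S0_def)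
        then show "bracket a b \<in> S0" "bracket b a \<in> S0"
          using closed that(1) act_bracket[of a b] act_bracket[of b a] by (simp_all add: S0_def)
      qed
      have "words S0 (Suc 0) \<subseteq> {0}"
        by (intro words_Suc_subsetI) (auto simp: S0_def V.subspace_single_0)
      then have "nil S0" by (rule nilI)
      then have "nil (S0 \<union> M1)"
        using S0 M1_L M1 br0 by (intro nil_union) (auto simp: good_def M1_def intro: span_base)
      moreover have "\<forall>a\<in>S0 \<union> M1. \<forall>b\<in>S0 \<union> M1. bracket a b \<in> S0 \<union> M1"
        using M1 br0 by (auto simp: good_def M1_def S0_def)
      ultimately have "good (S0 \<union> M1)" using M1 by (auto simp: good_def S0_def)
      then show False using no_ext[of "S0 \<union> M1" "y j"] y[of j] j by (auto simp: S0_def)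
    qed
  qed
  show ?thesis using nil_mono_span[OF M_L sub] M by (simp add: good_def)
qed

end

section \<open>The nilpotent radical\<close>


text \<open>
  Matrices of size \<open>n\<close> act on all functions \<open>nat \<Rightarrow> 'k\<close>, through their first \<open>n\<close> values: in this way
  the representation space is a whole type.
\<close>

definition mat_act :: "nat \<Rightarrow> 'k::field mat \<Rightarrow> (nat \<Rightarrow> 'k) \<Rightarrow> (nat \<Rightarrow> 'k)" where
  "mat_act n A v = (\<lambda>i. if i < n then \<Sum>j<n. A $$ (i, j) * v j else 0)"

lemma mat_act_mult:
  assumes "A \<in> carrier_mat n n" "B \<in> carrier_mat n n"
  shows "mat_act n (A * B) v = mat_act n A (mat_act n B v)"
proof
  fix i
  show "mat_act n (A * B) v i = mat_act n A (mat_act n B v) i"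
  proof (cases "i < n")
    case True
    have "(\<Sum>j<n. (A * B) $$ (i, j) * v j) = (\<Sum>j<n. \<Sum>l<n. A $$ (i, l) * B $$ (l, j) * v j)"
      using assms True by (intro sum.cong) (auto simp: scalar_prod_def sum_distrib_right lessThan_atLeast0)
    also have "\<dots> = (\<Sum>l<n. \<Sum>j<n. A $$ (i, l) * B $$ (l, j) * v j)" by (rule sum.swap)
    also have "\<dots> = (\<Sum>l<n. A $$ (i, l) * (\<Sum>j<n. B $$ (l, j) * v j))"
      by (simp add: sum_distrib_left mult.assoc)
    finally show ?thesis using True by (simp add: mat_act_def)
  qed (simp add: mat_act_def)
qed

lemma mat_act_funpow:
  assumes "A \<in> carrier_mat n n"
  shows "(mat_act n A ^^ Suc k) v = mat_act n (A ^\<^sub>m Suc k) v"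
proof (induction k arbitrary: v)
  case 0
  show ?case using assms by simp
next
  case (Suc k)
  have "(mat_act n A ^^ Suc (Suc k)) v = (mat_act n A ^^ Suc k) (mat_act n A v)"
    by (simp only: funpow_Suc_right o_apply)
  also have "\<dots> = mat_act n (A ^\<^sub>m Suc k * A) v"
    unfolding Suc using assms by (subst mat_act_mult) (auto intro: pow_carrier_mat)
  finally show ?case by simp
qed

lemma mat_nilpotent_iff:
  assumes A: "A \<in> carrier_mat n n"
  shows "(\<exists>k. A ^\<^sub>m k = 0\<^sub>m n n) \<longleftrightarrow> (\<exists>k. \<forall>v. (mat_act n A ^^ k) v = 0)"
proof
  assume "\<exists>k. A ^\<^sub>m k = 0\<^sub>m n n"
  then obtain k where "A ^\<^sub>m k = 0\<^sub>m n n" by auto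
  then have "A ^\<^sub>m Suc k = 0\<^sub>m n n" using A by simp
  then have "(mat_act n A ^^ Suc k) v = 0" for v
    unfolding mat_act_funpow[OF A] by (auto simp: mat_act_def fun_eq_iff)
  then show "\<exists>k. \<forall>v. (mat_act n A ^^ k) v = 0" by blast
next
  assume "\<exists>k. \<forall>v. (mat_act n A ^^ k) v = 0"
  then obtain k where k: "\<And>v. (mat_act n A ^^ k) v = 0" by auto
  have z: "mat_act n A 0 = 0" by (auto simp: mat_act_def fun_eq_iff)
  have "A ^\<^sub>m Suc k = 0\<^sub>m n n"
  proof (rule eq_matI)
    show "dim_row (A ^\<^sub>m Suc k) = dim_row (0\<^sub>m n n)" "dim_col (A ^\<^sub>m Suc k) = dim_col (0\<^sub>m n n)"
      using pow_carrier_mat[OF A, of "Suc k"] by auto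
  next
    fix i j assume ij: "i < dim_row (0\<^sub>m n n :: 'a mat)" "j < dim_col (0\<^sub>m n n :: 'a mat)"
    have "mat_act n (A ^\<^sub>m Suc k) (\<lambda>l. if l = j then 1 else 0) i = 0"
      unfolding mat_act_funpow[OF A, symmetric] using k z by simp
    moreover have "mat_act n (A ^\<^sub>m Suc k) (\<lambda>l. if l = j then 1 else 0) i = (A ^\<^sub>m Suc k) $$ (i, j)"
      using ij by (simp add: mat_act_def if_distrib[of "\<lambda>x. _ * x"] cong: if_cong del: pow_mat.simps)
    ultimately show "(A ^\<^sub>m Suc k) $$ (i, j) = 0\<^sub>m n n $$ (i, j)" using ij by simp
  qed
  then show "\<exists>k. A ^\<^sub>m k = 0\<^sub>m n n" by blast
qed

context fd_lie_algebra
begin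

lemma lie_module_of_representation:
  assumes L: "subalgebra L" and r: "representation_on L n \<rho>"
  shows "lie_module scale bracket (\<lambda>c v i. c * v i) L (\<lambda>x. mat_act n (\<rho> x))"
proof
  fix x y u v c assume x: "x \<in> L"
  have cx: "\<rho> x \<in> carrier_mat n n" using r x by (simp add: representation_on_def)
  show "mat_act n (\<rho> x) (u + v) = mat_act n (\<rho> x) u + mat_act n (\<rho> x) v"
    by (auto simp: mat_act_def fun_eq_iff algebra_simps sum.distrib)
  show "mat_act n (\<rho> x) (\<lambda>i. c * v i) = (\<lambda>i. c * mat_act n (\<rho> x) v i)"
    by (auto simp: mat_act_def fun_eq_iff algebra_simps sum_distrib_left)
  have "\<rho> (scale c x) = c \<cdot>\<^sub>m \<rho> x" using r x by (simp add: representation_on_def)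
  then show "mat_act n (\<rho> (scale c x)) v = (\<lambda>i. c * mat_act n (\<rho> x) v i)"
    using cx by (auto simp: mat_act_def fun_eq_iff algebra_simps sum_distrib_left intro!: sum.cong)
  assume y: "y \<in> L"
  have cy: "\<rho> y \<in> carrier_mat n n" using r y by (simp add: representation_on_def)
  have "\<rho> (x + y) = \<rho> x + \<rho> y" using r x y by (simp add: representation_on_def)
  then show "mat_act n (\<rho> (x + y)) v = mat_act n (\<rho> x) v + mat_act n (\<rho> y) v"
    using cx cy by (auto simp: mat_act_def fun_eq_iff algebra_simps sum.distrib[symmetric] intro!: sum.cong)
  have "\<rho> (bracket x y) = \<rho> x * \<rho> y - \<rho> y * \<rho> x" using r x y by (simp add: representation_on_def)
  moreover have "mat_act n (\<rho> x * \<rho> y - \<rho> y * \<rho> x) v = mat_act n (\<rho> x * \<rho> y) v - mat_act n (\<rho> y * \<rho> x) v"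
    using cx cy by (auto simp: mat_act_def fun_eq_iff left_diff_distrib sum_subtractf[symmetric] simp del: index_mult_mat(1) intro!: sum.cong)
  ultimately show "mat_act n (\<rho> (bracket x y)) v
      = mat_act n (\<rho> x) (mat_act n (\<rho> y) v) - mat_act n (\<rho> y) (mat_act n (\<rho> x) v)"
    using mat_act_mult cx cy by metis
qed (use L in \<open>auto simp: fun_eq_iff algebra_simps\<close>)

lemma acts_nilpotently_sum:
  assumes L: "subalgebra L" and I: "ideal_in I L" "\<And>x. x \<in> I \<Longrightarrow> acts_nilpotently L x"
    and J: "ideal_in J L" "\<And>x. x \<in> J \<Longrightarrow> acts_nilpotently L x"
    and xy: "x \<in> I" "y \<in> J"
  shows "acts_nilpotently L (x + y)"
  unfolding acts_nilpotently_def
proof (intro allI impI)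
  fix n \<rho> assume r: "representation_on L n \<rho>"
  interpret lie_module scale bracket "\<lambda>c v i. c * v i" L "\<lambda>x. mat_act n (\<rho> x)"
    by (rule lie_module_of_representation[OF L r])
  have c: "\<rho> z \<in> carrier_mat n n" if "z \<in> L" for z using r that by (simp add: representation_on_def)
  have nil_ideal: "nil I'" if I': "ideal_in I' L" "\<And>x. x \<in> I' \<Longrightarrow> acts_nilpotently L x" for I'
  proof (rule nil_weakly_closed)
    show "I' \<subseteq> L" "\<And>x y. x \<in> I' \<Longrightarrow> y \<in> I' \<Longrightarrow> bracket x y \<in> I'"
      using I'(1) by (auto simp: ideal_in_def stable_def)
    fix z assume "z \<in> I'"
    then show "\<exists>k. \<forall>v. (mat_act n (\<rho> z) ^^ k) v = 0"
      using I' r c mat_nilpotent_iff[of "\<rho> z" n] by (auto simp: acts_nilpotently_def ideal_in_def)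
  qed
  have sub: "I \<subseteq> L" "J \<subseteq> L" using I J by (auto simp: ideal_in_def)
  have "nil (I \<union> J)"
    using sub nil_ideal I J by (intro nil_union) (auto simp: ideal_in_def stable_def subset_iff intro: span_base)
  then obtain k where k: "words (I \<union> J) k = {0}" by (auto simp: nil_def)
  have "x + y \<in> span (I \<union> J)" using xy by (intro span_add span_base) auto
  then have "(mat_act n (\<rho> (x + y)) ^^ k) v = 0" for v
    using words_power[of "I \<union> J" "x + y" k v] sub k by auto
  moreover have "x + y \<in> L" using xy sub subspace_add[OF subspace_L] by blast
  ultimately show "\<exists>k. \<rho> (x + y) ^\<^sub>m k = 0\<^sub>m n n" using mat_nilpotent_iff[OF c] by blast
qed

text \<open>
  The greatest ideal exists: take one of maximal dimension; its sum with any other such ideal is again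
  such an ideal, by \<open>nil_union\<close>, hence not larger.
\<close>

theorem nilpotent_radical:
  assumes L: "subalgebra L"
  shows "ideal_in (nilpotent_radical L) L" "x \<in> nilpotent_radical L \<Longrightarrow> acts_nilpotently L x"
proof -
  define good where "good I \<longleftrightarrow> ideal_in I L \<and> (\<forall>x\<in>I. acts_nilpotently L x)" for I
  have sL: "subspace L" using L by (simp add: subalgebra_def)
  have "acts_nilpotently L 0"
    unfolding acts_nilpotently_def
  proof (intro allI impI)
    fix n \<rho> assume r: "representation_on L n \<rho>"
    have "\<rho> (scale 0 0) = 0 \<cdot>\<^sub>m \<rho> 0" "\<rho> 0 \<in> carrier_mat n n"
      using r subspace_0[OF sL] unfolding representation_on_def by blast+
    moreover have "0 \<cdot>\<^sub>m \<rho> 0 = 0\<^sub>m n n" using calculation(2) by (auto intro!: eq_matI)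
    ultimately have "\<rho> 0 = 0\<^sub>m n n" by simp
    then have "\<rho> 0 ^\<^sub>m 1 = 0\<^sub>m n n" by simp
    then show "\<exists>k. \<rho> 0 ^\<^sub>m k = 0\<^sub>m n n" by blast
  qed
  then have "good {0}"
    using subspace_0[OF sL] by (auto simp: good_def ideal_in_def stable_def subspace_single_0)
  then have "\<exists>I. good I \<and> (\<forall>J. good J \<longrightarrow> dim J \<le> dim I)"
    using ex_has_greatest_nat[of good "{0}" dim "Suc dimension"] dim_subset_UNIV
    by (meson le_imp_less_Suc)
  then obtain I where I: "good I" and maxd: "\<And>J. good J \<Longrightarrow> dim J \<le> dim I" by blast
  have sI: "subspace I" using I by (simp add: good_def ideal_in_def)
  have top: "J \<subseteq> I" if J: "good J" for J
  proof -
    define K where "K = {x + y | x y. x \<in> I \<and> y \<in> J}"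
    have sJ: "subspace J" using J by (simp add: good_def ideal_in_def)
    have sK: "subspace K" unfolding K_def using sI sJ by (rule subspace_sums)
    have "stable L K"
      using I J unfolding good_def ideal_in_def stable_def K_def by (fastforce simp: bracket_add_right)
    moreover have "K \<subseteq> L" using I J subspace_add[OF sL] by (auto simp: K_def good_def ideal_in_def)
    moreover have "\<forall>z\<in>K. acts_nilpotently L z"
      using acts_nilpotently_sum[OF L] I J by (auto simp: K_def good_def)
    ultimately have "good K" using sK by (simp add: good_def ideal_in_def)
    have "I \<subseteq> K" using subspace_0[OF sJ] unfolding K_def by (metis (mono_tags, lifting) add.right_neutral mem_Collect_eq subsetI)
    then have "I = K" using subspace_dim_equal[OF sI sK] maxd[OF \<open>good K\<close>] by simp
    moreover have "J \<subseteq> K" using subspace_0[OF sI] unfolding K_def by (metis (mono_tags, lifting) add.left_neutral mem_Collect_eq subsetI)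
    ultimately show ?thesis by simp
  qed
  have "nilpotent_radical L = I"
    unfolding nilpotent_radical_def good_def[symmetric] using I top by (intro Greatest_equality) auto
  then show "ideal_in (nilpotent_radical L) L" "x \<in> nilpotent_radical L \<Longrightarrow> acts_nilpotently L x"
    using I by (auto simp: good_def)
qed

text \<open>
  The matrices of the adjoint action on the whole ambient algebra, in some basis, are one of the
  representations in the definition of \<open>acts_nilpotently\<close>.
\<close>

lemma ad_nilpotent:
  assumes L: "subalgebra L" and x: "x \<in> L" "acts_nilpotently L x"
  shows "\<exists>k. \<forall>v. (bracket x ^^ k) v = 0"
proof -
  obtain bs where bs: "set bs = some_basis" "distinct bs" using some_basis finite_distinct_list by blast
  define n where "n = length bs"
  have ind: "independent some_basis" and spn: "span some_basis = UNIV" using some_basis by auto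
  define R where "R v b = representation some_basis v b" for v b
  define \<rho> where "\<rho> z = mat n n (\<lambda>(i, j). R (bracket z (bs ! j)) (bs ! i))" for z
  have expand: "v = (\<Sum>i<n. scale (R v (bs ! i)) (bs ! i))" for v
  proof -
    have "v = (\<Sum>b\<in>some_basis. scale (R v b) b)"
      using sum_representation_eq[OF ind, of v some_basis] spn some_basis by (simp add: R_def)
    also have "\<dots> = (\<Sum>i<n. scale (R v (bs ! i)) (bs ! i))"
      using bs by (intro sum.reindex_bij_betw[symmetric]) (auto simp: n_def bij_betw_nth)
    finally show ?thesis .
  qed
  have R_add: "R (u + v) b = R u b + R v b" and R_diff: "R (u - v) b = R u b - R v b"
    and R_scale: "R (scale c u) b = c * R u b" for u v c b
    unfolding R_def using ind spn by (simp_all add: representation_add representation_diff representation_scale)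
  have R_zero: "R 0 b = 0" for b using R_scale[of 0 0 b] by simp
  have R_sum: "R (\<Sum>i<m. f i) b = (\<Sum>i<m. R (f i) b)" for f and m :: nat and b
    by (induction m) (simp_all add: R_add R_zero)
  have bracket_sum: "bracket z (\<Sum>i<m. f i) = (\<Sum>i<m. bracket z (f i))" for z f and m :: nat
    by (induction m) (simp_all add: bracket_add_right)
  have R_bracket: "R (bracket z v) b = (\<Sum>i<n. R (bracket z (bs ! i)) b * R v (bs ! i))" for z v b
    by (subst expand[of v]) (simp add: bracket_sum R_sum bracket_scale_right R_scale mult.commute)
  have act_R: "mat_act n (\<rho> z) (\<lambda>j. if j < n then R v (bs ! j) else 0) = (\<lambda>i. if i < n then R (bracket z v) (bs ! i) else 0)" for z v
    by (auto simp: mat_act_def fun_eq_iff \<rho>_def R_bracket[of z v])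
  have rep: "representation_on L n \<rho>"
    unfolding representation_on_def
  proof (intro conjI ballI allI)
    fix y z assume "y \<in> L" "z \<in> L"
    show "\<rho> (bracket y z) = \<rho> y * \<rho> z - \<rho> z * \<rho> y"
    proof (rule eq_matI)
      fix i j assume "i < dim_row (\<rho> y * \<rho> z - \<rho> z * \<rho> y)" "j < dim_col (\<rho> y * \<rho> z - \<rho> z * \<rho> y)"
      then have ij: "i < n" "j < n" by (auto simp: \<rho>_def)
      have "R (bracket (bracket y z) (bs ! j)) (bs ! i)
          = R (bracket y (bracket z (bs ! j)) - bracket z (bracket y (bs ! j))) (bs ! i)"
        using leibniz[of y z "bs ! j"] by simp
      also have "\<dots> = (\<Sum>k<n. R (bracket y (bs ! k)) (bs ! i) * R (bracket z (bs ! j)) (bs ! k))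
          - (\<Sum>k<n. R (bracket z (bs ! k)) (bs ! i) * R (bracket y (bs ! j)) (bs ! k))"
        by (simp only: R_diff R_bracket[of y "bracket z (bs ! j)"] R_bracket[of z "bracket y (bs ! j)"])
      finally show "\<rho> (bracket y z) $$ (i, j) = (\<rho> y * \<rho> z - \<rho> z * \<rho> y) $$ (i, j)"
        using ij by (simp add: \<rho>_def scalar_prod_def lessThan_atLeast0)
    qed (auto simp: \<rho>_def)
  qed (auto simp: \<rho>_def bracket_add_left bracket_scale_left R_add R_scale intro!: eq_matI)
  then obtain k where "\<rho> x ^\<^sub>m k = 0\<^sub>m n n" using x by (auto simp: acts_nilpotently_def)
  moreover have "\<rho> x \<in> carrier_mat n n" by (simp add: \<rho>_def)
  ultimately obtain k where k: "\<And>v. (mat_act n (\<rho> x) ^^ k) v = 0" using mat_nilpotent_iff by blast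
  have "(mat_act n (\<rho> x) ^^ k) (\<lambda>j. if j < n then R v (bs ! j) else 0)
     = (\<lambda>i. if i < n then R ((bracket x ^^ k) v) (bs ! i) else 0)" for k v
    by (induction k) (simp_all add: act_R cong: if_cong)
  from this[of k] have zero: "(\<lambda>i. if i < n then R ((bracket x ^^ k) v) (bs ! i) else 0) = (0 :: nat \<Rightarrow> 'k)" for v
    by (simp only: k)
  have Rk: "R ((bracket x ^^ k) v) (bs ! i) = 0" if i: "i < n" for v i
    using fun_cong[OF zero, of i v] i by (simp only: if_True zero_fun_apply)
  have "(bracket x ^^ k) v = 0" for v
  proof -
    have "(bracket x ^^ k) v = (\<Sum>i<n. scale (R ((bracket x ^^ k) v) (bs ! i)) (bs ! i))" by (rule expand)
    also have "\<dots> = 0" by (intro sum.neutral) (simp add: Rk)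
    finally show ?thesis .
  qed
  then show ?thesis by (intro exI[of _ k] allI)
qed

text \<open>
  A linear form that vanishes on all brackets is a representation by matrices of size 1, in which a
  nilpotent matrix is zero.
\<close>

lemma character_zero:
  assumes L: "subalgebra L" and x: "x \<in> L" "acts_nilpotently L x"
    and W: "subspace W" "\<And>y z. bracket y z \<in> W" "x \<notin> W"
  shows False
proof -
  obtain Bs where Bs: "Bs \<subseteq> W" "independent Bs" "W \<subseteq> span Bs"
    using maximal_independent_subset[of W] by auto
  have WB: "span Bs = W" using Bs W(1) span_minimal by blast
  then have xB: "x \<notin> span Bs" using W by simp
  have ind: "independent (insert x Bs)" using Bs(2) xB by (rule independent_insertI[rotated])
  define D where "D = extend_basis (insert x Bs)"
  have D: "insert x Bs \<subseteq> D" "independent D" "span D = UNIV"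
    unfolding D_def using extend_basis_superset[OF ind] independent_extend_basis[OF ind] span_extend_basis[OF ind] by blast+
  define f where "f v = representation D v x" for v
  have f_add: "f (u + v) = f u + f v" and f_scale: "f (scale c u) = c * f u" for u v c
    unfolding f_def using D by (simp_all add: representation_add representation_scale)
  have fx: "f x = 1" using D unfolding f_def by (subst representation_basis) auto
  have f0: "f v = 0" if "v \<in> W" for v
  proof -
    have "v \<in> span Bs" using that WB by simp
    moreover have "subspace {v. f v = 0}" using f_add f_scale f_scale[of 0 0] by (auto simp: subspace_def)
    moreover have "f b = 0" if "b \<in> Bs" for b
      using that D xB span_base[of b Bs] unfolding f_def by (subst representation_basis) auto
    ultimately show ?thesis using span_minimal[of Bs "{v. f v = 0}"] by auto
  qed
  define \<rho> where "\<rho> v = mat 1 1 (\<lambda>_. f v)" for v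
  have "representation_on L 1 \<rho>"
    unfolding representation_on_def
    by (auto simp: \<rho>_def f_add f_scale f0 W scalar_prod_def intro!: eq_matI)
  then obtain k where k: "\<rho> x ^\<^sub>m k = 0\<^sub>m 1 1" using x by (auto simp: acts_nilpotently_def)
  have "\<rho> x = 1\<^sub>m 1" by (auto simp: \<rho>_def fx intro!: eq_matI)
  then have "\<rho> x ^\<^sub>m k = 1\<^sub>m 1" by (induction k) auto
  then have "(1\<^sub>m 1 :: 'k mat) $$ (0, 0) = 0\<^sub>m 1 1 $$ (0, 0)" using k by simp
  then show False by simp
qed

end

section \<open>Sandwich elements\<close>


context fd_complex_lie_algebra
begin

sublocale fd_lie_algebra scale bracket
  by unfold_locales (rule finite_dim)

sublocale ad: lie_module scale bracket scale UNIV bracket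
proof unfold_locales
  show "bracket (bracket x y) v = bracket x (bracket y v) - bracket y (bracket x v)" for x y v
    using leibniz[of x y v] by simp
qed (simp_all add: subalgebra_def subspace_UNIV bracket_add_left bracket_add_right
      bracket_scale_left bracket_scale_right)

lemma subspace_re: "subspace W \<Longrightarrow> re.subspace W"
  unfolding subspace_def re.subspace_def by simp

lemma funpow_bracket_zero: "(bracket x ^^ k) 0 = 0"
  by (induction k) simp_all

lemma funpow_bracket_add: "(bracket x ^^ k) (u + v) = (bracket x ^^ k) u + (bracket x ^^ k) v"
  by (induction k) (simp_all add: bracket_add_right)

lemma funpow_bracket_scale: "(bracket x ^^ k) (scale c v) = scale c ((bracket x ^^ k) v)"
  by (induction k) (simp_all add: bracket_scale_right)

definition ad_nilp :: "'a \<Rightarrow> bool" where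
  "ad_nilp x \<longleftrightarrow> (\<exists>k. \<forall>v. (bracket x ^^ k) v = 0)"

text \<open>
  These elements replace Cartan's criterion below: they are closed under brackets, and their span is
  stable enough to give a nilpotent ideal.
\<close>

definition sandwich :: "'a \<Rightarrow> bool" where
  "sandwich c \<longleftrightarrow> (\<forall>y. bracket c (bracket c y) = 0)"

lemma sandwich_mid:
  assumes "sandwich c" shows "bracket c (bracket y (bracket c z)) = 0"
proof -
  have c: "\<And>w. bracket c (bracket c w) = 0" using assms by (simp add: sandwich_def)
  have "bracket c (bracket c (bracket y z)) = bracket c (bracket (bracket c y) z + bracket y (bracket c z))"
    by (simp only: leibniz[of c y z])
  also have "\<dots> = bracket (bracket c y) (bracket c z) + bracket (bracket c y) (bracket c z)"
    by (simp add: bracket_add_right leibniz[of c "bracket c y" z] leibniz[of c y "bracket c z"] c)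
  finally have "scale 2 (bracket (bracket c y) (bracket c z)) = 0"
    by (metis c scale_left_distrib one_add_one scale_one)
  then have "bracket (bracket c y) (bracket c z) = 0" by simp
  then show ?thesis by (simp add: leibniz[of c y "bracket c z"] c)
qed

lemma sandwich_bracket:
  assumes "sandwich c" "sandwich d" shows "sandwich (bracket c d)"
  unfolding sandwich_def
proof
  fix y
  have e: "bracket (bracket c d) w = bracket c (bracket d w) - bracket d (bracket c w)" for w
    by (simp add: leibniz[of c d w])
  have "\<And>w. bracket c (bracket c w) = 0" "\<And>w. bracket d (bracket d w) = 0" using assms by (auto simp: sandwich_def)
  then show "bracket (bracket c d) (bracket (bracket c d) y) = 0"
    unfolding e by (simp add: bracket_diff_right sandwich_mid[OF assms(1)] sandwich_mid[OF assms(2)])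
qed

text \<open>
  Induction on the degree: replacing \<open>s\<close> by \<open>2 * s\<close> and subtracting \<open>2 ^ n\<close> times the original
  eliminates the top coefficient and multiplies the others by nonzero constants.
\<close>

lemma poly_coeff_in_subspace:
  assumes W: "subspace W" and "\<And>s. (\<Sum>j<n. scale (s ^ j) (c j)) \<in> W" "j < n"
  shows "c j \<in> W"
  using assms(2,3)
proof (induction n arbitrary: c j)
  case (Suc n)
  have low: "c j \<in> W" if "j < n" for j
  proof -
    have "(\<Sum>j<n. scale (s ^ j) (scale (2 ^ j - 2 ^ n) (c j))) \<in> W" for s
    proof -
      have "(\<Sum>j<Suc n. scale ((2 * s) ^ j) (c j)) - scale (2 ^ n) (\<Sum>j<Suc n. scale (s ^ j) (c j)) \<in> W"
        using Suc.prems(1) subspace_diff[OF W] subspace_scale[OF W] by blast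
      also have "(\<Sum>j<Suc n. scale ((2 * s) ^ j) (c j)) - scale (2 ^ n) (\<Sum>j<Suc n. scale (s ^ j) (c j))
          = (\<Sum>j<Suc n. scale (s ^ j) (scale (2 ^ j - 2 ^ n) (c j)))"
        unfolding scale_sum_right sum_subtractf[symmetric]
        by (intro sum.cong) (simp_all add: power_mult_distrib scale_left_diff_distrib scale_right_diff_distrib mult.commute)
      finally show ?thesis by simp
    qed
    from Suc.IH[OF this that] have "scale (2 ^ j - 2 ^ n) (c j) \<in> W" .
    moreover have "(2::complex) ^ j - 2 ^ n \<noteq> 0"
      using that power_inject_exp[of "2::real" j n] by (metis less_irrefl norm_numeral norm_power one_less_numeral_iff right_minus_eq semiring_norm(76))
    ultimately show ?thesis
      using subspace_scale[OF W, of "scale (2 ^ j - 2 ^ n) (c j)" "1 / (2 ^ j - 2 ^ n)"] by simp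
  qed
  show ?case
  proof (cases "j < n")
    case False
    then have "j = n" using Suc.prems by simp
    have "(\<Sum>j<n. c j) \<in> W" using low by (intro subspace_sum[OF W]) auto
    moreover have "(\<Sum>j<n. c j) + c n \<in> W" using Suc.prems(1)[of 1] by simp
    ultimately have "(\<Sum>j<n. c j) + c n - (\<Sum>j<n. c j) \<in> W" using subspace_diff[OF W] by blast
    then show ?thesis using \<open>j = n\<close> by simp
  qed (rule low)
qed simp

text \<open>
  Infinitesimally, \<open>exp (s ad x)\<close> is an automorphism and so preserves sandwich elements, and the
  derivative at \<open>s = 0\<close> is \<open>bracket x c\<close>. As \<open>x\<close> is nilpotent the curve is a polynomial in \<open>s\<close>, so it is
  enough to know its values. That they are sandwich elements is checked coefficientwise, by bracketing the
  identity for \<open>m\<close> with \<open>x\<close>.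
\<close>

lemma sandwich_stable:
  assumes x: "ad_nilp x" and c: "sandwich c"
  shows "bracket x c \<in> span {c. sandwich c}"
proof -
  obtain M where M: "\<And>v. (bracket x ^^ M) v = 0" using x by (auto simp: ad_nilp_def)
  define u where "u j = scale (1 / fact j) ((bracket x ^^ j) c)" for j
  define G where "G y i j = bracket (u i) (bracket (u j) y)" for y i j
  have u_bracket: "bracket x (u j) = scale (of_nat (Suc j)) (u (Suc j))" for j
  proof -
    have "(1 / fact j :: complex) = of_nat (Suc j) * (1 / fact (Suc j))"
      by (simp add: fact_Suc del: of_nat_Suc)
    then show ?thesis by (simp add: u_def bracket_scale_right del: of_nat_Suc fact_Suc)
  qed
  have u0: "u j = 0" if "M \<le> j" for j
  proof -
    have "(bracket x ^^ j) c = (bracket x ^^ (j - M)) ((bracket x ^^ M) c)"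
      using that by (metis comp_apply funpow_add le_add_diff_inverse2)
    then show ?thesis by (simp add: u_def M funpow_bracket_zero)
  qed
  have bracket_sum: "bracket z (\<Sum>i\<in>A. f i) = (\<Sum>i\<in>A. bracket z (f i))" for z f and A :: "nat set"
    by (induction A rule: infinite_finite_induct) (simp_all add: bracket_add_right)
  have bracket_sum_left: "bracket (\<Sum>i\<in>A. f i) z = (\<Sum>i\<in>A. bracket (f i) z)" for z f and A :: "nat set"
    by (induction A rule: infinite_finite_induct) (simp_all add: bracket_add_left)
  \<comment> \<open>the coefficient of \<open>s ^ m\<close> in the sandwich equation for the curve\<close>
  have id: "(\<Sum>i\<le>m. G y i (m - i)) = 0" for m y
  proof (induction m arbitrary: y)
    case 0
    show ?case using c by (simp add: G_def u_def sandwich_def)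
  next
    case (Suc m)
    have xG: "bracket x (G y i j) = scale (of_nat (Suc i)) (G y (Suc i) j) + scale (of_nat (Suc j)) (G y i (Suc j))
        + G (bracket x y) i j" for i j
      by (simp only: G_def leibniz[of x "u i"] leibniz[of x "u j"] u_bracket bracket_add_right
          bracket_scale_left bracket_scale_right add.assoc)
    have "0 = bracket x (\<Sum>i\<le>m. G y i (m - i))" using Suc by simp
    also have "\<dots> = (\<Sum>i\<le>m. scale (of_nat (Suc i)) (G y (Suc i) (m - i))) + (\<Sum>i\<le>m. scale (of_nat (Suc (m - i))) (G y i (Suc (m - i))))
        + (\<Sum>i\<le>m. G (bracket x y) i (m - i))"
      by (simp only: bracket_sum xG sum.distrib)
    also have "(\<Sum>i\<le>m. G (bracket x y) i (m - i)) = 0" by (rule Suc)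
    also have "(\<Sum>i\<le>m. scale (of_nat (Suc i)) (G y (Suc i) (m - i))) = (\<Sum>i\<le>Suc m. scale (of_nat i) (G y i (Suc m - i)))"
      by (subst sum.atMost_Suc_shift) simp
    also have "(\<Sum>i\<le>m. scale (of_nat (Suc (m - i))) (G y i (Suc (m - i)))) = (\<Sum>i\<le>Suc m. scale (of_nat (Suc m - i)) (G y i (Suc m - i)))"
      by (simp add: Suc_diff_le del: of_nat_Suc of_nat_diff)
    also have "(\<Sum>i\<le>Suc m. scale (of_nat i) (G y i (Suc m - i))) + (\<Sum>i\<le>Suc m. scale (of_nat (Suc m - i)) (G y i (Suc m - i)))
        = (\<Sum>i\<le>Suc m. scale (of_nat (Suc m)) (G y i (Suc m - i)))"
      unfolding sum.distrib[symmetric]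
      by (intro sum.cong refl) (simp only: scale_left_distrib[symmetric] of_nat_add[symmetric] atMost_iff le_add_diff_inverse)
    finally have "scale (of_nat (Suc m)) (\<Sum>i\<le>Suc m. G y i (Suc m - i)) = 0" by (simp only: scale_sum_right add_0_right)
    then show ?case by (simp only: scale_eq_0_iff of_nat_eq_0_iff) simp
  qed
  have "sandwich (\<Sum>j<Suc (Suc M). scale (s ^ j) (u j))" for s
    unfolding sandwich_def
  proof
    fix y
    define N where "N = Suc (Suc M)"
    have "bracket (\<Sum>i<N. scale (s ^ i) (u i)) (bracket (\<Sum>j<N. scale (s ^ j) (u j)) y)
       = (\<Sum>i<N. \<Sum>j<N. scale (s ^ (i + j)) (G y i j))"
      by (simp only: bracket_sum_left)
         (simp add: bracket_sum bracket_scale_left bracket_scale_right G_def power_add scale_sum_right mult.commute)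
    also have "\<dots> = (\<Sum>(i, j)\<in>{..<N} \<times> {..<N}. scale (s ^ (i + j)) (G y i j))"
      by (simp only: sum.cartesian_product)
    also have "\<dots> = (\<Sum>(i, j)\<in>{(i, j). i + j < N + N}. scale (s ^ (i + j)) (G y i j))"
    proof (rule sum.mono_neutral_left)
      have "{(i, j). i + j < N + N} \<subseteq> {..<N + N} \<times> {..<N + N}" by auto
      then show "finite {(i, j). i + j < N + N}" by (rule finite_subset) simp
      show "\<forall>p\<in>{(i, j). i + j < N + N} - {..<N} \<times> {..<N}. (case p of (i, j) \<Rightarrow> scale (s ^ (i + j)) (G y i j)) = 0"
      proof
        fix p assume "p \<in> {(i, j). i + j < N + N} - {..<N} \<times> {..<N}"
        then obtain i j where p: "p = (i, j)" "N \<le> i \<or> N \<le> j" by (cases p) auto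
        then have "u i = 0 \<or> u j = 0" using u0 by (auto simp: N_def)
        then show "(case p of (i, j) \<Rightarrow> scale (s ^ (i + j)) (G y i j)) = 0" using p by (auto simp: G_def)
      qed
    qed auto
    also have "\<dots> = (\<Sum>k<N + N. \<Sum>i\<le>k. scale (s ^ (i + (k - i))) (G y i (k - i)))"
      by (rule sum.triangle_reindex)
    also have "\<dots> = (\<Sum>k<N + N. scale (s ^ k) (\<Sum>i\<le>k. G y i (k - i)))"
      unfolding scale_sum_right by (intro sum.cong) auto
    also have "\<dots> = 0" by (simp add: id)
    finally show "bracket (\<Sum>j<Suc (Suc M). scale (s ^ j) (u j)) (bracket (\<Sum>j<Suc (Suc M). scale (s ^ j) (u j)) y) = 0"
      by (simp add: N_def)
  qed
  then have "(\<Sum>j<Suc (Suc M). scale (s ^ j) (u j)) \<in> span {c. sandwich c}" for s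
    by (rule span_base[OF CollectI])
  then have "u 1 \<in> span {c. sandwich c}"
    by (rule poly_coeff_in_subspace[OF subspace_span, where n = "Suc (Suc M)" and c = u]) simp
  moreover have "u 1 = bracket x c" by (simp add: u_def)
  ultimately show ?thesis by (simp only:)
qed

text \<open>
  The vectors killed by \<open>R\<close> form an \<open>L\<close>-stable subspace. A nonzero complement would contain a nonzero
  vector killed by \<open>R\<close>, namely the last nonzero value of a word in \<open>R\<close>.
\<close>

lemma completely_reducible_trivial:
  assumes red: "completely_reducible L UNIV" and R: "R \<subseteq> L" "ad.nil R"
    and stab: "\<And>l r. l \<in> L \<Longrightarrow> r \<in> R \<Longrightarrow> bracket l r \<in> span R" and r: "r \<in> R"
  shows "bracket r x = 0"
proof -
  define K where "K = {x. \<forall>r\<in>R. bracket r x = 0}"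
  have sK: "subspace K" by (simp add: K_def subspace_def bracket_add_right bracket_scale_right)
  have spanK: "bracket s x = 0" if "s \<in> span R" "x \<in> K" for s x
  proof -
    have "bracket s x \<in> {0}"
      using that(2) by (intro bracket_span_left[OF subspace_single_0 _ that(1)]) (simp add: K_def)
    then show ?thesis by simp
  qed
  have "stable L K"
    unfolding stable_def
  proof (intro ballI)
    fix l x assume l: "l \<in> L" "x \<in> K"
    show "bracket l x \<in> K"
      unfolding K_def
    proof (intro CollectI ballI)
      fix r assume r: "r \<in> R"
      have "bracket l (bracket r x) = bracket (bracket l r) x + bracket r (bracket l x)" by (rule leibniz)
      moreover have "bracket (bracket l r) x = 0" by (rule spanK[OF stab[OF l(1) r] l(2)])
      moreover have "bracket r x = 0" using l r by (simp add: K_def)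
      ultimately show "bracket r (bracket l x) = 0" by simp
    qed
  qed
  then obtain K' where K': "subspace K'" "stable L K'" "direct_sum_of K K' UNIV"
    using red sK subset_UNIV unfolding completely_reducible_def by meson
  have int: "K \<inter> K' = {0}" and sum: "UNIV = {u + v | u v. u \<in> K \<and> v \<in> K'}"
    using K'(3) by (auto simp: direct_sum_of_def)
  have "K' = {0}"
  proof (rule ccontr)
    assume "K' \<noteq> {0}"
    then obtain x0 where x0: "x0 \<in> K'" "x0 \<noteq> 0" using subspace_0[OF K'(1)] by blast
    have "\<exists>z. z \<in> ad.words R k \<and> z \<in> K' \<and> z \<noteq> 0" for k
    proof (induction k)
      case 0 then show ?case using x0 by auto
    next
      case (Suc k)
      then obtain z where z: "z \<in> ad.words R k" "z \<in> K'" "z \<noteq> 0" by auto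
      then have "z \<notin> K" using int by auto
      then obtain r where r: "r \<in> R" "bracket r z \<noteq> 0" by (auto simp: K_def)
      have "bracket r z \<in> ad.words R (Suc k)" using r(1) z(1) by (rule ad.words_act)
      moreover have "bracket r z \<in> K'" using K'(2) R(1) r(1) z(2) unfolding stable_def by blast
      ultimately show ?case using r(2) by blast
    qed
    moreover obtain k where "ad.words R k = {0}" using R(2) unfolding ad.nil_def by blast
    ultimately show False by blast
  qed
  moreover obtain u v where "x = u + v" "u \<in> K" "v \<in> K'" using sum by blast
  ultimately have "x \<in> K" by simp
  then show ?thesis using r unfolding K_def by blast
qed

text \<open>
  The iterated brackets of \<open>c\<close> with elements of \<open>X\<close> span an ideal, which lies in the span of the
  sandwich elements; as these are weakly closed, the ideal acts nilpotently, so it acts trivially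
  on a completely reducible adjoint module. The elements of \<open>J\<close> may fail to be nilpotent, so that stability
  under them comes from their commuting with \<open>c\<close> and normalizing \<open>X\<close>.
\<close>

theorem sandwich_central:
  assumes red: "completely_reducible UNIV UNIV"
    and gen: "span (J \<union> X) = UNIV" and X: "\<And>x. x \<in> X \<Longrightarrow> ad_nilp x"
    and JX: "\<And>j x. j \<in> J \<Longrightarrow> x \<in> X \<Longrightarrow> bracket j x \<in> X"
    and c: "sandwich c" "\<And>j. j \<in> J \<Longrightarrow> bracket j c = 0"
  shows "bracket c y = 0"
proof -
  define Orb where "Orb = {foldr bracket xs c | xs. set xs \<subseteq> X}"
  have XS: "bracket x z \<in> span {c. sandwich c}" if "x \<in> X" "z \<in> span {c. sandwich c}" for x z
    by (rule bracket_span_right[OF subspace_span _ that(2)]) (simp add: sandwich_stable X that(1))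
  have Orb_S: "Orb \<subseteq> span {c. sandwich c}"
  proof -
    have "foldr bracket xs c \<in> span {c. sandwich c}" if "set xs \<subseteq> X" for xs
      using that by (induction xs) (auto intro: XS span_base c)
    then show ?thesis by (auto simp: Orb_def)
  qed
  have XO: "bracket x z \<in> Orb" if x: "x \<in> X" and z: "z \<in> Orb" for x z
  proof -
    obtain xs where "set xs \<subseteq> X" "z = foldr bracket xs c" using z by (auto simp: Orb_def)
    then show ?thesis unfolding Orb_def using x by (intro CollectI exI[of _ "x # xs"]) auto
  qed
  have XO': "bracket x z \<in> span Orb" if "x \<in> X" "z \<in> span Orb" for x z
    by (rule bracket_span_right[OF subspace_span _ that(2)]) (rule span_base[OF XO[OF that(1)]])
  have JO: "bracket j (foldr bracket xs c) \<in> span Orb" if "j \<in> J" "set xs \<subseteq> X" for j xs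
    using that(2)
  proof (induction xs)
    case Nil then show ?case using c(2) that span_zero by simp
  next
    case (Cons x xs)
    have "foldr bracket xs c \<in> Orb" using Cons by (auto simp: Orb_def)
    then have "bracket (bracket j x) (foldr bracket xs c) \<in> span Orb"
      using XO JX that Cons by (intro span_base) auto
    moreover have "bracket x (bracket j (foldr bracket xs c)) \<in> span Orb" using Cons XO' by auto
    ultimately show ?case using leibniz[of j x "foldr bracket xs c"] span_add by simp
  qed
  have stab: "bracket l z \<in> span Orb" if z: "z \<in> Orb" for l z
  proof (rule bracket_span_left[OF subspace_span])
    show "l \<in> span (J \<union> X)" using gen by simp
    fix w assume "w \<in> J \<union> X"
    moreover obtain xs where "set xs \<subseteq> X" "z = foldr bracket xs c" using z by (auto simp: Orb_def)
    ultimately show "bracket w z \<in> span Orb" using JO XO[OF _ z] span_base by blast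
  qed
  have "ad.nil {c. sandwich c}"
  proof (rule ad.nil_weakly_closed)
    fix x assume "x \<in> {c. sandwich c}"
    then have "\<forall>v. (bracket x ^^ 2) v = 0" by (simp add: sandwich_def numeral_2_eq_2)
    then show "\<exists>k. \<forall>v. (bracket x ^^ k) v = 0" by blast
  qed (auto simp: sandwich_bracket)
  then have "ad.nil Orb" by (rule ad.nil_mono_span[rotated 2]) (use Orb_S in auto)
  moreover have "c \<in> Orb" unfolding Orb_def by (intro CollectI exI[of _ "[]"]) auto
  ultimately show ?thesis
    using completely_reducible_trivial[OF red, of Orb c y] stab by auto
qed

text \<open>
  With \<open>Y\<close>, \<open>F\<close>, \<open>T\<close> the adjoint actions of \<open>y\<close>, \<open>f\<close>, \<open>t = [y, f]\<close>, the operators \<open>Y\<close> and \<open>T\<close> commute and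
  \<open>[Y ^ (n + 1), F] = (n + 1) Y ^ n T\<close>. If \<open>Y ^ (n + 1) T ^ K = 0\<close>, multiplying this by \<open>T ^ K\<close> on both sides
  gives \<open>Y ^ n T ^ (2 K + 1) = 0\<close>; so a power of \<open>T\<close> alone vanishes in the end.
\<close>

lemma jacobson_nilpotent:
  assumes y: "ad_nilp y" and comm: "bracket (bracket y f) y = 0"
  shows "ad_nilp (bracket y f)"
proof -
  define t where "t = bracket y f"
  have yt: "bracket y (bracket t v) = bracket t (bracket y v)" for v
    using leibniz[of t y v] comm by (simp add: t_def[symmetric])
  have ypt: "(bracket y ^^ n) (bracket t v) = bracket t ((bracket y ^^ n) v)" for n v
    by (induction n) (simp_all add: yt)
  have tpy: "(bracket y ^^ n) ((bracket t ^^ k) v) = (bracket t ^^ k) ((bracket y ^^ n) v)" for n k v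
    by (induction k) (simp_all add: ypt)
  have comm_pow: "(bracket y ^^ Suc n) (bracket f v)
      = bracket f ((bracket y ^^ Suc n) v) + scale (of_nat (Suc n)) (bracket t ((bracket y ^^ n) v))" for n v
  proof (induction n)
    case 0
    show ?case using leibniz[of y f v] by (simp add: t_def)
  next
    case (Suc n)
    have "(bracket y ^^ Suc (Suc n)) (bracket f v)
        = bracket y (bracket f ((bracket y ^^ Suc n) v) + scale (of_nat (Suc n)) (bracket t ((bracket y ^^ n) v)))"
      using Suc by simp
    also have "\<dots> = bracket t ((bracket y ^^ Suc n) v) + bracket f ((bracket y ^^ Suc (Suc n)) v)
        + scale (of_nat (Suc n)) (bracket t ((bracket y ^^ Suc n) v))"
      using leibniz[of y f "(bracket y ^^ Suc n) v"]
      by (simp add: bracket_add_right bracket_scale_right yt t_def[symmetric])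
    also have "\<dots> = bracket f ((bracket y ^^ Suc (Suc n)) v) + scale (1 + of_nat (Suc n)) (bracket t ((bracket y ^^ Suc n) v))"
      by (simp only: scale_left_distrib scale_one add_ac)
    finally show ?case by (simp only: of_nat_Suc[of "Suc n"])
  qed
  obtain M where M: "\<And>v. (bracket y ^^ M) v = 0" using y by (auto simp: ad_nilp_def)
  have "\<exists>K. \<forall>v. (bracket y ^^ (M - j)) ((bracket t ^^ K) v) = 0" if "j \<le> M" for j
    using that
  proof (induction j)
    case 0 then show ?case using M by auto
  next
    case (Suc j)
    define n where "n = M - Suc j"
    have n: "M - j = Suc n" using Suc.prems by (simp add: n_def)
    obtain K where K: "\<And>v. (bracket y ^^ Suc n) ((bracket t ^^ K) v) = 0" using Suc n by auto
    have "(bracket y ^^ n) ((bracket t ^^ (K + Suc K)) v) = 0" for v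
    proof -
      have "0 = (bracket y ^^ Suc n) ((bracket t ^^ K) (bracket f ((bracket t ^^ K) v)))" by (rule K[symmetric])
      also have "\<dots> = (bracket t ^^ K) ((bracket y ^^ Suc n) (bracket f ((bracket t ^^ K) v)))" by (rule tpy)
      also have "\<dots> = (bracket t ^^ K) (scale (of_nat (Suc n)) (bracket t ((bracket y ^^ n) ((bracket t ^^ K) v))))"
        by (simp only: comm_pow K bracket_zero_right add_0_left)
      also have "\<dots> = scale (of_nat (Suc n)) ((bracket t ^^ K) (bracket t ((bracket y ^^ n) ((bracket t ^^ K) v))))"
        by (rule funpow_bracket_scale)
      also have "bracket t ((bracket y ^^ n) ((bracket t ^^ K) v)) = (bracket t ^^ Suc K) ((bracket y ^^ n) v)"
        by (simp add: tpy)
      also have "(bracket t ^^ K) ((bracket t ^^ Suc K) ((bracket y ^^ n) v)) = (bracket t ^^ (K + Suc K)) ((bracket y ^^ n) v)"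
        by (simp only: funpow_add o_apply)
      also have "\<dots> = (bracket y ^^ n) ((bracket t ^^ (K + Suc K)) v)" by (rule tpy[symmetric])
      finally show ?thesis by (metis of_nat_eq_0_iff nat.distinct(1) scale_eq_0_iff)
    qed
    then show ?case unfolding n_def[symmetric] by blast
  qed
  from this[of M] show ?thesis by (auto simp: ad_nilp_def t_def)
qed

end

section \<open>Generalized weight spaces\<close>


context fd_complex_lie_algebra
begin

text \<open>
  Horner's scheme for a polynomial in the operator \<open>A\<close>, which suits induction over \<open>pCons\<close>.
\<close>

definition poly_op :: "('a \<Rightarrow> 'a) \<Rightarrow> complex poly \<Rightarrow> 'a \<Rightarrow> 'a" where
  "poly_op A p v = fold_coeffs (\<lambda>a w. scale a v + A w) p 0"

lemma poly_op_0 [simp]: "poly_op A 0 v = 0"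
  by (simp add: poly_op_def)

lemma poly_op_pCons:
  assumes "A 0 = 0" shows "poly_op A (pCons a p) v = scale a v + A (poly_op A p v)"
  using assms by (cases "p = 0 \<and> a = 0") (auto simp: poly_op_def)

text \<open>
  Some nonzero polynomial in \<open>A\<close> kills \<open>x\<close> by finite dimension, and over the complex numbers it splits
  into linear factors.
\<close>

lemma annihilating_list:
  assumes A: "\<And>u v. A (u + v) = A u + A v" "\<And>c v. A (scale c v) = scale c (A v)"
  shows "\<exists>ls. foldr (\<lambda>l v. A v - scale l v) ls x = 0"
proof -
  have A0: "A 0 = 0" using A(2)[of 0 0] by simp
  note [simp] = poly_op_pCons[where A = A, OF A0]
  have p_add: "poly_op A (p + q) v = poly_op A p v + poly_op A q v" for p q v
    by (induction p q rule: poly_induct2) (simp_all add: A scale_left_distrib algebra_simps)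
  have p_smult: "poly_op A (smult c p) v = scale c (poly_op A p v)" for c p v
    by (induction p) (simp_all add: A scale_right_distrib)
  have p_A: "poly_op A p (A v) = A (poly_op A p v)" for p v
    by (induction p) (simp_all add: A A0)
  have p_diff: "poly_op A p (u - v) = poly_op A p u - poly_op A p v" for p u v
  proof -
    have Ad: "A (u - v) = A u - A v" for u v using A(1)[of "u - v" v] by (simp add: eq_diff_eq)
    show ?thesis by (induction p) (simp_all add: Ad scale_right_diff_distrib)
  qed
  have p_sc: "poly_op A p (scale c v) = scale c (poly_op A p v)" for p c v
    by (induction p) (simp_all add: A scale_right_distrib mult.commute)
  have p_monom: "poly_op A (monom c j) v = scale c ((A ^^ j) v)" for c j v
    by (induction j) (simp_all add: monom_0 monom_Suc A A0)
  have p_factor: "poly_op A ([:- l, 1:] * q) v = poly_op A q (A v - scale l v)" for l q v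
  proof -
    have "[:- l, 1:] * q = smult (- l) q + pCons 0 q" by simp
    then show ?thesis by (simp only: p_add p_smult) (simp add: p_diff p_A p_sc)
  qed
  have main: "\<exists>ls. foldr (\<lambda>l v. A v - scale l v) ls x = 0" if "p \<noteq> 0" "poly_op A p x = 0" for p x
    using that
  proof (induction "degree p" arbitrary: p x)
    case 0
    then obtain a where "p = [:a:]" by (metis degree_eq_zeroE)
    then have "x = 0" using 0 by (simp add: A0)
    then show ?case by (intro exI[of _ "[]"]) simp
  next
    case (Suc n)
    have "\<not> constant (poly p)" using Suc.hyps(2) by (simp add: constant_degree)
    then obtain l where "poly p l = 0" using fundamental_theorem_of_algebra by blast
    then obtain q where q: "p = [:- l, 1:] * q" by (metis dvdE poly_eq_0_iff_dvd)
    have "q \<noteq> 0" using q Suc.prems by auto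
    then have "degree p = Suc (degree q)" unfolding q by (subst degree_mult_eq) auto
    then have "n = degree q" using Suc.hyps by simp
    moreover have "poly_op A q (A x - scale l x) = 0" using Suc.prems p_factor by (simp only: q)
    ultimately obtain ls where "foldr (\<lambda>l v. A v - scale l v) ls (A x - scale l x) = 0"
      using Suc.hyps(1) \<open>q \<noteq> 0\<close> by blast
    then show ?case by (intro exI[of _ "ls @ [l]"]) simp
  qed
  define Wk where "Wk k = span ((\<lambda>j. (A ^^ j) x) ` {..<k})" for k
  have "\<exists>k. (A ^^ k) x \<in> Wk k"
  proof (rule ccontr)
    assume "\<nexists>k. (A ^^ k) x \<in> Wk k"
    then have nin: "(A ^^ k) x \<notin> Wk k" for k by auto
    have "k \<le> dim (Wk k)" for k
    proof (induction k)
      case (Suc k)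
      have "Wk k \<subset> Wk (Suc k)"
        unfolding Wk_def using nin[of k] span_base[of "(A ^^ k) x"] unfolding Wk_def
        by (intro psubsetI span_mono) auto
      then have "dim (Wk k) < dim (Wk (Suc k))"
        using dim_psubset[of "Wk k" "Wk (Suc k)"] by (simp add: Wk_def span_span)
      then show ?case using Suc by simp
    qed simp
    from this[of "Suc dimension"] show False using dim_subset_UNIV[of "Wk (Suc dimension)"] by simp
  qed
  then obtain k where k: "(A ^^ k) x \<in> Wk k" by auto
  have "\<exists>q. (\<forall>i\<ge>k. coeff q i = 0) \<and> v = poly_op A q x" if "v \<in> Wk k" for v
    using that unfolding Wk_def
  proof (induction rule: span_induct_alt)
    case base
    show ?case by (intro exI[of _ 0]) simp
  next
    case (step c u y)
    then obtain q j where "\<forall>i\<ge>k. coeff q i = 0" "y = poly_op A q x" "j < k" "u = (A ^^ j) x" by blast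
    then show ?case
      by (intro exI[of _ "monom c j + q"]) (simp add: p_add p_monom coeff_monom)
  qed
  then obtain q where q: "\<forall>i\<ge>k. coeff q i = 0" "(A ^^ k) x = poly_op A q x" using k by blast
  define p where "p = monom 1 k + smult (- 1) q"
  have "coeff p k = 1" using q(1) by (simp add: p_def)
  then have "p \<noteq> 0" by auto
  moreover have "poly_op A p x = 0" using q(2) by (simp only: p_def p_add p_smult p_monom) simp
  ultimately show ?thesis by (rule main)
qed

end

locale abelian_subspace = fd_complex_lie_algebra scale bracket
  for scale :: "complex \<Rightarrow> 'a::ab_group_add \<Rightarrow> 'a" and bracket :: "'a \<Rightarrow> 'a \<Rightarrow> 'a" +
  fixes H :: "'a set"
  assumes subspace_H: "subspace H" and abelian: "x \<in> H \<Longrightarrow> y \<in> H \<Longrightarrow> bracket x y = 0"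
begin

lemma comm: "h \<in> H \<Longrightarrow> k \<in> H \<Longrightarrow> bracket h (bracket k x) = bracket k (bracket h x)"
  using leibniz[of h k x] abelian[of h k] by simp

definition shift :: "'a \<Rightarrow> complex \<Rightarrow> 'a \<Rightarrow> 'a" where
  "shift h a x = bracket h x - scale a x"

lemma shift_add: "shift h a (x + y) = shift h a x + shift h a y"
  by (simp add: shift_def bracket_add_right scale_right_distrib)

lemma shift_scale: "shift h a (scale c x) = scale c (shift h a x)"
  by (simp add: shift_def bracket_scale_right scale_right_diff_distrib mult.commute)

lemma shift_0 [simp]: "shift h a 0 = 0"
  by (simp add: shift_def)

lemma shift_comm: "h \<in> H \<Longrightarrow> k \<in> H \<Longrightarrow> shift h a (shift k b x) = shift k b (shift h a x)"
  by (simp add: shift_def bracket_diff_right bracket_scale_right comm scale_right_diff_distrib mult.commute algebra_simps)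

lemma shift_bracket_comm: "h \<in> H \<Longrightarrow> k \<in> H \<Longrightarrow> shift h a (bracket k x) = bracket k (shift h a x)"
  by (simp add: shift_def bracket_diff_right bracket_scale_right comm)

lemma shift_pow_0 [simp]: "(shift h a ^^ m) 0 = 0"
  by (induction m) simp_all

lemma shift_pow_add: "(shift h a ^^ m) (x + y) = (shift h a ^^ m) x + (shift h a ^^ m) y"
  by (induction m) (simp_all add: shift_add)

lemma shift_pow_scale: "(shift h a ^^ m) (scale c x) = scale c ((shift h a ^^ m) x)"
  by (induction m) (simp_all add: shift_scale)

lemma shift_pow_bracket: "h \<in> H \<Longrightarrow> k \<in> H \<Longrightarrow> (shift h a ^^ m) (bracket k x) = bracket k ((shift h a ^^ m) x)"
  by (induction m) (simp_all add: shift_bracket_comm)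

lemma shift_pow_mono:
  assumes "(shift h a ^^ m) x = 0" "m \<le> n" shows "(shift h a ^^ n) x = 0"
proof -
  have "(shift h a ^^ n) x = (shift h a ^^ (n - m)) ((shift h a ^^ m) x)"
    using assms(2) by (metis comp_apply funpow_add le_add_diff_inverse2)
  then show ?thesis using assms(1) by simp
qed

lemma stable_shift: "subspace W \<Longrightarrow> stable H W \<Longrightarrow> h \<in> H \<Longrightarrow> x \<in> W \<Longrightarrow> shift h a x \<in> W"
  unfolding shift_def stable_def by (blast intro: subspace_diff subspace_scale)

lemma stable_shift_pow: "subspace W \<Longrightarrow> stable H W \<Longrightarrow> h \<in> H \<Longrightarrow> x \<in> W \<Longrightarrow> (shift h a ^^ m) x \<in> W"
  by (induction m) (auto intro: stable_shift)

text \<open>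
  An eigenvector modulo \<open>b\<close>, which replaces eigenvectors in the quotient of \<open>Q\<close> by \<open>b\<close>. On a stable
  subspace of minimal dimension among those not contained in \<open>b\<close>, each \<open>h\<close> acts as a scalar modulo \<open>b\<close>: its
  eigenvectors modulo \<open>b\<close> form a stable subspace again.
\<close>

lemma common_eigenvector:
  assumes Q: "subspace Q" "stable H Q" and b: "subspace b" "stable H b" and nsub: "\<not> Q \<subseteq> b"
  shows "\<exists>y lam. y \<in> Q \<and> y \<notin> b \<and> (\<forall>h\<in>H. bracket h y - scale (lam h) y \<in> b)"
proof -
  define P where "P W \<longleftrightarrow> subspace W \<and> stable H W \<and> W \<subseteq> Q \<and> \<not> W \<subseteq> b" for W
  have "P Q" using assms by (simp add: P_def)
  then obtain W where W: "P W" and mn: "\<And>W'. P W' \<Longrightarrow> dim W \<le> dim W'"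
    using ex_has_least_nat[of P Q dim] by blast
  have sW: "subspace W" "stable H W" using W by (auto simp: P_def)
  have "\<exists>a. \<forall>x\<in>W. shift h a x \<in> b" if h: "h \<in> H" for h
  proof -
    obtain y where y: "y \<in> W" "y \<notin> b" using W by (auto simp: P_def)
    have "\<exists>ls. foldr (\<lambda>l v. bracket h v - scale l v) ls y = 0"
      by (rule annihilating_list) (simp_all add: bracket_add_right bracket_scale_right)
    then obtain ls where ls: "foldr (shift h) ls y = 0" by (auto simp: shift_def[abs_def])
    have "\<exists>z\<in>W. z \<notin> b \<and> (\<exists>a. shift h a z \<in> b)"
    proof (rule ccontr)
      assume neg: "\<not> ?thesis"
      have "foldr (shift h) ls y \<in> W \<and> foldr (shift h) ls y \<notin> b" for ls
        by (induction ls) (use y neg stable_shift[OF sW h] in auto)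
      then show False using ls subspace_0[OF b(1)] by metis
    qed
    then obtain z a where z: "z \<in> W" "z \<notin> b" "shift h a z \<in> b" by blast
    define W' where "W' = {x\<in>W. shift h a x \<in> b}"
    have "subspace W'"
      using sW(1) b(1) unfolding W'_def subspace_def by (simp add: shift_add shift_scale)
    moreover have "stable H W'"
      using sW(2) b(2) h unfolding W'_def stable_def by (simp add: shift_bracket_comm)
    ultimately have "P W'" using z W by (auto simp: P_def W'_def)
    then have "W' = W"
      using subspace_dim_equal[OF \<open>subspace W'\<close> sW(1)] mn by (auto simp: W'_def)
    then show ?thesis by (auto simp: W'_def)
  qed
  then obtain lam where "\<And>h x. h \<in> H \<Longrightarrow> x \<in> W \<Longrightarrow> shift h (lam h) x \<in> b" by metis
  moreover obtain y where "y \<in> W" "y \<notin> b" using W by (auto simp: P_def)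
  ultimately show ?thesis using W unfolding P_def shift_def by blast
qed

text \<open>
  Generalized weight spaces, because until \<open>gw_weight_space\<close> it is not known that \<open>H\<close> acts
  diagonalizably.
\<close>

definition gw :: "('a \<Rightarrow> complex) \<Rightarrow> 'a set" where
  "gw \<alpha> = {x. \<forall>h\<in>H. \<exists>m. (shift h (\<alpha> h) ^^ m) x = 0}"

lemma subspace_gw: "subspace (gw \<alpha>)"
  unfolding subspace_def
proof (intro conjI ballI allI)
  fix x y assume x: "x \<in> gw \<alpha>" and y: "y \<in> gw \<alpha>"
  show "x + y \<in> gw \<alpha>"
    unfolding gw_def
  proof (intro CollectI ballI)
    fix h assume h: "h \<in> H"
    obtain m n where "(shift h (\<alpha> h) ^^ m) x = 0" "(shift h (\<alpha> h) ^^ n) y = 0"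
      using x y h unfolding gw_def by blast
    then have "(shift h (\<alpha> h) ^^ max m n) (x + y) = 0"
      using shift_pow_mono by (simp add: shift_pow_add)
    then show "\<exists>m. (shift h (\<alpha> h) ^^ m) (x + y) = 0" ..
  qed
next
  show "0 \<in> gw \<alpha>" by (simp add: gw_def)
next
  fix c x assume "x \<in> gw \<alpha>"
  then show "scale c x \<in> gw \<alpha>" unfolding gw_def by (simp add: shift_pow_scale)
qed

lemma stable_gw: "stable H (gw \<alpha>)"
  unfolding stable_def
proof (intro ballI)
  fix k x assume k: "k \<in> H" and x: "x \<in> gw \<alpha>"
  show "bracket k x \<in> gw \<alpha>"
    unfolding gw_def
  proof (intro CollectI ballI)
    fix h assume h: "h \<in> H"
    then obtain m where "(shift h (\<alpha> h) ^^ m) x = 0" using x by (auto simp: gw_def)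
    then have "(shift h (\<alpha> h) ^^ m) (bracket k x) = 0" by (simp add: shift_pow_bracket h k)
    then show "\<exists>m. (shift h (\<alpha> h) ^^ m) (bracket k x) = 0" ..
  qed
qed

lemma weight_space_gw: "weight_space H \<alpha> \<subseteq> gw \<alpha>"
proof
  fix x assume x: "x \<in> weight_space H \<alpha>"
  have "(shift h (\<alpha> h) ^^ 1) x = 0" if "h \<in> H" for h
    using x that by (simp add: weight_space_def shift_def)
  then show "x \<in> gw \<alpha>" unfolding gw_def by blast
qed

lemma subspace_weight_space: "subspace (weight_space H \<alpha>)"
  unfolding weight_space_def subspace_def
  by (simp add: bracket_add_right bracket_scale_right scale_right_distrib mult.commute)

lemma gw_cong: "(\<And>h. h \<in> H \<Longrightarrow> \<alpha> h = \<beta> h) \<Longrightarrow> gw \<alpha> = gw \<beta>"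
  by (simp add: gw_def)

lemma weight_space_cong: "(\<And>h. h \<in> H \<Longrightarrow> \<alpha> h = \<beta> h) \<Longrightarrow> weight_space H \<alpha> = weight_space H \<beta>"
  by (simp add: weight_space_def)

lemma gw_bracket:
  assumes x: "x \<in> gw \<alpha>" and y: "y \<in> gw \<beta>"
  shows "bracket x y \<in> gw (\<lambda>h. \<alpha> h + \<beta> h)"
  unfolding gw_def
proof (intro CollectI ballI)
  fix h assume h: "h \<in> H"
  have step: "shift h (a + b) (bracket u v) = bracket (shift h a u) v + bracket u (shift h b v)" for a b u v
    using leibniz[of h u v]
    by (simp add: shift_def bracket_diff_left bracket_diff_right bracket_scale_left bracket_scale_right scale_left_distrib)
  have main: "(shift h (a + b) ^^ n) (bracket u v) = 0"
    if "(shift h a ^^ i) u = 0" "(shift h b ^^ j) v = 0" "i + j \<le> n" for n i j u v a b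
    using that
  proof (induction n arbitrary: i j u v)
    case 0 then show ?case by simp
  next
    case (Suc n)
    have a: "(shift h (a + b) ^^ n) (bracket (shift h a u) v) = 0"
    proof (cases i)
      case 0 then show ?thesis using Suc.prems by simp
    next
      case (Suc i')
      then have "(shift h a ^^ i') (shift h a u) = 0" using Suc.prems(1) by (simp add: funpow_swap1)
      then show ?thesis using Suc.IH[of i' "shift h a u" j v] Suc.prems Suc by simp
    qed
    have b: "(shift h (a + b) ^^ n) (bracket u (shift h b v)) = 0"
    proof (cases j)
      case 0 then show ?thesis using Suc.prems by simp
    next
      case (Suc j')
      then have "(shift h b ^^ j') (shift h b v) = 0" using Suc.prems(2) by (simp add: funpow_swap1)
      then show ?thesis using Suc.IH[of i u j' "shift h b v"] Suc.prems Suc by simp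
    qed
    show ?case using a b by (simp only: funpow_Suc_right o_apply step shift_pow_add add_0_left)
  qed
  obtain i j where "(shift h (\<alpha> h) ^^ i) x = 0" "(shift h (\<beta> h) ^^ j) y = 0"
    using x y h unfolding gw_def by blast
  then show "\<exists>m. (shift h (\<alpha> h + \<beta> h) ^^ m) (bracket x y) = 0" using main by blast
qed

lemma weight_space_bracket:
  assumes x: "x \<in> weight_space H \<alpha>" and y: "y \<in> weight_space H \<beta>"
  shows "bracket x y \<in> weight_space H (\<lambda>h. \<alpha> h + \<beta> h)"
  unfolding weight_space_def
proof (intro CollectI ballI)
  fix h assume "h \<in> H"
  then show "bracket h (bracket x y) = scale (\<alpha> h + \<beta> h) (bracket x y)"
    using x y leibniz[of h x y]
    by (simp add: weight_space_def bracket_scale_left bracket_scale_right scale_left_distrib)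
qed

lemma gw_shift_inj:
  assumes h: "h \<in> H" and x: "x \<in> gw \<alpha>" and a: "a \<noteq> \<alpha> h" and z: "shift h a x = 0"
  shows "x = 0"
proof -
  have "bracket h x = scale a x" using z by (simp add: shift_def)
  then have "shift h (\<alpha> h) x = scale (a - \<alpha> h) x" by (simp add: shift_def scale_left_diff_distrib)
  then have "(shift h (\<alpha> h) ^^ m) x = scale ((a - \<alpha> h) ^ m) x" for m
    by (induction m) (simp_all add: shift_scale mult.commute)
  moreover obtain m where "(shift h (\<alpha> h) ^^ m) x = 0" using x h by (auto simp: gw_def)
  ultimately show ?thesis using a by simp
qed

text \<open>
  An element of the span is killed by a product of operators \<open>shift h b\<close> with \<open>b \<noteq> \<alpha> h\<close>, each of which
  is injective on \<open>gw \<alpha>\<close>.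
\<close>

lemma gw_independent:
  assumes x: "x \<in> gw \<alpha>" and sp: "x \<in> span (\<Union>{gw \<beta> | \<beta>. \<exists>h\<in>H. \<beta> h \<noteq> \<alpha> h})"
  shows "x = 0"
proof -
  define ops where "ops ps v = foldr (\<lambda>(h, b). shift h b) ps v" for ps v
  define ok where "ok ps \<longleftrightarrow> (\<forall>(h, b)\<in>set ps. h \<in> H \<and> b \<noteq> \<alpha> h)" for ps
  define K where "K = {z. \<exists>ps. ok ps \<and> ops ps z = 0}"
  have ops_Cons: "ops ((h, b) # ps) v = shift h b (ops ps v)" and ops_Nil: "ops [] v = v" for h b ps v
    by (simp_all add: ops_def)
  have ops_append: "ops (ps @ qs) v = ops ps (ops qs v)" for ps qs v by (simp add: ops_def)
  have ops_0: "ops ps 0 = 0" for ps by (induction ps) (auto simp: ops_Cons ops_Nil)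
  have ops_add: "ops ps (u + v) = ops ps u + ops ps v" for ps u v
    by (induction ps) (auto simp: ops_Cons ops_Nil shift_add)
  have ops_scale: "ops ps (scale c v) = scale c (ops ps v)" for ps c v
    by (induction ps) (auto simp: ops_Cons ops_Nil shift_scale)
  have ops_shift: "ops ps (shift h b v) = shift h b (ops ps v)" if "ok ps" "h \<in> H" for ps h b v
    using that by (induction ps) (auto simp: ops_Cons ops_Nil ok_def shift_comm)
  have ops_comm: "ops ps (ops qs v) = ops qs (ops ps v)" if "ok ps" "ok qs" for ps qs v
    using that(2) by (induction qs) (auto simp: ops_Cons ops_Nil ok_def[of "_ # _"] ops_shift that(1), auto simp: ok_def)
  have "subspace K"
    unfolding subspace_def
  proof (intro conjI ballI allI)
    show "0 \<in> K" unfolding K_def by (intro CollectI exI[of _ "[]"]) (auto simp: ok_def ops_Nil)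
  next
    fix u v assume "u \<in> K" "v \<in> K"
    then obtain ps qs where "ok ps" "ops ps u = 0" "ok qs" "ops qs v = 0" by (auto simp: K_def)
    moreover from this have "ops (ps @ qs) (u + v) = 0"
      by (simp add: ops_append ops_add ops_0 ops_comm[of ps qs u])
    moreover have "ok (ps @ qs)" using calculation by (auto simp: ok_def)
    ultimately show "u + v \<in> K" unfolding K_def by blast
  next
    fix c u assume "u \<in> K"
    then show "scale c u \<in> K" unfolding K_def by (auto simp: ops_scale)
  qed
  moreover have "gw \<beta> \<subseteq> K" if bh: "h \<in> H" "\<beta> h \<noteq> \<alpha> h" for \<beta> h
  proof
    fix z assume "z \<in> gw \<beta>"
    then obtain m where m: "(shift h (\<beta> h) ^^ m) z = 0" using bh by (auto simp: gw_def)
    have "ops (replicate m (h, \<beta> h)) z = (shift h (\<beta> h) ^^ m) z" for m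
      by (induction m) (simp_all add: ops_Nil ops_Cons)
    moreover have "ok (replicate m (h, \<beta> h))" using bh by (auto simp: ok_def)
    ultimately show "z \<in> K" unfolding K_def using m by auto
  qed
  ultimately have "span (\<Union>{gw \<beta> | \<beta>. \<exists>h\<in>H. \<beta> h \<noteq> \<alpha> h}) \<subseteq> K" by (intro span_minimal) auto
  then obtain ps where ps: "ok ps" "ops ps x = 0" using sp by (auto simp: K_def)
  then show ?thesis using x
  proof (induction ps arbitrary: x rule: rev_induct)
    case Nil then show ?case by (simp add: ops_Nil)
  next
    case (snoc p ps)
    obtain h b where p: "p = (h, b)" by (cases p)
    have hb: "h \<in> H" "b \<noteq> \<alpha> h" and "ok ps" using snoc.prems by (auto simp: ok_def p)
    have "shift h b x \<in> gw \<alpha>" using stable_shift[OF subspace_gw stable_gw hb(1)] snoc.prems by blast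
    then have "shift h b x = 0"
      using snoc.IH[OF \<open>ok ps\<close>] snoc.prems by (simp add: ops_append p ops_Nil ops_Cons)
    then show ?case by (rule gw_shift_inj[OF hb(1) snoc.prems(3) hb(2)])
  qed
qed

lemma dim_image_less:
  assumes W: "subspace W" "stable H W" and h: "h \<in> H" and e: "e \<in> W" "e \<noteq> 0" "shift h a e = 0"
  shows "dim (shift h a ` W) < dim W"
proof -
  have "independent {e}" using e by simp
  then obtain Bs where Bs: "{e} \<subseteq> Bs" "Bs \<subseteq> W" "independent Bs" "W \<subseteq> span Bs"
    using maximal_independent_subset_extend[of "{e}" W] e by blast
  have fin: "finite Bs" using Bs finiteI_independent by blast
  have WB: "W = span Bs" using Bs W(1) span_minimal by blast
  have "W \<subseteq> {x. shift h a x \<in> span (shift h a ` (Bs - {e}))}"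
    unfolding WB
  proof (rule span_minimal)
    show "Bs \<subseteq> {x. shift h a x \<in> span (shift h a ` (Bs - {e}))}"
    proof
      fix x assume "x \<in> Bs"
      then show "x \<in> {x. shift h a x \<in> span (shift h a ` (Bs - {e}))}"
        using e(3) span_zero by (cases "x = e") (auto intro: span_base)
    qed
    show "subspace {x. shift h a x \<in> span (shift h a ` (Bs - {e}))}"
      unfolding subspace_def by (simp add: shift_add shift_scale span_zero span_add span_scale)
  qed
  then have "dim (shift h a ` W) \<le> card (shift h a ` (Bs - {e}))"
    using fin by (intro dim_le_card) auto
  also have "\<dots> \<le> card (Bs - {e})" using fin by (intro card_image_le) auto
  also have "\<dots> < card Bs" using fin Bs by (intro psubset_card_mono) auto
  also have "card Bs = dim W" using Bs basis_card_eq_dim by blast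
  finally show ?thesis .
qed

text \<open>
  Induction on the dimension. If some \<open>h\<close> has two eigenvalues on \<open>W\<close>, the Fitting decomposition of
  \<open>shift h a\<close>, for an eigenvalue \<open>a\<close>, splits \<open>W\<close> into two smaller stable subspaces.
\<close>

lemma gw_decomposition:
  assumes "subspace W" "stable H W"
  shows "W \<subseteq> span (\<Union>{W \<inter> gw \<alpha> | \<alpha>. True})"
  using assms
proof (induction "dim W" arbitrary: W rule: less_induct)
  case less
  note W = less.prems
  show ?case
  proof (cases "\<exists>\<alpha>. W \<subseteq> gw \<alpha>")
    case True
    then have "W \<subseteq> \<Union>{W \<inter> gw \<alpha> | \<alpha>. True}" by blast
    then show ?thesis using span_superset by (rule order_trans)
  next
    case False
    have "\<exists>h\<in>H. \<forall>a. \<not> (\<exists>d. \<forall>x\<in>W. (shift h a ^^ d) x = 0)"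
    proof (rule ccontr)
      assume "\<not> ?thesis"
      then have "\<forall>h. \<exists>a. h \<in> H \<longrightarrow> (\<exists>d. \<forall>x\<in>W. (shift h a ^^ d) x = 0)" by blast
      then obtain \<alpha> where "\<And>h. h \<in> H \<Longrightarrow> \<exists>d. \<forall>x\<in>W. (shift h (\<alpha> h) ^^ d) x = 0" by metis
      then have "W \<subseteq> gw \<alpha>" unfolding gw_def by blast
      then show False using False by blast
    qed
    then obtain h where h: "h \<in> H" and nn: "\<And>a d. \<exists>x\<in>W. (shift h a ^^ d) x \<noteq> 0" by blast
    obtain x0 where "x0 \<in> W" "x0 \<noteq> 0" using nn[of 0 0] by auto
    then have "\<not> W \<subseteq> {0}" by blast
    moreover have "stable H {0}" by (simp add: stable_def)
    ultimately obtain e lam where e: "e \<in> W" "e \<noteq> 0" "\<forall>h\<in>H. bracket h e - scale (lam h) e \<in> {0}"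
      using common_eigenvector[OF W subspace_single_0] by auto
    define T where "T = shift h (lam h)"
    have Te: "T e = 0" using e(3) h by (simp add: T_def shift_def)
    define I where "I k = (T ^^ k) ` W" for k
    have T_W: "(T ^^ k) x \<in> W" if "x \<in> W" for k x
      unfolding T_def using stable_shift_pow[OF W h that] .
    have sI: "subspace (I k)" for k
      unfolding subspace_def I_def
    proof (intro conjI ballI allI)
      show "0 \<in> (T ^^ k) ` W" using subspace_0[OF W(1)] by (force simp: T_def)
      show "u + v \<in> (T ^^ k) ` W" if "u \<in> (T ^^ k) ` W" "v \<in> (T ^^ k) ` W" for u v
        using that subspace_add[OF W(1)] by (auto simp: T_def shift_pow_add[symmetric])
      show "scale c u \<in> (T ^^ k) ` W" if "u \<in> (T ^^ k) ` W" for c u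
        using that subspace_scale[OF W(1)] by (auto simp: T_def shift_pow_scale[symmetric])
    qed
    have stI: "stable H (I k)" for k
      using W(2) h unfolding stable_def I_def by (auto simp: T_def shift_pow_bracket[symmetric])
    have I_mono: "I (k + j) \<subseteq> I k" for k j
      using T_W by (auto simp: I_def funpow_add)
    obtain d where d: "\<And>k. dim (I d) \<le> dim (I k)"
      using ex_has_least_nat[of "\<lambda>_. True" 0 "\<lambda>k. dim (I k)"] by auto
    define D where "D = Suc d"
    have "dim (I D) \<le> dim (I k)" for k
      using d[of k] dim_subset[OF I_mono[of d 1]] by (simp add: D_def)
    then have "I (D + D) = I D" by (intro subspace_dim_equal sI I_mono)
    define Kr where "Kr = {x\<in>W. (T ^^ D) x = 0}"
    have sK: "subspace Kr" using W(1) unfolding Kr_def subspace_def T_def by (simp add: shift_pow_add shift_pow_scale)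
    have stK: "stable H Kr" using W(2) h unfolding Kr_def stable_def T_def by (simp add: shift_pow_bracket)
    obtain x1 where "x1 \<in> W" "(T ^^ D) x1 \<noteq> 0" using nn[where d = D and a = "lam h"] by (auto simp: T_def)
    then have "Kr \<subset> W" by (auto simp: Kr_def)
    then have dK: "dim Kr < dim W" using dim_psubset[of Kr W] sK W(1) span_eq_iff by metis
    have "dim (I D) \<le> dim (I 1)" using dim_subset[OF I_mono[of 1 d]] by (simp add: D_def)
    also have "\<dots> < dim W"
      using dim_image_less[OF W h e(1,2), of "lam h"] Te by (simp add: I_def T_def)
    finally have dI: "dim (I D) < dim W" .
    have sub: "span (\<Union>{W' \<inter> gw \<alpha> | \<alpha>. True}) \<subseteq> span (\<Union>{W \<inter> gw \<alpha> | \<alpha>. True})" if "W' \<subseteq> W" for W'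
      using that by (intro span_mono) blast
    have K1: "Kr \<subseteq> span (\<Union>{W \<inter> gw \<alpha> | \<alpha>. True})"
      using less.hyps[OF dK sK stK] sub[of Kr] by (auto simp: Kr_def)
    have I_W: "I D \<subseteq> W" using T_W by (auto simp: I_def)
    have I1: "I D \<subseteq> span (\<Union>{W \<inter> gw \<alpha> | \<alpha>. True})"
      using less.hyps[OF dI sI stI] sub[OF I_W] by blast
    show ?thesis
    proof
      fix w assume w: "w \<in> W"
      then have "(T ^^ D) w \<in> I (D + D)" unfolding \<open>I (D + D) = I D\<close> by (simp add: I_def)
      then obtain w' where w': "w' \<in> W" "(T ^^ D) w = (T ^^ D) ((T ^^ D) w')" by (auto simp: I_def funpow_add)
      have "(T ^^ D) (w + scale (-1) ((T ^^ D) w')) = 0"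
        using w'(2) by (simp only: T_def shift_pow_add shift_pow_scale) simp
      moreover have "w + scale (-1) ((T ^^ D) w') \<in> W"
        using w T_W[OF w'(1)] W(1) by (intro subspace_add subspace_scale)
      ultimately have "w + scale (-1) ((T ^^ D) w') \<in> Kr" by (simp add: Kr_def)
      moreover have "(T ^^ D) w' \<in> I D" using w' by (simp add: I_def)
      ultimately have "(w + scale (-1) ((T ^^ D) w')) + (T ^^ D) w' \<in> span (\<Union>{W \<inter> gw \<alpha> | \<alpha>. True})"
        using K1 I1 by (blast intro: span_add)
      then show "w \<in> span (\<Union>{W \<inter> gw \<alpha> | \<alpha>. True})" by simp
    qed
  qed
qed

lemma UNIV_gw: "span (\<Union>{gw \<alpha> | \<alpha>. True}) = UNIV"
  using gw_decomposition[of UNIV] by (simp add: subspace_UNIV stable_def top.extremum_unique)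

lemma finite_eigenvalues:
  assumes h: "h \<in> H"
  shows "\<exists>ls. \<forall>x. foldr (shift h) ls x = 0"
proof -
  have add: "foldr (shift h) ls (u + v) = foldr (shift h) ls u + foldr (shift h) ls v" for ls u v
    by (induction ls) (simp_all add: shift_add)
  have scl: "foldr (shift h) ls (scale c v) = scale c (foldr (shift h) ls v)" for ls c v
    by (induction ls) (simp_all add: shift_scale)
  have z: "foldr (shift h) ls 0 = 0" for ls by (induction ls) simp_all
  have swap: "foldr (shift h) ks (shift h a v) = shift h a (foldr (shift h) ks v)" for ks a v
    by (induction ks) (simp_all add: shift_comm[OF h h])
  have comm': "foldr (shift h) ls (foldr (shift h) ks v) = foldr (shift h) ks (foldr (shift h) ls v)" for ls ks v
    by (induction ls) (simp_all add: swap)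
  have "\<exists>ls. \<forall>x\<in>F. foldr (shift h) ls x = 0" if "finite F" for F
    using that
  proof (induction F)
    case (insert x F)
    then obtain ls where ls: "\<forall>x\<in>F. foldr (shift h) ls x = 0" by blast
    have "\<exists>ls. foldr (\<lambda>l v. bracket h v - scale l v) ls x = 0"
      by (rule annihilating_list) (simp_all add: bracket_add_right bracket_scale_right)
    then obtain ks where ks: "foldr (shift h) ks x = 0" by (auto simp: shift_def[abs_def])
    have "foldr (shift h) (ls @ ks) x = 0" using ks by (simp add: z)
    moreover have "foldr (shift h) (ls @ ks) y = 0" if "y \<in> F" for y
      using ls that comm'[of ls ks y] by (simp add: z)
    ultimately have "\<forall>y\<in>insert x F. foldr (shift h) (ls @ ks) y = 0" by blast
    then show ?case by blast
  qed simp
  then obtain ls where ls: "\<And>x. x \<in> some_basis \<Longrightarrow> foldr (shift h) ls x = 0" using some_basis by blast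
  have "subspace {x. foldr (shift h) ls x = 0}" by (simp add: subspace_def add scl z)
  then have "span some_basis \<subseteq> {x. foldr (shift h) ls x = 0}" using ls by (intro span_minimal) auto
  then show ?thesis using some_basis by auto
qed

lemma gw_finite_values:
  assumes h: "h \<in> H"
  shows "\<exists>F. finite F \<and> (\<forall>\<alpha> x. x \<in> gw \<alpha> \<longrightarrow> x \<noteq> 0 \<longrightarrow> \<alpha> h \<in> F)"
proof -
  obtain ls where ls: "\<And>x. foldr (shift h) ls x = 0" using finite_eigenvalues[OF h] by blast
  have "\<alpha> h \<in> set ls" if x: "x \<in> gw \<alpha>" "x \<noteq> 0" for \<alpha> x
  proof (rule ccontr)
    assume "\<alpha> h \<notin> set ls"
    then have "foldr (shift h) ls x \<in> gw \<alpha> \<and> foldr (shift h) ls x \<noteq> 0"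
    proof (induction ls)
      case (Cons a ls)
      then show ?case
        using gw_shift_inj[OF h, of "foldr (shift h) ls x" \<alpha> a] stable_shift[OF subspace_gw stable_gw h] by auto
    qed (use x in simp)
    then show False using ls by simp
  qed
  then show ?thesis by (intro exI[of _ "set ls"]) auto
qed

text \<open>
  The action of \<open>x\<close> translates weights by \<open>\<alpha>\<close>, and \<open>h\<close> has finitely many eigenvalues.
\<close>

lemma gw_ad_nilp:
  assumes x: "x \<in> gw \<alpha>" and h: "h \<in> H" "\<alpha> h \<noteq> 0"
  shows "ad_nilp x"
proof -
  obtain F where F: "finite F" "\<And>\<beta> z. z \<in> gw \<beta> \<Longrightarrow> z \<noteq> 0 \<Longrightarrow> \<beta> h \<in> F" using gw_finite_values[OF h(1)] by blast
  define N where "N = card F"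
  have "(bracket x ^^ N) z = 0" if z: "z \<in> gw \<beta>" for \<beta> z
  proof (rule ccontr)
    assume nz: "(bracket x ^^ N) z \<noteq> 0"
    have inG: "(bracket x ^^ j) z \<in> gw (\<lambda>h. \<beta> h + of_nat j * \<alpha> h)" for j
    proof (induction j)
      case (Suc j)
      then show ?case using gw_bracket[OF x Suc] by (simp add: algebra_simps)
    qed (use z in simp)
    have "(bracket x ^^ j) z \<noteq> 0" if "j \<le> N" for j
    proof
      assume "(bracket x ^^ j) z = 0"
      moreover have "(bracket x ^^ N) z = (bracket x ^^ (N - j)) ((bracket x ^^ j) z)"
        using that by (metis comp_apply funpow_add le_add_diff_inverse2)
      ultimately show False using nz by (simp add: funpow_bracket_zero)
    qed
    then have "(\<lambda>j. \<beta> h + of_nat j * \<alpha> h) ` {..N} \<subseteq> F" using F(2)[OF inG] by auto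
    then have "card ((\<lambda>j. \<beta> h + of_nat j * \<alpha> h) ` {..N}) \<le> N" unfolding N_def using F(1) card_mono by blast
    moreover have "inj_on (\<lambda>j. \<beta> h + of_nat j * \<alpha> h) {..N}" using h(2) by (auto simp: inj_on_def)
    ultimately show False by (simp add: card_image)
  qed
  then have "\<Union>{gw \<beta> | \<beta>. True} \<subseteq> {z. (bracket x ^^ N) z = 0}" by blast
  moreover have "subspace {z. (bracket x ^^ N) z = 0}"
    unfolding subspace_def by (simp add: funpow_bracket_zero funpow_bracket_add funpow_bracket_scale)
  ultimately have "span (\<Union>{gw \<beta> | \<beta>. True}) \<subseteq> {z. (bracket x ^^ N) z = 0}" by (rule span_minimal)
  then show ?thesis unfolding ad_nilp_def UNIV_gw by blast
qed

lemma weight_vector_exists: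
  assumes W: "subspace W" "stable H W" "W \<subseteq> gw \<alpha>" and x: "x \<in> W" "x \<noteq> 0"
  obtains e where "e \<in> W" "e \<noteq> 0" "e \<in> weight_space H \<alpha>"
proof -
  have "\<not> W \<subseteq> {0}" using x by blast
  moreover have "stable H {0}" by (simp add: stable_def)
  ultimately obtain e lam where e: "e \<in> W" "e \<noteq> 0" "\<forall>h\<in>H. bracket h e - scale (lam h) e \<in> {0}"
    using common_eigenvector[OF W(1,2) subspace_single_0] by auto
  have "lam h = \<alpha> h" if h: "h \<in> H" for h
    using gw_shift_inj[OF h, of e \<alpha> "lam h"] e W(3) h by (auto simp: shift_def)
  then have "e \<in> weight_space H \<alpha>" using e(3) by (simp add: weight_space_def)
  then show ?thesis using that e by blast
qed

lemma ad_nilp_weight_zero: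
  assumes t: "t \<in> H" "ad_nilp t" and x: "x \<in> gw \<alpha>" "x \<noteq> 0"
  shows "\<alpha> t = 0"
proof -
  obtain e where e: "e \<noteq> 0" "e \<in> weight_space H \<alpha>"
    using weight_vector_exists[OF subspace_gw stable_gw order.refl x] by blast
  have "(bracket t ^^ k) e = scale (\<alpha> t ^ k) e" for k
    using e(2) t(1) by (induction k) (simp_all add: weight_space_def bracket_scale_right mult.commute)
  moreover obtain k where "(bracket t ^^ k) e = 0" using t by (auto simp: ad_nilp_def)
  ultimately show ?thesis using e by simp
qed

end

section \<open>Derived algebras and a lowest weight argument\<close>


context fd_complex_lie_algebra
begin

lemma brackets_mono: "U \<subseteq> U' \<Longrightarrow> V \<subseteq> V' \<Longrightarrow> brackets U V \<subseteq> brackets U' V'"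
  unfolding brackets_def by (intro span_mono) blast

lemma bracket_in_brackets: "x \<in> U \<Longrightarrow> y \<in> V \<Longrightarrow> bracket x y \<in> brackets U V"
  unfolding brackets_def by (intro span_base) blast

lemma brackets_subset:
  assumes "subspace W" "\<And>x y. x \<in> U \<Longrightarrow> y \<in> V \<Longrightarrow> bracket x y \<in> W"
  shows "brackets U V \<subseteq> W"
  unfolding brackets_def using assms by (intro span_minimal) auto

abbreviation derived :: "nat \<Rightarrow> 'a set \<Rightarrow> 'a set" where
  "derived k L \<equiv> ((\<lambda>U. brackets U U) ^^ k) L"

lemma derived_mono: "L \<subseteq> L' \<Longrightarrow> derived k L \<subseteq> derived k L'"
  by (induction k) (auto simp: brackets_mono)

lemma zero_in_derived: "0 \<in> L \<Longrightarrow> 0 \<in> derived k L"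
  by (induction k) (auto simp: brackets_def span_zero)

lemma solvable_derived:
  assumes "solvable b" "derived j L \<subseteq> b" "0 \<in> L" shows "solvable L"
proof -
  obtain k where k: "derived k b = {0}" using assms(1) by (auto simp: solvable_def)
  have "derived (k + j) L \<subseteq> derived k b"
    using derived_mono[OF assms(2), of k] by (simp add: funpow_add)
  then have "derived (k + j) L = {0}" using k zero_in_derived[OF assms(3), of "k + j"] by blast
  then show ?thesis unfolding solvable_def by blast
qed

text \<open>
  A complement of the center is an ideal, and it contains all brackets.
\<close>

lemma central_commutator_zero:
  assumes red: "completely_reducible UNIV UNIV"
    and z: "\<And>y. bracket z y = 0" "z \<in> brackets UNIV UNIV"
  shows "z = 0"
proof -
  define Z where "Z = {z. \<forall>y. bracket z y = 0}"
  have "subspace Z" unfolding Z_def subspace_def by (simp add: bracket_add_left bracket_scale_left)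
  moreover have "stable UNIV Z"
    unfolding stable_def
  proof (intro ballI)
    fix x w assume w: "w \<in> Z"
    have "bracket x w = 0" using w bracket_swap[of x w] by (simp add: Z_def)
    then show "bracket x w \<in> Z" by (simp add: Z_def)
  qed
  ultimately obtain W where W: "subspace W" "stable UNIV W" "direct_sum_of Z W UNIV"
    using red subset_UNIV unfolding completely_reducible_def by meson
  have "bracket x y \<in> W" for x y
  proof -
    have "UNIV = {u + v | u v. u \<in> Z \<and> v \<in> W}" using W(3) unfolding direct_sum_of_def by simp
    then have split: "\<exists>u v. w = u + v \<and> u \<in> Z \<and> v \<in> W" for w by blast
    obtain a b c d where ab: "x = a + b" "a \<in> Z" "b \<in> W" "y = c + d" "c \<in> Z" "d \<in> W"
      using split[of x] split[of y] by blast
    have "bracket b c = 0" using ab bracket_swap[of b c] by (simp add: Z_def)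
    then have "bracket x y = bracket b d"
      using ab by (simp add: bracket_add_left bracket_add_right Z_def)
    then show ?thesis using W(2) ab by (simp add: stable_def)
  qed
  then have "brackets UNIV UNIV \<subseteq> W" using W(1) by (intro brackets_subset)
  moreover have "z \<in> Z" using z by (simp add: Z_def)
  ultimately show ?thesis using W(3) z(2) unfolding direct_sum_of_def by blast
qed

lemma ad_nilp_0: "ad_nilp 0"
  unfolding ad_nilp_def by (intro exI[of _ 1]) simp

end

context abelian_subspace
begin

abbreviation nonzero_wt :: "('a \<Rightarrow> complex) \<Rightarrow> bool" where
  "nonzero_wt \<alpha> \<equiv> \<exists>h\<in>H. \<alpha> h \<noteq> 0"

text \<open>
  Applying \<open>shift h (\<alpha> h)\<close> to a sum of weight vectors removes the component of weight \<open>\<alpha>\<close>; what is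
  left has both weight \<open>\<alpha>\<close> and only other weights.
\<close>

lemma weight_space_of_gw:
  assumes x: "x \<in> gw \<alpha>" and sp: "x \<in> span (\<Union>{weight_space H \<beta> | \<beta>. True})"
  shows "x \<in> weight_space H \<alpha>"
  unfolding weight_space_def
proof (intro CollectI ballI)
  fix h assume h: "h \<in> H"
  define N where "N = span (\<Union>{gw \<beta> | \<beta>. \<exists>h\<in>H. \<beta> h \<noteq> \<alpha> h})"
  have "span (\<Union>{weight_space H \<beta> | \<beta>. True}) \<subseteq> {x. shift h (\<alpha> h) x \<in> N}"
  proof (rule span_minimal)
    show "subspace {x. shift h (\<alpha> h) x \<in> N}"
      unfolding subspace_def N_def by (simp add: shift_add shift_scale span_zero span_add span_scale)
    show "\<Union>{weight_space H \<beta> | \<beta>. True} \<subseteq> {x. shift h (\<alpha> h) x \<in> N}"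
    proof
      fix y assume "y \<in> \<Union>{weight_space H \<beta> | \<beta>. True}"
      then obtain \<beta> where y: "y \<in> weight_space H \<beta>" by blast
      show "y \<in> {x. shift h (\<alpha> h) x \<in> N}"
      proof (cases "\<exists>h\<in>H. \<beta> h \<noteq> \<alpha> h")
        case True
        have "shift h (\<alpha> h) y \<in> gw \<beta>"
          using stable_shift[OF subspace_gw stable_gw h] weight_space_gw y by blast
        then show ?thesis unfolding N_def using True by (intro CollectI span_base) blast
      next
        case False
        then have "shift h (\<alpha> h) y = 0" using y h by (simp add: shift_def weight_space_def)
        then show ?thesis by (simp add: N_def span_zero)
      qed
    qed
  qed
  then have "shift h (\<alpha> h) x \<in> N" using sp by blast
  moreover have "shift h (\<alpha> h) x \<in> gw \<alpha>" using stable_shift[OF subspace_gw stable_gw h x] .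
  ultimately have "shift h (\<alpha> h) x = 0" unfolding N_def by (intro gw_independent)
  then show "bracket h x = scale (\<alpha> h) x" by (simp add: shift_def)
qed

lemma weight_linear:
  assumes "e \<in> weight_space H \<alpha>" "e \<noteq> 0" "h \<in> H" "k \<in> H"
  shows "\<alpha> (h - scale c k) = \<alpha> h - c * \<alpha> k"
proof -
  have hk: "h - scale c k \<in> H" by (intro subspace_diff subspace_scale subspace_H assms)
  have e: "bracket u e = scale (\<alpha> u) e" if "u \<in> H" for u using assms(1) that by (simp add: weight_space_def)
  have "scale (\<alpha> (h - scale c k)) e = bracket (h - scale c k) e" by (rule e[OF hk, symmetric])
  also have "\<dots> = scale (\<alpha> h - c * \<alpha> k) e"
    by (simp add: bracket_diff_left bracket_scale_left e assms(3,4) scale_left_diff_distrib)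
  finally show ?thesis using assms(2) by simp
qed

lemma gw_H: "h \<in> H \<Longrightarrow> x \<in> gw \<alpha> \<Longrightarrow> bracket h x \<in> gw \<alpha>"
  using stable_gw[of \<alpha>] unfolding stable_def by blast

text \<open>
  If \<open>y\<close> kills a nonzero element of \<open>gw \<alpha>\<close> it kills a weight vector \<open>e\<close>, which is a lowest weight vector
  of positive weight for the would-be triple \<open>y\<close>, \<open>t = [y, f]\<close>, \<open>f\<close>. Then \<open>[y, f ^ (k + 1) e]\<close> is a nonzero
  multiple of \<open>f ^ k e\<close>, so that no \<open>f ^ k e\<close> vanishes, contradicting nilpotency of \<open>f\<close>.
  As \<open>f\<close> is only a generalized weight vector, \<open>[t, f]\<close> differs from \<open>\<alpha> t\<close> times \<open>f\<close> by an element of the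
  kernel \<open>G\<close> of \<open>y\<close> in \<open>gw \<alpha>\<close>. The identities therefore hold modulo the span \<open>U k\<close> of the words of length \<open>k\<close>
  in \<open>f\<close> and \<open>G\<close> that have a letter from \<open>G\<close>, and what is proved is that \<open>f ^ k e\<close> is not in \<open>U k\<close>.
\<close>

lemma lowest_weight_injective:
  assumes y: "y \<in> weight_space H (\<lambda>h. - \<alpha> h)" and f: "f \<in> gw \<alpha>"
    and t: "bracket y f \<in> H" "\<alpha> (bracket y f) \<noteq> 0"
    and g: "g \<in> gw \<alpha>" "bracket y g = 0"
  shows "g = 0"
proof (rule ccontr)
  assume "g \<noteq> 0"
  define tt where "tt = bracket y f"
  define a where "a = \<alpha> tt"
  have tH: "tt \<in> H" and a0: "a \<noteq> 0" using t by (simp_all add: tt_def a_def)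
  define G where "G = {g\<in>gw \<alpha>. bracket y g = 0}"
  have sG: "subspace G" using subspace_gw[of \<alpha>] unfolding G_def subspace_def by (simp add: bracket_add_right bracket_scale_right)
  have hy: "bracket h y = scale (- \<alpha> h) y" if "h \<in> H" for h using y that by (simp add: weight_space_def)
  have yt: "bracket y tt = scale a y" using hy[OF tH] bracket_swap[of y tt] by (simp add: a_def)
  have HG: "bracket h u \<in> G" if "h \<in> H" "u \<in> G" for h u
  proof -
    have "bracket y (bracket h u) = - bracket (bracket h y) u"
      using leibniz[of h y u] that by (simp add: G_def add_eq_0_iff)
    also have "\<dots> = 0" using that hy[OF that(1)] by (simp add: bracket_minus_left bracket_scale_left G_def)
    finally show ?thesis using gw_H[OF that(1), of u \<alpha>] that(2) by (simp add: G_def)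
  qed
  then have "stable H G" by (simp add: stable_def)
  then obtain e where e: "e \<in> G" "e \<noteq> 0" "e \<in> weight_space H \<alpha>"
    using weight_vector_exists[OF sG, of \<alpha> g] \<open>g \<noteq> 0\<close> g by (auto simp: G_def)
  have te: "bracket tt e = scale a e" using e(3) tH by (simp add: weight_space_def a_def)
  have ye: "bracket y e = 0" using e by (simp add: G_def)
  define g1 where "g1 = bracket tt f - scale a f"
  have g1: "g1 \<in> G"
  proof -
    have "g1 \<in> gw \<alpha>" unfolding g1_def by (intro subspace_diff subspace_scale subspace_gw gw_H tH f)
    moreover have "bracket y g1 = 0"
      using leibniz[of y tt f] by (simp add: g1_def bracket_diff_right bracket_scale_right yt bracket_scale_left
          tt_def[symmetric] bracket_self)
    ultimately show ?thesis by (simp add: G_def)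
  qed
  have tf: "bracket tt f = scale a f + g1" by (simp add: g1_def)
  define F where "F k = (bracket f ^^ k) e" for k
  have F0: "F 0 = e" and FS: "F (Suc k) = bracket f (F k)" for k by (simp_all add: F_def)
  define step where "step k A = span ({bracket f u | u. u \<in> A} \<union> {bracket g (F k) | g. g \<in> G} \<union> {bracket g u | g u. g \<in> G \<and> u \<in> A})" for k A
  define U where "U = rec_nat {0} step"
  have U0: "U 0 = {0}" and US: "U (Suc k) = step k (U k)" for k by (simp_all add: U_def)
  have sU: "subspace (U k)" for k by (cases k) (auto simp: U0 US step_def subspace_single_0)
  have fU: "bracket f u \<in> U (Suc k)" if "u \<in> U k" for u k
    unfolding US step_def using that by (intro span_base) blast
  have gF: "bracket g (F k) \<in> U (Suc k)" if "g \<in> G" for g k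
    unfolding US step_def using that by (intro span_base) blast
  have gU: "bracket g u \<in> U (Suc k)" if "g \<in> G" "u \<in> U k" for g u k
    unfolding US step_def using that by (intro span_base) blast
  have U_induct: "U (Suc k) \<subseteq> W" if "subspace W" "\<And>u. u \<in> U k \<Longrightarrow> bracket f u \<in> W"
     "\<And>g. g \<in> G \<Longrightarrow> bracket g (F k) \<in> W" "\<And>g u. g \<in> G \<Longrightarrow> u \<in> U k \<Longrightarrow> bracket g u \<in> W" for W k
    unfolding US step_def using that by (intro span_minimal) blast+
  have tF: "\<exists>u\<in>U k. bracket tt (F k) = scale (of_nat (Suc k) * a) (F k) + u"
    and tU: "\<forall>u\<in>U k. bracket tt u \<in> U k" for k
  proof (induction k)
    case 0
    show "\<exists>u\<in>U 0. bracket tt (F 0) = scale (of_nat (Suc 0) * a) (F 0) + u" by (simp add: U0 F0 te)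
    show "\<forall>u\<in>U 0. bracket tt u \<in> U 0" by (simp add: U0)
  next
    case (Suc k)
    obtain u where u: "u \<in> U k" "bracket tt (F k) = scale (of_nat (Suc k) * a) (F k) + u" using Suc by blast
    have SS: "scale (of_nat (Suc (Suc k)) * a) v = scale a v + scale (of_nat (Suc k) * a) v" for v
      by (simp only: of_nat_Suc[of "Suc k"] distrib_right mult_1 scale_left_distrib)
    have tg: "bracket tt (bracket g v) = bracket (bracket tt g) v + bracket g (bracket tt v)" for g v by (rule leibniz)
    have "bracket tt (F (Suc k)) = scale (of_nat (Suc (Suc k)) * a) (F (Suc k)) + (bracket g1 (F k) + bracket f u)"
      unfolding FS tg[of f] tf u(2)
      by (simp only: SS bracket_add_left bracket_add_right bracket_scale_left bracket_scale_right add_ac)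
    moreover have "bracket g1 (F k) + bracket f u \<in> U (Suc k)"
      by (rule subspace_add[OF sU gF[OF g1] fU[OF u(1)]])
    ultimately show "\<exists>u\<in>U (Suc k). bracket tt (F (Suc k)) = scale (of_nat (Suc (Suc k)) * a) (F (Suc k)) + u" by blast
    have "U (Suc k) \<subseteq> {v. bracket tt v \<in> U (Suc k)}"
    proof (rule U_induct)
      show "subspace {v. bracket tt v \<in> U (Suc k)}" by (rule subspace_bracket_vimage[OF sU])
    next
      fix v assume v: "v \<in> U k"
      have "bracket tt (bracket f v) = scale a (bracket f v) + bracket g1 v + bracket f (bracket tt v)"
        unfolding tg tf by (simp add: bracket_add_left bracket_scale_left)
      moreover have "bracket tt v \<in> U k" using Suc v by blast
      ultimately show "bracket f v \<in> {v. bracket tt v \<in> U (Suc k)}"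
        using fU gU[OF g1 v] v by (simp add: subspace_add[OF sU] subspace_scale[OF sU])
    next
      fix g assume g: "g \<in> G"
      have "bracket g (bracket tt (F k)) = scale (of_nat (Suc k) * a) (bracket g (F k)) + bracket g u"
        unfolding u(2) by (simp add: bracket_add_right bracket_scale_right)
      then show "bracket g (F k) \<in> {v. bracket tt v \<in> U (Suc k)}"
        unfolding tg mem_Collect_eq using gF[OF HG[OF tH g]] gF[OF g] gU[OF g u(1)]
        by (simp add: subspace_add[OF sU] subspace_scale[OF sU] del: of_nat_Suc)
    next
      fix g v assume g: "g \<in> G" and v: "v \<in> U k"
      have "bracket tt v \<in> U k" using Suc v by blast
      then show "bracket g v \<in> {v. bracket tt v \<in> U (Suc k)}"
        unfolding tg mem_Collect_eq using gU[OF HG[OF tH g] v] gU[OF g] by (simp add: subspace_add[OF sU])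
    qed
    then show "\<forall>u\<in>U (Suc k). bracket tt u \<in> U (Suc k)" by blast
  qed
  define c where "c k = a * (of_nat ((k + 1) * (k + 2)) / 2)" for k :: nat
  have cS: "c (Suc k) = of_nat (Suc (Suc k)) * a + c k" for k by (simp add: c_def field_simps)
  have c0: "c 0 = a" by (simp add: c_def)
  have yg: "bracket y (bracket g v) = bracket g (bracket y v)" if "g \<in> G" for g v
    using leibniz[of y g v] that by (simp add: G_def)
  have yf: "bracket y (bracket f v) = bracket tt v + bracket f (bracket y v)" for v
    by (simp only: tt_def leibniz[of y f v])
  have main: "(\<exists>u\<in>U k. bracket y (F (Suc k)) = scale (c k) (F k) + u) \<and> (\<forall>u\<in>U (Suc k). bracket y u \<in> U k)" for k
  proof (induction k)
    case 0
    have "bracket y (F (Suc 0)) = scale (c 0) (F 0) + 0" by (simp add: FS F0 yf ye te c0)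
    moreover have "U (Suc 0) \<subseteq> {v. bracket y v \<in> U 0}"
      by (rule U_induct) (auto simp: U0 F0 yg ye subspace_bracket_vimage[OF subspace_single_0, simplified])
    ultimately show ?case using U0 by blast
  next
    case (Suc k)
    obtain u where u: "u \<in> U k" "bracket y (F (Suc k)) = scale (c k) (F k) + u" using Suc by blast
    obtain w where w: "w \<in> U (Suc k)" "bracket tt (F (Suc k)) = scale (of_nat (Suc (Suc k)) * a) (F (Suc k)) + w"
      using tF by blast
    have "bracket y (F (Suc (Suc k))) = bracket tt (F (Suc k)) + bracket f (bracket y (F (Suc k)))"
      unfolding FS[of "Suc k"] by (rule yf)
    also have "\<dots> = scale (c (Suc k)) (F (Suc k)) + (w + bracket f u)"
      unfolding w(2) u(2) cS by (simp only: bracket_add_right bracket_scale_right FS scale_left_distrib add_ac)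
    finally have "bracket y (F (Suc (Suc k))) = scale (c (Suc k)) (F (Suc k)) + (w + bracket f u)" .
    moreover have "w + bracket f u \<in> U (Suc k)" by (rule subspace_add[OF sU w(1) fU[OF u(1)]])
    moreover have "U (Suc (Suc k)) \<subseteq> {v. bracket y v \<in> U (Suc k)}"
    proof (rule U_induct)
      show "subspace {v. bracket y v \<in> U (Suc k)}" by (rule subspace_bracket_vimage[OF sU])
    next
      fix v assume v: "v \<in> U (Suc k)"
      then have "bracket y v \<in> U k" "bracket tt v \<in> U (Suc k)" using Suc tU by blast+
      then show "bracket f v \<in> {v. bracket y v \<in> U (Suc k)}"
        unfolding mem_Collect_eq yf by (intro subspace_add[OF sU] fU)
    next
      fix g assume g: "g \<in> G"
      have "bracket g (bracket y (F (Suc k))) = scale (c k) (bracket g (F k)) + bracket g u"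
        unfolding u(2) by (simp add: bracket_add_right bracket_scale_right)
      then show "bracket g (F (Suc k)) \<in> {v. bracket y v \<in> U (Suc k)}"
        unfolding mem_Collect_eq yg[OF g] using gF[OF g] gU[OF g u(1)]
        by (simp add: subspace_add[OF sU] subspace_scale[OF sU])
    next
      fix g v assume g: "g \<in> G" and v: "v \<in> U (Suc k)"
      then have "bracket y v \<in> U k" using Suc by blast
      then show "bracket g v \<in> {v. bracket y v \<in> U (Suc k)}"
        unfolding mem_Collect_eq yg[OF g] using gU[OF g] by blast
    qed
    ultimately show ?case by blast
  qed
  have notin: "F k \<notin> U k" for k
  proof (induction k)
    case 0 then show ?case using e by (simp add: F0 U0)
  next
    case (Suc k)
    show ?case
    proof
      assume "F (Suc k) \<in> U (Suc k)"
      then have in1: "bracket y (F (Suc k)) \<in> U k" using main by blast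
      obtain u where u: "u \<in> U k" "bracket y (F (Suc k)) = scale (c k) (F k) + u" using main by blast
      have "scale (c k) (F k) \<in> U k" using in1 u subspace_diff[OF sU in1 u(1)] by simp
      then have "scale (1 / c k) (scale (c k) (F k)) \<in> U k" by (rule subspace_scale[OF sU])
      moreover have "of_nat ((k + 1) * (k + 2)) \<noteq> (0::complex)" by (simp only: of_nat_eq_0_iff) simp
      then have "c k \<noteq> 0" using a0 unfolding c_def by simp
      ultimately show False using Suc by simp
    qed
  qed
  have "ad_nilp f" by (rule gw_ad_nilp[OF f tH]) (use a0 in \<open>simp add: a_def\<close>)
  then obtain k where "F k = 0" by (auto simp: ad_nilp_def F_def)
  then show False using notin[of k] subspace_0[OF sU] by simp
qed

end

section \<open>The root decomposition\<close>


text \<open>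
  The Manin form is used here in place of the Killing form: it is nondegenerate by assumption, whereas
  for the Killing form this would be Cartan's criterion.
\<close>

locale cartan_with_form = abelian_subspace scale bracket H
  for scale :: "complex \<Rightarrow> 'a::ab_group_add \<Rightarrow> 'a" and bracket :: "'a \<Rightarrow> 'a \<Rightarrow> 'a" and H :: "'a set" +
  fixes B :: "'a \<Rightarrow> 'a \<Rightarrow> real"
  assumes red: "completely_reducible UNIV UNIV"
    and normalizer_H: "normalizer H = H"
    and B_add: "B (x + y) z = B x z + B y z"
    and B_scale: "B (scale (complex_of_real r) x) y = r * B x y"
    and B_sym: "B x y = B y x"
    and B_inv: "B (bracket x y) z = - B y (bracket x z)"
    and B_nondeg: "(\<And>y. B x y = 0) \<Longrightarrow> x = 0"
begin

abbreviation D :: "'a set" where "D \<equiv> brackets UNIV UNIV"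

lemma B_add_right: "B x (y + z) = B x y + B x z" by (metis B_add B_sym)
lemma B_0 [simp]: "B 0 y = 0" using B_add[of 0 0 y] by simp
lemma B_0_right [simp]: "B x 0 = 0" using B_sym[of x 0] by simp
lemma B_minus: "B (- x) y = - B x y" using B_add[of x "- x" y] by simp
lemma B_diff: "B (x - y) z = B x z - B y z" using B_add[of x "- y" z] by (simp add: B_minus)
text \<open>
  The real form \<open>B\<close> is the real part of a complex bilinear form on \<open>D\<close>, but need not be on the center.
\<close>

lemma B_scale_shift:
  assumes "y \<in> D" shows "B (scale c x) y = B x (scale c y)"
proof -
  define K where "K = {y. \<forall>c x. B (scale c x) y = B x (scale c y)}"
  have "subspace K"
    unfolding subspace_def K_def
  proof (intro conjI ballI allI CollectI)
    fix d y c x assume y: "y \<in> {y. \<forall>c x. B (scale c x) y = B x (scale c y)}"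
    then have 1: "\<And>c x. B (scale c x) y = B x (scale c y)" by blast
    have "B (scale c x) (scale d y) = B (scale d (scale c x)) y" by (rule 1[symmetric])
    also have "\<dots> = B (scale (d * c) x) y" by simp
    also have "\<dots> = B x (scale (d * c) y)" by (rule 1)
    finally show "B (scale c x) (scale d y) = B x (scale c (scale d y))" by (simp add: mult.commute)
  qed (simp_all add: B_add_right scale_right_distrib)
  moreover have "bracket u v \<in> K" for u v
    unfolding K_def
  proof (intro CollectI allI)
    fix c x
    have "B (scale c x) (bracket u v) = - B (bracket u (scale c x)) v" by (simp add: B_inv)
    also have "\<dots> = - B (bracket (scale c u) x) v" by (simp add: bracket_scale_left bracket_scale_right)
    also have "\<dots> = B x (bracket (scale c u) v)" by (simp add: B_inv)
    finally show "B (scale c x) (bracket u v) = B x (scale c (bracket u v))" by (simp add: bracket_scale_left)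
  qed
  ultimately have "D \<subseteq> K" by (intro brackets_subset)
  then have "y \<in> K" using assms by blast
  then show ?thesis by (simp add: K_def)
qed

lemma subspace_D: "subspace D" by (simp add: brackets_def)

lemma gw_in_D:
  assumes x: "x \<in> gw \<alpha>" and h: "h \<in> H" "\<alpha> h \<noteq> 0" shows "x \<in> D"
proof -
  define a where "a = \<alpha> h"
  have "(shift h a ^^ m) x - scale ((- a) ^ m) x \<in> D" for m
  proof (induction m)
    case 0 show ?case using subspace_0[OF subspace_D] by simp
  next
    case (Suc m)
    let ?u = "(shift h a ^^ m) x"
    have "(shift h a ^^ Suc m) x - scale ((- a) ^ Suc m) x
      = bracket h ?u - scale a (?u - scale ((- a) ^ m) x)"
      by (simp add: shift_def scale_right_diff_distrib)
    moreover have "bracket h ?u \<in> D" by (rule bracket_in_brackets) auto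
    ultimately show ?case using Suc by (simp only: subspace_diff[OF subspace_D] subspace_scale[OF subspace_D])
  qed
  moreover obtain m where "(shift h a ^^ m) x = 0" using x h(1) unfolding gw_def a_def by blast
  ultimately have "0 - scale ((- a) ^ m) x \<in> D" by metis
  then have "scale (- 1 / (- a) ^ m) (0 - scale ((- a) ^ m) x) \<in> D" by (rule subspace_scale[OF subspace_D])
  then show ?thesis using h(2) by (simp add: a_def)
qed

text \<open>
  With \<open>s = \<alpha> h + \<beta> h\<close>, invariance expresses \<open>B x (scale s y)\<close> through pairings of \<open>x\<close> and \<open>y\<close> moved one step
  towards zero by the nilpotent operators \<open>shift h (\<alpha> h)\<close> and \<open>shift h (\<beta> h)\<close>. For \<open>\<beta> h \<noteq> 0\<close> the space \<open>gw \<beta>\<close> lies in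
  \<open>D\<close>, where scalars can be moved across \<open>B\<close>.
\<close>

lemma B_gw_orth_aux:
  assumes x: "x \<in> gw \<alpha>" and y: "y \<in> gw \<beta>" and h: "h \<in> H" "\<alpha> h + \<beta> h \<noteq> 0" "\<beta> h \<noteq> 0"
  shows "B x y = 0"
proof -
  define s where "s = \<alpha> h + \<beta> h"
  have "B x y = 0" if "i + j \<le> n" "(shift h (\<alpha> h) ^^ i) x = 0" "(shift h (\<beta> h) ^^ j) y = 0" "x \<in> gw \<alpha>" "y \<in> gw \<beta>"
    for n i j x y
    using that
  proof (induction n arbitrary: i j x y)
    case 0 then show ?case by simp
  next
    case (Suc n)
    define y' where "y' = scale (1 / s) y"
    have yy: "y = scale s y'" using h(2) by (simp add: y'_def s_def)
    have y'g: "y' \<in> gw \<beta>" unfolding y'_def by (intro subspace_scale subspace_gw Suc.prems)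
    have y'j: "(shift h (\<beta> h) ^^ j) y' = 0" using Suc.prems by (simp add: y'_def shift_pow_scale)
    have y'D: "y' \<in> D" by (rule gw_in_D[where \<alpha> = \<beta>, OF y'g h(1,3)])
    have 1: "B (shift h (\<alpha> h) x) y' = 0"
    proof (cases i)
      case 0 then show ?thesis using Suc.prems by simp
    next
      case (Suc i')
      have "(shift h (\<alpha> h) ^^ i') (shift h (\<alpha> h) x) = 0" using Suc.prems(2) Suc by (simp add: funpow_swap1)
      moreover have "shift h (\<alpha> h) x \<in> gw \<alpha>" by (rule stable_shift[OF subspace_gw stable_gw h(1) Suc.prems(4)])
      ultimately show ?thesis using Suc.IH[of i' j "shift h (\<alpha> h) x" y'] Suc.prems(1) Suc y'j y'g by simp
    qed
    have 2: "B x (shift h (\<beta> h) y') = 0"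
    proof (cases j)
      case 0 then show ?thesis using y'j by simp
    next
      case (Suc j')
      have "(shift h (\<beta> h) ^^ j') (shift h (\<beta> h) y') = 0" using y'j Suc by (simp add: funpow_swap1)
      moreover have "shift h (\<beta> h) y' \<in> gw \<beta>" by (rule stable_shift[OF subspace_gw stable_gw h(1) y'g])
      ultimately show ?thesis using Suc.IH[of i j' x "shift h (\<beta> h) y'"] Suc.prems(1,2,4) Suc by simp
    qed
    have "B (shift h (\<alpha> h) x) y' = - B x (bracket h y') - B x (scale (\<alpha> h) y')"
      by (simp add: shift_def B_diff B_inv B_scale_shift[OF y'D])
    also have "bracket h y' = shift h (\<beta> h) y' + scale (\<beta> h) y'" by (simp add: shift_def)
    finally have "B (shift h (\<alpha> h) x) y' = - B x (shift h (\<beta> h) y') - (B x (scale (\<alpha> h) y') + B x (scale (\<beta> h) y'))"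
      by (simp add: B_add_right)
    then have "B x (scale (\<alpha> h) y') + B x (scale (\<beta> h) y') = 0" using 1 2 by simp
    then show ?case by (simp add: yy s_def scale_left_distrib B_add_right)
  qed
  moreover obtain i where "(shift h (\<alpha> h) ^^ i) x = 0" using x h(1) unfolding gw_def by blast
  moreover obtain j where "(shift h (\<beta> h) ^^ j) y = 0" using y h(1) unfolding gw_def by blast
  ultimately show ?thesis using x y by blast
qed

lemma B_gw_orth:
  assumes x: "x \<in> gw \<alpha>" and y: "y \<in> gw \<beta>" and h: "h \<in> H" "\<alpha> h + \<beta> h \<noteq> 0"
  shows "B x y = 0"
proof (cases "\<beta> h = 0")
  case False then show ?thesis using B_gw_orth_aux assms by blast
next
  case True
  then have "B y x = 0" using h by (intro B_gw_orth_aux[OF y x h(1)]) (auto simp: add.commute)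
  then show ?thesis by (simp add: B_sym)
qed

text \<open>
  Otherwise some \<open>y\<close> outside \<open>H\<close> of generalized weight zero is an eigenvector modulo \<open>H\<close>, with eigenvalue
  zero; then \<open>y\<close> normalizes \<open>H\<close>.
\<close>

lemma gw_zero: "gw (\<lambda>_. 0) = H"
proof
  show "H \<subseteq> gw (\<lambda>_. 0)"
  proof
    fix x assume x: "x \<in> H"
    have "(shift h 0 ^^ 1) x = 0" if "h \<in> H" for h using abelian[OF that x] by (simp add: shift_def)
    then show "x \<in> gw (\<lambda>_. 0)" unfolding gw_def by blast
  qed
  show "gw (\<lambda>_. 0) \<subseteq> H"
  proof (rule ccontr)
    assume nsub: "\<not> gw (\<lambda>_. 0) \<subseteq> H"
    have "stable H H" using abelian subspace_0[OF subspace_H] by (simp add: stable_def)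
    then obtain y lam where y: "y \<in> gw (\<lambda>_. 0)" "y \<notin> H" "\<forall>h\<in>H. bracket h y - scale (lam h) y \<in> H"
      using common_eigenvector[OF subspace_gw stable_gw subspace_H _ nsub] by blast
    have hyH: "bracket h y \<in> H" if h: "h \<in> H" for h
    proof -
      obtain k where k: "k \<in> H" "bracket h y = scale (lam h) y + k"
        using y(3) h by (metis add.commute diff_add_cancel)
      have "\<exists>k'\<in>H. (shift h 0 ^^ m) y = scale (lam h ^ m) y + k'" for m
      proof (induction m)
        case 0 then show ?case using subspace_0[OF subspace_H] by (auto intro!: bexI[of _ 0])
      next
        case (Suc m)
        then obtain k' where k': "k' \<in> H" "(shift h 0 ^^ m) y = scale (lam h ^ m) y + k'" by blast
        have "(shift h 0 ^^ Suc m) y = scale (lam h ^ Suc m) y + scale (lam h ^ m) k"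
          using k' abelian[OF h k'(1)]
          by (simp add: shift_def bracket_add_right bracket_scale_right k(2) scale_right_distrib mult.commute)
        then show ?case using subspace_scale[OF subspace_H k(1)] by blast
      qed
      moreover obtain m where "(shift h 0 ^^ m) y = 0" using y(1) h unfolding gw_def by blast
      ultimately obtain k' where k': "k' \<in> H" "scale (lam h ^ m) y + k' = 0" by metis
      have "lam h = 0"
      proof (rule ccontr)
        assume l: "lam h \<noteq> 0"
        have "scale (lam h ^ m) y = - k'" using k'(2) by (simp add: add_eq_0_iff2)
        then have "scale (lam h ^ m) y \<in> H" using subspace_neg[OF subspace_H k'(1)] by simp
        then have "scale (1 / lam h ^ m) (scale (lam h ^ m) y) \<in> H" by (rule subspace_scale[OF subspace_H])
        then show False using l y(2) by simp
      qed
      then show ?thesis using k by simp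
    qed
    have "bracket y h \<in> H" if h: "h \<in> H" for h
      using subspace_neg[OF subspace_H hyH[OF h]] bracket_swap[of y h] by simp
    then have "y \<in> normalizer H" by (simp add: normalizer_def)
    then show False using y normalizer_H by simp
  qed
qed

lemma gw_zero': "\<not> nonzero_wt \<alpha> \<Longrightarrow> gw \<alpha> = H"
  using gw_cong[of \<alpha> "\<lambda>_. 0"] gw_zero by auto

lemma gw_opp: "x \<in> gw \<alpha> \<Longrightarrow> y \<in> gw \<beta> \<Longrightarrow> (\<And>h. h \<in> H \<Longrightarrow> \<alpha> h + \<beta> h = 0) \<Longrightarrow> bracket x y \<in> H"
  using gw_bracket[of x \<alpha> y \<beta>] gw_zero'[of "\<lambda>h. \<alpha> h + \<beta> h"] by auto

lemma B_zero_of_gw: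
  assumes "\<And>\<beta> y. y \<in> gw \<beta> \<Longrightarrow> B x y = 0" shows "x = 0"
proof -
  define K where "K = {y. \<forall>c. B x (scale c y) = 0}"
  have "subspace K" unfolding K_def subspace_def by (simp add: scale_right_distrib B_add_right)
  moreover have "\<Union>{gw \<beta> | \<beta>. True} \<subseteq> K"
  proof
    fix y assume "y \<in> \<Union>{gw \<beta> | \<beta>. True}"
    then obtain \<beta> where "y \<in> gw \<beta>" by blast
    then have "scale c y \<in> gw \<beta>" for c by (rule subspace_scale[OF subspace_gw])
    then have "B x (scale c y) = 0" for c by (rule assms)
    then show "y \<in> K" by (simp add: K_def)
  qed
  ultimately have "span (\<Union>{gw \<beta> | \<beta>. True}) \<subseteq> K" by (intro span_minimal)
  then have "y \<in> K" for y unfolding UNIV_gw by blast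
  then have "B x (scale 1 y) = 0" for y unfolding K_def by blast
  then have "B x y = 0" for y by simp
  then show ?thesis by (rule B_nondeg)
qed

lemma B_pairing:
  assumes x: "x \<in> gw \<alpha>" "x \<noteq> 0"
  obtains y where "y \<in> gw (\<lambda>h. - \<alpha> h)" "B x y \<noteq> 0"
proof -
  have "\<exists>y\<in>gw (\<lambda>h. - \<alpha> h). B x y \<noteq> 0"
  proof (rule ccontr)
    assume "\<not> ?thesis"
    then have neg: "\<And>y. y \<in> gw (\<lambda>h. - \<alpha> h) \<Longrightarrow> B x y = 0" by blast
    have "B x y = 0" if y: "y \<in> gw \<beta>" for \<beta> y
    proof (cases "\<exists>h\<in>H. \<alpha> h + \<beta> h \<noteq> 0")
      case True then show ?thesis using B_gw_orth[OF x(1) y] by blast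
    next
      case False
      then have "\<beta> h = - \<alpha> h" if "h \<in> H" for h
        using that by (metis add.inverse_unique add.commute)
      then have "gw \<beta> = gw (\<lambda>h. - \<alpha> h)" by (rule gw_cong)
      then show ?thesis using neg y by blast
    qed
    then show False using B_zero_of_gw x(2) by blast
  qed
  then show ?thesis using that by blast
qed

lemma nonzero_gw_span: "span (H \<union> \<Union>{gw \<alpha> | \<alpha>. nonzero_wt \<alpha>}) = UNIV"
proof -
  have "\<Union>{gw \<alpha> | \<alpha>. True} \<subseteq> H \<union> \<Union>{gw \<alpha> | \<alpha>. nonzero_wt \<alpha>}"
  proof
    fix x assume "x \<in> \<Union>{gw \<alpha> | \<alpha>. True}"
    then obtain \<alpha> where "x \<in> gw \<alpha>" by blast
    then show "x \<in> H \<union> \<Union>{gw \<alpha> | \<alpha>. nonzero_wt \<alpha>}" using gw_zero'[of \<alpha>] by (cases "nonzero_wt \<alpha>") blast+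
  qed
  from span_mono[OF this] show ?thesis unfolding UNIV_gw by (rule top.extremum_uniqueI)
qed

text \<open>
  The largest complex subspace of the \<open>B\<close>-orthogonal of \<open>b\<close>. The orthogonal itself need not be a
  complex subspace, because of the center.
\<close>

definition complex_orth :: "'a set \<Rightarrow> 'a set" where
  "complex_orth b = {v. \<forall>c. \<forall>x\<in>b. B (scale c v) x = 0}"

lemma subspace_complex_orth: "subspace (complex_orth b)"
  unfolding complex_orth_def subspace_def by (simp add: scale_right_distrib B_add)

text \<open>
  Let \<open>V\<close> be this orthogonal and \<open>S\<close> the weight vectors of \<open>b\<close> of nonzero weight together with the
  nilpotent elements of \<open>H\<close>. Then \<open>S\<close> is weakly closed: for opposite weights either the bracket is nilpotent or
  \<open>b\<close> contains a copy of \<open>sl2\<close>, which is impossible in a solvable algebra. Hence, if \<open>V\<close> is not contained in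
  \<open>b\<close>, there is \<open>y\<close> in \<open>V\<close> outside \<open>b\<close> which \<open>S\<close> maps into \<open>b\<close> and which is an eigenvector of \<open>H\<close> modulo \<open>b\<close>.
  The algebra spanned by \<open>b\<close> and \<open>y\<close> has its second derived algebra in \<open>b\<close>, because \<open>b \<inter> V\<close> meets \<open>H\<close> in zero
  and so is contained in \<open>span S\<close>. It is solvable, contrary to maximality of \<open>b\<close>.
\<close>

lemma complex_orth_subset:
  assumes borel: "borel b" and Hb: "H \<subseteq> b"
    and diag: "b \<subseteq> span (\<Union>{b \<inter> weight_space H \<alpha> | \<alpha>. True})"
  shows "complex_orth b \<subseteq> b"
proof (rule ccontr)
  define V where "V = complex_orth b"
  assume "\<not> complex_orth b \<subseteq> b"
  then have nV: "\<not> V \<subseteq> b" by (simp add: V_def)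
  have sb: "subspace b" and bb: "\<And>x y. x \<in> b \<Longrightarrow> y \<in> b \<Longrightarrow> bracket x y \<in> b" and solv: "solvable b"
    and mx: "\<And>c. subalgebra c \<Longrightarrow> solvable c \<Longrightarrow> b \<subseteq> c \<Longrightarrow> c = b"
    using borel by (auto simp: borel_def subalgebra_def)
  define S where "S = {x\<in>b. \<exists>\<alpha>. x \<in> weight_space H \<alpha> \<and> nonzero_wt \<alpha>} \<union> {t\<in>H. ad_nilp t}"
  have Sb: "S \<subseteq> b" using Hb by (auto simp: S_def)
  have S0: "0 \<in> S" using subspace_0[OF subspace_H] ad_nilp_0 by (simp add: S_def)
  have wH: "bracket h x = scale (\<alpha> h) x" if "x \<in> weight_space H \<alpha>" "h \<in> H" for h x \<alpha>
    using that by (simp add: weight_space_def)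
  have wH': "bracket x h = - scale (\<alpha> h) x" if "x \<in> weight_space H \<alpha>" "h \<in> H" for h x \<alpha>
    using wH[OF that] bracket_swap[of x h] by simp
  have w_nilp: "ad_nilp x" if "x \<in> weight_space H \<alpha>" "nonzero_wt \<alpha>" for x \<alpha>
    using gw_ad_nilp weight_space_gw that by blast
  have opp_nilp: "ad_nilp (bracket x y)"
    if x: "x \<in> b" "x \<in> weight_space H \<alpha>" "nonzero_wt \<alpha>" and y: "y \<in> b" "y \<in> weight_space H \<beta>"
      and opp: "\<And>h. h \<in> H \<Longrightarrow> \<alpha> h + \<beta> h = 0" for x y \<alpha> \<beta>
  proof -
    define t where "t = bracket x y"
    have tH: "t \<in> H" unfolding t_def
      using gw_opp[of x \<alpha> y \<beta>] weight_space_gw x y opp by blast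
    have tx: "bracket t x = scale (\<alpha> t) x" by (rule wH[OF x(2) tH])
    have ty: "bracket t y = scale (\<beta> t) y" by (rule wH[OF y(2) tH])
    have bt: "\<beta> t = - \<alpha> t" using opp[OF tH] by (simp add: add_eq_0_iff)
    show ?thesis
    proof (cases "\<alpha> t = 0")
      case True
      then show ?thesis using jacobson_nilpotent[of x y] w_nilp[OF x(2,3)] tx by (simp add: t_def)
    next
      case False
      \<comment> \<open>\<open>x\<close>, \<open>y\<close>, \<open>t\<close> would span a perfect subalgebra\<close>
      have "x \<in> derived k b \<and> y \<in> derived k b" for k
      proof (induction k)
        case (Suc k)
        have t: "t \<in> derived (Suc k) b" unfolding t_def funpow.simps o_apply using Suc by (intro bracket_in_brackets) auto
        have sub: "subspace (derived k b)" using sb by (cases k) (auto simp: brackets_def)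
        have "t \<in> derived k b" 
        proof -
          have bb': "brackets b b \<subseteq> b" using sb bb by (rule brackets_subset)
          have "derived (Suc j) b \<subseteq> derived j b" for j
          proof (induction j)
            case 0 show ?case unfolding funpow.simps o_apply id_apply by (rule bb')
          next
            case (Suc j)
            then show ?case by (simp only: funpow.simps o_apply brackets_mono)
          qed
          then show ?thesis using t by blast
        qed
        then have "bracket t x \<in> derived (Suc k) b" "bracket t y \<in> derived (Suc k) b"
          using Suc by (auto intro: bracket_in_brackets)
        then have "scale (1 / \<alpha> t) (bracket t x) \<in> derived (Suc k) b" "scale (1 / \<beta> t) (bracket t y) \<in> derived (Suc k) b"
          by (auto simp: brackets_def intro: span_scale)
        then show ?case using False bt unfolding tx ty by simp
      qed (use x y in simp)
      moreover obtain k where "derived k b = {0}" using solv by (auto simp: solvable_def)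
      ultimately have "x = 0" by blast
      then show ?thesis using ad_nilp_0 by simp
    qed
  qed
  have HS: "bracket h s \<in> span S" if h: "h \<in> H" and s: "s \<in> S" for h s
  proof (cases "s \<in> H")
    case True then show ?thesis using abelian[OF h] span_zero by simp
  next
    case False
    then obtain \<alpha> where "s \<in> weight_space H \<alpha>" using s by (auto simp: S_def)
    then show ?thesis using wH[OF _ h, of s \<alpha>] span_scale[OF span_base[OF s]] by simp
  qed
  have SS: "bracket x y \<in> S" if x: "x \<in> S" and y: "y \<in> S" for x y
  proof -
    have kill: "bracket u v = 0 \<and> bracket v u = 0"
      if u: "u \<in> weight_space H \<alpha>" and v: "v \<in> H" "ad_nilp v" for u v \<alpha>
    proof (cases "u = 0")
      case False
      have "\<alpha> v = 0" using ad_nilp_weight_zero[OF v _ False] weight_space_gw u by blast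
      then show ?thesis using wH[OF u v(1)] wH'[OF u v(1)] by simp
    qed simp
    consider "x \<in> H" "ad_nilp x" "y \<in> H" | \<beta> where "x \<in> H" "ad_nilp x" "y \<in> weight_space H \<beta>"
      | \<alpha> where "x \<in> weight_space H \<alpha>" "y \<in> H" "ad_nilp y"
      | \<alpha> \<beta> where "x \<in> b" "x \<in> weight_space H \<alpha>" "nonzero_wt \<alpha>" "y \<in> b" "y \<in> weight_space H \<beta>"
      using x y unfolding S_def by blast
    then show ?thesis
    proof cases
      case 1 then show ?thesis using abelian S0 by simp
    next
      case 2 then show ?thesis using kill S0 by metis
    next
      case 3 then show ?thesis using kill S0 by metis
    next
      case 4
      show ?thesis
      proof (cases "\<exists>h\<in>H. \<alpha> h + \<beta> h \<noteq> 0")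
        case True
        then show ?thesis using weight_space_bracket[OF 4(2,5)] bb[OF 4(1,4)] unfolding S_def by blast
      next
        case False
        then have "ad_nilp (bracket x y)" using opp_nilp[OF 4] by blast
        moreover have "bracket x y \<in> H"
          using gw_opp[of x \<alpha> y \<beta>] weight_space_gw 4 False by blast
        ultimately show ?thesis by (simp add: S_def)
      qed
    qed
  qed
  have nilS: "ad.nil S"
  proof (rule ad.nil_weakly_closed)
    fix x assume "x \<in> S"
    then have "ad_nilp x" using w_nilp unfolding S_def by blast
    then show "\<exists>k. \<forall>v. (bracket x ^^ k) v = 0" by (simp add: ad_nilp_def)
  qed (auto intro: SS)
  then obtain K where K: "ad.words S K = {0}" by (auto simp: ad.nil_def)
  have sV: "subspace V" unfolding V_def by (rule subspace_complex_orth)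
  have bV: "bracket x v \<in> V" if x: "x \<in> b" and v: "v \<in> V" for x v
    unfolding V_def complex_orth_def
  proof (intro CollectI allI ballI)
    fix c z assume z: "z \<in> b"
    have "B (scale c (bracket x v)) z = B (bracket x (scale c v)) z" by (simp add: bracket_scale_right)
    also have "\<dots> = - B (scale c v) (bracket x z)" by (rule B_inv)
    also have "\<dots> = 0" using v bb[OF x z] by (simp add: V_def complex_orth_def)
    finally show "B (scale c (bracket x v)) z = 0" .
  qed
  have VH: "v = 0" if v: "v \<in> V" "v \<in> H" for v
  proof (rule ccontr)
    assume "v \<noteq> 0"
    then obtain y where y: "y \<in> gw (\<lambda>h. - 0)" "B v y \<noteq> 0" using B_pairing[of v "\<lambda>_. 0"] gw_zero v by blast
    then have "y \<in> b" using gw_zero Hb by auto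
    moreover have "B (scale 1 v) y = 0 \<or> y \<notin> b" using v(1) unfolding V_def complex_orth_def by blast
    ultimately show False using y by simp
  qed
  have b_span: "b \<subseteq> span (H \<union> S)"
  proof -
    have "b \<inter> weight_space H \<alpha> \<subseteq> H \<union> S" for \<alpha>
    proof (cases "nonzero_wt \<alpha>")
      case True then show ?thesis unfolding S_def by blast
    next
      case False then show ?thesis using gw_zero'[of \<alpha>] weight_space_gw[of \<alpha>] by blast
    qed
    then have "span (\<Union>{b \<inter> weight_space H \<alpha> | \<alpha>. True}) \<subseteq> span (H \<union> S)" by (intro span_mono) blast
    then show ?thesis using diag by blast
  qed
  have spanS_b: "span S \<subseteq> b" using Sb sb by (rule span_minimal)
  have HbS: "bracket x y \<in> span S" if "x \<in> H \<union> S" "y \<in> H \<union> S" for x y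
  proof -
    consider "x \<in> H" "y \<in> H" | "x \<in> H" "y \<in> S" | "x \<in> S" "y \<in> H" | "x \<in> S" "y \<in> S" using \<open>x \<in> H \<union> S\<close> \<open>y \<in> H \<union> S\<close> by blast
    then show ?thesis
    proof cases
      case 1 then show ?thesis using abelian span_zero by simp
    next
      case 2 then show ?thesis using HS by blast
    next
      case 3 then show ?thesis using span_neg[OF HS[OF 3(2,1)]] bracket_swap[of x y] by simp
    next
      case 4 then show ?thesis using span_base[OF SS] by blast
    qed
  qed
  have bbS: "bracket x y \<in> span S" if "x \<in> b" "y \<in> b" for x y
    by (rule bracket_span[OF subspace_span, where X = "H \<union> S" and Y = "H \<union> S"]) (use HbS that b_span in blast)+
  have bVS: "b \<inter> V \<subseteq> span S"
  proof -
    have sbV: "subspace (b \<inter> V)" using sb sV by (rule subspace_inter)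
    have "stable H (b \<inter> V)" unfolding stable_def using Hb bb bV by blast
    then have "b \<inter> V \<subseteq> span (\<Union>{(b \<inter> V) \<inter> gw \<alpha> | \<alpha>. True})" by (rule gw_decomposition[OF sbV])
    moreover have "(b \<inter> V) \<inter> gw \<alpha> \<subseteq> S" for \<alpha>
    proof
      fix x assume x: "x \<in> (b \<inter> V) \<inter> gw \<alpha>"
      show "x \<in> S"
      proof (cases "nonzero_wt \<alpha>")
        case True
        have "span (\<Union>{b \<inter> weight_space H \<alpha> | \<alpha>. True}) \<subseteq> span (\<Union>{weight_space H \<alpha> | \<alpha>. True})"
          by (intro span_mono) blast
        then have "x \<in> weight_space H \<alpha>" using x diag by (intro weight_space_of_gw) blast+
        then show ?thesis using x True unfolding S_def by blast
      next
        case False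
        then have "x = 0" using gw_zero' VH x by blast
        then show ?thesis using S0 by simp
      qed
    qed
    then have "span (\<Union>{(b \<inter> V) \<inter> gw \<alpha> | \<alpha>. True}) \<subseteq> span S" by (intro span_mono) blast
    ultimately show ?thesis by blast
  qed
  define Q where "Q = {y\<in>V. \<forall>s\<in>S. bracket s y \<in> b}"
  have sQ: "subspace Q"
    using sV sb unfolding Q_def subspace_def by (simp add: bracket_add_right bracket_scale_right)
  have stQ: "stable H Q"
    unfolding stable_def
  proof (intro ballI)
    fix h y assume h: "h \<in> H" and y: "y \<in> Q"
    have yV: "y \<in> V" and ys: "\<And>s. s \<in> S \<Longrightarrow> bracket s y \<in> b" using y by (auto simp: Q_def)
    have "bracket s (bracket h y) \<in> b" if s: "s \<in> S" for s
    proof -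
      have "- bracket h s \<in> span S" by (intro span_neg HS h s)
      then have sh: "bracket s h \<in> span S" using bracket_swap[of s h] by simp
      have "bracket (bracket s h) y \<in> b" by (rule bracket_span_left[OF sb _ sh]) (rule ys)
      moreover have "bracket h (bracket s y) \<in> b" using bb Hb h ys[OF s] by blast
      ultimately show ?thesis using leibniz[of s h y] subspace_add[OF sb] by simp
    qed
    moreover have "bracket h y \<in> V" using bV Hb h yV by blast
    ultimately show "bracket h y \<in> Q" by (simp add: Q_def)
  qed
  have nQ: "\<not> Q \<subseteq> b"
  proof
    assume Qb: "Q \<subseteq> b"
    obtain y0 where y0: "y0 \<in> V" "y0 \<notin> b" using nV by blast
    have "\<exists>z. z \<in> ad.words S k \<and> z \<in> V \<and> z \<notin> b" for k
    proof (induction k)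
      case 0 then show ?case using y0 by auto
    next
      case (Suc k)
      then obtain z where z: "z \<in> ad.words S k" "z \<in> V" "z \<notin> b" by blast
      then obtain s where s: "s \<in> S" "bracket s z \<notin> b" using Qb by (auto simp: Q_def)
      have "bracket s z \<in> ad.words S (Suc k)" using s(1) z(1) by (rule ad.words_act)
      moreover have "bracket s z \<in> V" using bV Sb s(1) z(2) by blast
      ultimately show ?case using s by blast
    qed
    from this[of K] show False using K subspace_0[OF sb] by auto
  qed
  have stb: "stable H b" using bb Hb by (auto simp: stable_def)
  obtain y lam where y: "y \<in> Q" "y \<notin> b" and yl: "\<forall>h\<in>H. bracket h y - scale (lam h) y \<in> b"
    using common_eigenvector[OF sQ stQ sb stb nQ] by blast
  have yV: "y \<in> V" and ys: "\<And>s. s \<in> S \<Longrightarrow> bracket s y \<in> b" using y by (auto simp: Q_def)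
  define E where "E = span (insert y S)"
  have SE: "span S \<subseteq> E" unfolding E_def by (intro span_mono) blast
  have yE: "y \<in> E" unfolding E_def by (intro span_base) simp
  have sE: "subspace E" by (simp add: E_def)
  have sy: "bracket s y \<in> span S" if "s \<in> S" for s
    using ys[OF that] bV[of s y] Sb that yV bVS by blast
  have hy: "bracket h y \<in> E" if h: "h \<in> H" for h
  proof -
    have "bracket h y - scale (lam h) y \<in> V"
      using bV[of h y] Hb h yV subspace_scale[OF sV yV] by (intro subspace_diff[OF sV]) auto
    then have "bracket h y - scale (lam h) y \<in> E" using yl h bVS SE by blast
    then have "(bracket h y - scale (lam h) y) + scale (lam h) y \<in> E"
      using subspace_scale[OF sE yE] by (rule subspace_add[OF sE])
    then show ?thesis by simp
  qed
  have by_E: "bracket x y \<in> E" if x: "x \<in> b" for x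
  proof (rule bracket_span_left[OF sE])
    show "x \<in> span (H \<union> S)" using x b_span by blast
    show "bracket u y \<in> E" if "u \<in> H \<union> S" for u using that hy sy SE by blast
  qed
  have yb_E: "bracket y x \<in> E" if x: "x \<in> b" for x
    using subspace_neg[OF sE by_E[OF x]] bracket_swap[of y x] by simp
  define b2 where "b2 = span (insert y b)"
  have b2E: "bracket u v \<in> E" if "u \<in> insert y b" "v \<in> insert y b" for u v
    using that by_E yb_E bbS SE bracket_self[of y] subspace_0[OF sE] by auto
  have b2E': "bracket u v \<in> E" if "u \<in> b2" "v \<in> b2" for u v
    using bracket_span[OF sE b2E, of "insert y b" "insert y b"] that unfolding b2_def by blast
  have Eb2: "E \<subseteq> b2" unfolding E_def b2_def using Sb by (intro span_mono) blast
  have EE: "bracket u v \<in> span S" if "u \<in> insert y S" "v \<in> insert y S" for u v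
  proof -
    have ysw: "bracket y s \<in> span S" if "s \<in> S" for s
      using span_neg[OF sy[OF that]] bracket_swap[of y s] by simp
    have "bracket y y \<in> span S" by (simp add: bracket_self span_zero)
    then show ?thesis using that sy ysw span_base[OF SS] by blast
  qed
  have EE': "bracket u v \<in> span S" if "u \<in> E" "v \<in> E" for u v
    using bracket_span[OF subspace_span EE, of "insert y S" "insert y S"] that unfolding E_def by blast
  have "derived 2 b2 \<subseteq> b"
  proof -
    have "brackets b2 b2 \<subseteq> E" using sE b2E' by (rule brackets_subset)
    then have "brackets (brackets b2 b2) (brackets b2 b2) \<subseteq> brackets E E" by (intro brackets_mono)
    also have "\<dots> \<subseteq> span S" using subspace_span EE' by (rule brackets_subset)
    also have "\<dots> \<subseteq> b" by (rule spanS_b)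
    finally show ?thesis by (simp add: numeral_2_eq_2)
  qed
  then have "solvable b2" by (rule solvable_derived[OF solv]) (simp add: b2_def span_zero)
  moreover have "subalgebra b2" unfolding subalgebra_def using b2E' Eb2 by (auto simp: b2_def)
  moreover have "b \<subseteq> b2" unfolding b2_def using span_superset[of "insert y b"] by blast
  ultimately have "b2 = b" using mx by blast
  moreover have "y \<in> b2" unfolding b2_def by (intro span_base) simp
  ultimately show False using y by simp
qed

end

locale cartan_with_borel = cartan_with_form scale bracket H B
  for scale :: "complex \<Rightarrow> 'a::ab_group_add \<Rightarrow> 'a" and bracket :: "'a \<Rightarrow> 'a \<Rightarrow> 'a"
    and H :: "'a set" and B :: "'a \<Rightarrow> 'a \<Rightarrow> real" +
  fixes b :: "'a set"
  assumes borel_b: "borel b" and H_b: "H \<subseteq> b"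
    and diag_b: "b \<subseteq> span (\<Union>{b \<inter> weight_space H \<alpha> | \<alpha>. True})"
begin

text \<open>
  A nilpotent \<open>t\<close> in \<open>H\<close> kills the weight vectors spanning \<open>b\<close>, so by invariance it maps everything into
  the orthogonal of \<open>b\<close>, hence into \<open>b\<close>, and its square is zero.
\<close>

lemma ad_nilp_central:
  assumes t: "t \<in> H" "ad_nilp t" shows "bracket t y = 0"
proof -
  have kill: "bracket t x = 0" if x: "x \<in> weight_space H \<alpha>" for x \<alpha>
  proof (cases "x = 0")
    case False
    have "x \<in> gw \<alpha>" using weight_space_gw x by blast
    then have "\<alpha> t = 0" by (rule ad_nilp_weight_zero[OF t _ False])
    then show ?thesis using x t(1) by (simp add: weight_space_def)
  qed simp
  have tb: "bracket t x = 0" if x: "x \<in> b" for x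
  proof -
    have "bracket t x \<in> {0}"
    proof (rule bracket_span_right[OF subspace_single_0])
      show "x \<in> span (\<Union>{b \<inter> weight_space H \<alpha> | \<alpha>. True})" using diag_b x by blast
      show "bracket t z \<in> {0}" if "z \<in> \<Union>{b \<inter> weight_space H \<alpha> | \<alpha>. True}" for z
        using that kill by blast
    qed
    then show ?thesis by simp
  qed
  have tV: "bracket t z \<in> complex_orth b" for z
    unfolding complex_orth_def
  proof (intro CollectI allI ballI)
    fix c x assume x: "x \<in> b"
    have "B (scale c (bracket t z)) x = B (bracket t (scale c z)) x" by (simp add: bracket_scale_right)
    also have "\<dots> = - B (scale c z) (bracket t x)" by (rule B_inv)
    also have "\<dots> = 0" using tb[OF x] by simp
    finally show "B (scale c (bracket t z)) x = 0" .
  qed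
  have sand: "sandwich t"
    unfolding sandwich_def
  proof
    fix z
    have "bracket t z \<in> b" using tV complex_orth_subset[OF borel_b H_b diag_b] by blast
    then show "bracket t (bracket t z) = 0" by (rule tb)
  qed
  show ?thesis
  proof (rule sandwich_central[OF red nonzero_gw_span _ _ sand])
    show "ad_nilp x" if "x \<in> \<Union>{gw \<alpha> | \<alpha>. nonzero_wt \<alpha>}" for x
      using that gw_ad_nilp by blast
    show "bracket h x \<in> \<Union>{gw \<alpha> | \<alpha>. nonzero_wt \<alpha>}" if "h \<in> H" "x \<in> \<Union>{gw \<alpha> | \<alpha>. nonzero_wt \<alpha>}" for h x
      using that gw_H by blast
    show "bracket h t = 0" if "h \<in> H" for h by (rule abelian[OF that t(1)])
  qed
qed

text \<open>
  The bracket is nilpotent by \<open>jacobson_nilpotent\<close>, so it is central, but it is also a commutator.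
\<close>

lemma opposite_bracket_zero:
  assumes y: "y \<in> weight_space H (\<lambda>h. - \<alpha> h)" and f: "f \<in> gw \<alpha>" and nz: "nonzero_wt \<alpha>"
    and a: "\<alpha> (bracket y f) = 0"
  shows "bracket y f = 0"
proof -
  define t where "t = bracket y f"
  have yg: "y \<in> gw (\<lambda>h. - \<alpha> h)" using weight_space_gw y by blast
  have tH: "t \<in> H" unfolding t_def by (rule gw_opp[OF yg f]) simp
  have "bracket t y = 0" using y tH a by (simp add: weight_space_def t_def[symmetric])
  moreover have "ad_nilp y" using nz by (auto intro: gw_ad_nilp[OF yg])
  ultimately have "ad_nilp t" unfolding t_def by (intro jacobson_nilpotent) auto
  then have "bracket t z = 0" for z by (rule ad_nilp_central[OF tH])
  moreover have "t \<in> D" unfolding t_def by (rule bracket_in_brackets) auto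
  ultimately show ?thesis using central_commutator_zero[OF red, of t] by (simp add: t_def)
qed

text \<open>
  There are \<open>y\<close> of weight \<open>- \<alpha>\<close> and \<open>f\<close> in \<open>gw \<alpha>\<close> with \<open>\<alpha> [y, f] \<noteq> 0\<close>. Any \<open>v\<close> in \<open>gw \<alpha>\<close> has a multiple of \<open>f\<close> such
  that \<open>\<alpha>\<close> vanishes on the bracket of \<open>y\<close> with the difference; then this bracket is zero, and
  \<open>lowest_weight_injective\<close> makes the difference zero.
\<close>

lemma gw_line:
  assumes x: "x \<in> gw \<alpha>" "x \<noteq> 0" and x': "x' \<in> gw \<alpha>" and nz: "nonzero_wt \<alpha>"
  shows "\<exists>c. x' = scale c x"
proof -
  obtain z where z: "z \<in> gw (\<lambda>h. - \<alpha> h)" "B x z \<noteq> 0" using B_pairing[OF x] by blast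
  have "z \<noteq> 0" using z(2) by auto
  then obtain y where y: "y \<noteq> 0" "y \<in> weight_space H (\<lambda>h. - \<alpha> h)"
    using weight_vector_exists[OF subspace_gw stable_gw order.refl z(1)] by blast
  have yg: "y \<in> gw (\<lambda>h. - \<alpha> h)" using weight_space_gw y by blast
  obtain f where f: "f \<in> gw (\<lambda>h. - (- \<alpha> h))" "B y f \<noteq> 0" using B_pairing[OF yg y(1)] by blast
  have fg: "f \<in> gw \<alpha>" using f(1) by simp
  define t where "t = bracket y f"
  have tH: "bracket y v \<in> H" if "v \<in> gw \<alpha>" for v by (rule gw_opp[OF yg that]) simp
  have t0: "\<alpha> t \<noteq> 0"
  proof
    assume "\<alpha> t = 0"
    then have "bracket y f = 0" unfolding t_def by (rule opposite_bracket_zero[OF y(2) fg nz])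
    obtain h where h: "h \<in> H" "\<alpha> h \<noteq> 0" using nz by blast
    define k where "k = scale (1 / \<alpha> h) h"
    have "bracket y h = scale (\<alpha> h) y"
      using y(2) h(1) bracket_swap[of y h] by (simp add: weight_space_def)
    then have "bracket y k = y" using h(2) by (simp add: k_def bracket_scale_right)
    then have "B (bracket y f) k = - B f y" by (simp add: B_inv)
    then show False using \<open>bracket y f = 0\<close> f(2) by (simp add: B_sym)
  qed
  have all: "\<exists>c. v = scale c f" if v: "v \<in> gw \<alpha>" for v
  proof -
    define c where "c = \<alpha> (bracket y v) / \<alpha> t"
    define v' where "v' = v - scale c f"
    have v': "v' \<in> gw \<alpha>" unfolding v'_def by (intro subspace_diff subspace_scale subspace_gw v fg)
    have br: "bracket y v' = bracket y v - scale c t"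
      by (simp add: v'_def t_def bracket_diff_right bracket_scale_right)
    have "- \<alpha> (bracket y v - scale c t) = - \<alpha> (bracket y v) - c * (- \<alpha> t)"
      by (rule weight_linear[OF y(2,1)]) (use tH[OF v] tH[OF fg] in \<open>simp_all add: t_def\<close>)
    then have "\<alpha> (bracket y v') = 0" unfolding br using t0 by (simp add: c_def)
    then have "bracket y v' = 0" by (rule opposite_bracket_zero[OF y(2) v' nz])
    then have "v' = 0" using lowest_weight_injective[OF y(2) fg _ _ v'] tH[OF fg] t0 by (simp add: t_def)
    then show ?thesis by (auto simp: v'_def)
  qed
  obtain c c' where c: "x = scale c f" "x' = scale c' f" using all[OF x(1)] all[OF x'] by blast
  then have "x' = scale (c' / c) x" using x(2) by auto
  then show ?thesis by blast
qed

theorem gw_weight_space: "gw \<alpha> = weight_space H \<alpha>"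
proof (cases "nonzero_wt \<alpha>")
  case True_nz: True
  show ?thesis
  proof
    show "weight_space H \<alpha> \<subseteq> gw \<alpha>" by (rule weight_space_gw)
    show "gw \<alpha> \<subseteq> weight_space H \<alpha>"
    proof
      fix x assume x: "x \<in> gw \<alpha>"
      show "x \<in> weight_space H \<alpha>"
      proof (cases "x = 0")
        case True then show ?thesis by (simp add: weight_space_def)
      next
        case False
        then obtain e where e: "e \<in> gw \<alpha>" "e \<noteq> 0" "e \<in> weight_space H \<alpha>"
          using weight_vector_exists[OF subspace_gw stable_gw order.refl x] by blast
        obtain c where "x = scale c e" using gw_line[OF e(1,2) x True_nz] by blast
        then show ?thesis using subspace_scale[OF subspace_weight_space e(3)] by simp
      qed
    qed
  qed
next
  case False
  then have "weight_space H \<alpha> = {x. \<forall>h\<in>H. bracket h x = 0}" by (simp add: weight_space_def)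
  then have "H \<subseteq> weight_space H \<alpha>" using abelian by auto
  then show ?thesis using gw_zero'[OF False] weight_space_gw[of \<alpha>] by blast
qed

end

section \<open>Real forms of split signature\<close>


context fd_complex_lie_algebra
begin

abbreviation rscale :: "real \<Rightarrow> 'a \<Rightarrow> 'a" where "rscale r \<equiv> scale (complex_of_real r)"

lemma complex_scale: "scale c x = rscale (Re c) x + rscale (Im c) (scale \<i> x)"
proof -
  have "scale c x = scale (complex_of_real (Re c) + complex_of_real (Im c) * \<i>) x"
    using complex_eq[of c] by (simp add: mult.commute)
  then show ?thesis by (simp add: scale_left_distrib)
qed

lemma span_re_span: "span S \<subseteq> re.span (S \<union> scale \<i> ` S)"
proof -
  define R where "R = re.span (S \<union> scale \<i> ` S)"
  have sR: "re.subspace R" by (simp add: R_def)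
  have iR: "scale \<i> x \<in> R" if "x \<in> R" for x
    using that unfolding R_def
  proof (induction rule: re.span_induct_alt)
    case base then show ?case by (simp add: re.span_zero)
  next
    case (step c x y)
    have "scale \<i> x \<in> re.span (S \<union> scale \<i> ` S)"
    proof (cases "x \<in> S")
      case True then show ?thesis by (intro re.span_base) blast
    next
      case False
      then obtain s where s: "s \<in> S" "x = scale \<i> s" using step(1) by blast
      then have "scale \<i> x = - s" by simp
      then show ?thesis using s by (simp add: re.span_neg re.span_base)
    qed
    then have "rscale c (scale \<i> x) + scale \<i> y \<in> re.span (S \<union> scale \<i> ` S)"
      using step(2) by (intro re.span_add re.span_scale)
    then show ?case by (simp add: scale_right_distrib mult.commute)
  qed
  have "subspace R"
    unfolding subspace_def
  proof (intro conjI ballI allI)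
    show "0 \<in> R" by (rule re.subspace_0[OF sR])
    show "x + y \<in> R" if "x \<in> R" "y \<in> R" for x y using that by (rule re.subspace_add[OF sR])
    show "scale c x \<in> R" if "x \<in> R" for c x
      unfolding complex_scale[of c x] using that iR by (intro re.subspace_add[OF sR] re.subspace_scale[OF sR])
  qed
  moreover have "S \<subseteq> R" unfolding R_def using re.span_superset by blast
  ultimately show ?thesis unfolding R_def[symmetric] by (intro span_minimal)
qed

sublocale re: fd_lie_algebra "\<lambda>r. scale (complex_of_real r)" bracket
proof unfold_locales
  obtain S where "finite S" "span S = UNIV" using finite_dim by blast
  then show "\<exists>S. finite S \<and> re.span S = UNIV"
    using span_re_span[of S] by (intro exI[of _ "S \<union> scale \<i> ` S"]) auto
qed

lemma re_span_subset: "subspace W \<Longrightarrow> S \<subseteq> W \<Longrightarrow> re.span S \<subseteq> W"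
  by (intro re.span_minimal subspace_re)

lemma re_dim_line:
  assumes "b \<noteq> 0" shows "re.dim (span {b}) = 2"
proof -
  have "span {b} \<subseteq> re.span {b, scale \<i> b}" using span_re_span[of "{b}"] by (simp add: insert_commute)
  moreover have "re.span {b, scale \<i> b} \<subseteq> span {b}"
    by (intro re_span_subset) (auto intro: span_base span_scale)
  ultimately have eq: "span {b} = re.span {b, scale \<i> b}" by blast
  have "scale \<i> b \<notin> re.span {b}"
  proof
    assume "scale \<i> b \<in> re.span {b}"
    then obtain r where r: "scale \<i> b = rscale r b" by (auto simp: re.span_singleton)
    have "\<i> = complex_of_real r" using r assms scale_right_imp_eq by blast
    then show False by (metis Im_complex_of_real imaginary_unit.simps(2) zero_neq_one)
  qed
  moreover have "re.independent {b}" using assms by simp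
  ultimately have ind: "re.independent (insert (scale \<i> b) {b})" by (rule re.independent_insertI)
  have "scale \<i> b \<noteq> b" using \<open>scale \<i> b \<notin> re.span {b}\<close> re.span_base[of b "{b}"] by auto
  then have "card (insert (scale \<i> b) {b}) = 2" by simp
  moreover have "span {b} = re.span (insert (scale \<i> b) {b})" unfolding eq by (simp add: insert_commute)
  ultimately show ?thesis using re.dim_span_eq_card_independent[OF ind] by simp
qed

lemma re_dim:
  assumes "subspace W" shows "re.dim W = 2 * dim W"
proof -
  have main: "re.dim (span Bs) = 2 * card Bs" if "finite Bs" "independent Bs" for Bs
    using that
  proof (induction Bs)
    case empty
    have "span {} = {0}" by simp
    then show ?case by simp
  next
    case (insert b Bs)
    have ind: "independent Bs" and b: "b \<notin> span Bs"
      using insert by (auto simp: independent_insert)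
    have b0: "b \<noteq> 0" using b span_zero by auto
    have int: "span Bs \<inter> span {b} = {0}"
    proof -
      have "x = 0" if "x \<in> span Bs" "x \<in> span {b}" for x
      proof (rule ccontr)
        assume "x \<noteq> 0"
        obtain c where c: "x = scale c b" using \<open>x \<in> span {b}\<close> by (auto simp: span_singleton)
        then have "b = scale (1 / c) x" using \<open>x \<noteq> 0\<close> by auto
        then show False using b span_scale[OF \<open>x \<in> span Bs\<close>] by metis
      qed
      then show ?thesis using span_zero by blast
    qed
    have "span (insert b Bs) = {x + y | x y. x \<in> span Bs \<and> y \<in> span {b}}"
      using span_Un[of Bs "{b}"] by simp
    moreover have "re.dim {x + y | x y. x \<in> span Bs \<and> y \<in> span {b}} + re.dim (span Bs \<inter> span {b})
        = re.dim (span Bs) + re.dim (span {b})"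
      by (intro re.dim_sums_Int subspace_re subspace_span)
    ultimately have "re.dim (span (insert b Bs)) = re.dim (span Bs) + 2"
      using int re_dim_line[OF b0] by simp
    then show ?case using insert ind by simp
  qed
  obtain Bs where Bs: "Bs \<subseteq> W" "independent Bs" "W \<subseteq> span Bs" "card Bs = dim W" using basis_exists[of W] by blast
  have "span Bs = W" using Bs assms span_minimal by blast
  moreover have "finite Bs" using Bs finiteI_independent by blast
  ultimately show ?thesis using main Bs by metis
qed

end

locale real_form = fd_lie_algebra scale bracket
  for scale :: "real \<Rightarrow> 'a::ab_group_add \<Rightarrow> 'a" and bracket :: "'a \<Rightarrow> 'a \<Rightarrow> 'a" +
  fixes B :: "'a \<Rightarrow> 'a \<Rightarrow> real"
  assumes B_add: "B (x + y) z = B x z + B y z"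
    and B_scale: "B (scale r x) y = r * B x y"
    and B_sym: "B x y = B y x"
begin

definition orth_basis :: "'a set \<Rightarrow> 'a set \<Rightarrow> bool" where
  "orth_basis K E \<longleftrightarrow> independent E \<and> span E = K \<and> (\<forall>e\<in>E. \<forall>f\<in>E. e \<noteq> f \<longrightarrow> B e f = 0)"

lemma B_add_right: "B x (y + z) = B x y + B x z" by (metis B_add B_sym)
lemma B_scale_right: "B x (scale r y) = r * B x y" by (metis B_scale B_sym)
lemma B_0 [simp]: "B 0 y = 0" using B_scale[of 0 0 y] by simp
lemma B_0_right [simp]: "B y 0 = 0" using B_sym[of y 0] by simp
lemma B_diff: "B (x - y) z = B x z - B y z" using B_add[of "x - y" y z] by simp

lemma orth_basis_exists:
  assumes "subspace K" shows "\<exists>E. orth_basis K E"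
  using assms
proof (induction "dim K" arbitrary: K rule: less_induct)
  case less
  show ?case
  proof (cases "\<exists>v\<in>K. B v v \<noteq> 0")
    case False
    then have v0: "B v v = 0" if "v \<in> K" for v using that by blast
    have z: "B x y = 0" if "x \<in> K" "y \<in> K" for x y
    proof -
      have "B (x + y) (x + y) = 0" using that less.prems by (intro v0 subspace_add)
      then show ?thesis using v0 that B_sym[of x y] by (simp add: B_add B_add_right)
    qed
    obtain E where E: "E \<subseteq> K" "independent E" "K \<subseteq> span E" "card E = dim K" by (rule basis_exists)
    have "span E = K" using E less.prems span_minimal by blast
    moreover have "B e f = 0" if "e \<in> E" "f \<in> E" for e f using z E(1) that by blast
    ultimately have "orth_basis K E" using E(2) by (simp add: orth_basis_def)
    then show ?thesis by blast
  next
    case True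
    then obtain v where v: "v \<in> K" "B v v \<noteq> 0" by blast
    define K' where "K' = {x\<in>K. B v x = 0}"
    have sK': "subspace K'" using less.prems unfolding K'_def subspace_def by (simp add: B_add_right B_scale_right)
    have spans: "span K' = K'" "span K = K" using sK' less.prems by (simp_all only: span_eq_iff)
    have "span K' \<subset> span K" unfolding spans using v by (auto simp: K'_def)
    then have "dim K' < dim K" by (rule dim_psubset)
    then obtain E where E: "independent E" "span E = K'" "\<forall>e\<in>E. \<forall>f\<in>E. e \<noteq> f \<longrightarrow> B e f = 0"
      using less.hyps sK' unfolding orth_basis_def by blast
    have ve: "B v e = 0" if "e \<in> E" for e using that E(2) span_base[of e E] by (auto simp: K'_def)
    have "v \<notin> span E" using v E(2) by (simp add: K'_def)
    then have "independent (insert v E)" using E(1) by (rule independent_insertI)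
    moreover have "span (insert v E) = K"
    proof
      show "span (insert v E) \<subseteq> K"
        using v E(2) span_superset[of E] less.prems by (intro span_minimal) (auto simp: K'_def)
      show "K \<subseteq> span (insert v E)"
      proof
        fix x assume x: "x \<in> K"
        define c where "c = B v x / B v v"
        have "x - scale c v \<in> K" using x v less.prems by (intro subspace_diff subspace_scale)
        moreover have "B v (x - scale c v) = 0"
          using v by (simp add: c_def B_diff B_scale B_sym[of v "x - _"] B_sym[of x v])
        ultimately have "x - scale c v \<in> span E" using E(2) by (simp add: K'_def)
        then have "x - scale c v \<in> span (insert v E)" using span_mono[of E "insert v E"] by blast
        moreover have "scale c v \<in> span (insert v E)" by (intro span_scale span_base) simp
        ultimately have "(x - scale c v) + scale c v \<in> span (insert v E)" by (rule span_add)
        then show "x \<in> span (insert v E)" by simp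
      qed
    qed
    ultimately have "orth_basis K (insert v E)"
      unfolding orth_basis_def using E(3) ve B_sym by (metis insert_iff)
    then show ?thesis by blast
  qed
qed

lemma orth_coordinate:
  assumes P: "finite P" "\<forall>e\<in>P. \<forall>f\<in>P. e \<noteq> f \<longrightarrow> B e f = 0" and e: "e \<in> P"
  shows "B (\<Sum>f\<in>P. scale (u f) f) e = u e * B e e"
proof -
  have "B (\<Sum>f\<in>Q. scale (u f) f) e = (\<Sum>f\<in>Q. u f * B f e)" if "finite Q" for Q
    using that by (induction Q) (simp_all add: B_add B_scale)
  then have "B (\<Sum>f\<in>P. scale (u f) f) e = (\<Sum>f\<in>P. u f * B f e)" using P(1) by blast
  also have "\<dots> = (\<Sum>f\<in>P. if f = e then u e * B e e else 0)"
    using P(2) e by (intro sum.cong) auto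
  also have "\<dots> = u e * B e e" using P(1) e by simp
  finally show ?thesis .
qed

lemma orth_basis_nondegenerate:
  assumes E: "orth_basis K E" "\<And>e. e \<in> E \<Longrightarrow> B e e \<noteq> 0" and x: "x \<in> K" "\<And>y. y \<in> K \<Longrightarrow> B x y = 0"
  shows "x = 0"
proof -
  have ind: "independent E" and sp: "span E = K" and orth: "\<forall>e\<in>E. \<forall>f\<in>E. e \<noteq> f \<longrightarrow> B e f = 0"
    using E by (auto simp: orth_basis_def)
  have fin: "finite E" using ind finiteI_independent by blast
  obtain u where u: "x = (\<Sum>e\<in>E. scale (u e) e)" using x(1) sp span_finite[OF fin] by auto
  have "u e = 0" if e: "e \<in> E" for e
  proof -
    have "B x e = 0" using x(2) sp span_base[OF e] by simp
    then have "u e * B e e = 0" unfolding u orth_coordinate[OF fin orth e] .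
    then show ?thesis using E(2)[OF e] by simp
  qed
  then show ?thesis by (simp add: u)
qed

text \<open>
  The sign \<open>s\<close> allows positive and negative definite spans to be treated together.
\<close>

lemma definite_span:
  assumes P: "finite P" "\<forall>e\<in>P. \<forall>f\<in>P. e \<noteq> f \<longrightarrow> B e f = 0"
    and s: "\<And>e. e \<in> P \<Longrightarrow> 0 < s * B e e" and v: "v \<in> span P" "B v v = 0"
  shows "v = 0"
proof -
  obtain u where u: "v = (\<Sum>e\<in>P. scale (u e) e)" using v(1) span_finite[OF P(1)] by auto
  have Bv: "B v e = u e * B e e" if e: "e \<in> P" for e
    unfolding u by (rule orth_coordinate[OF P e])
  have sumB: "B (\<Sum>e\<in>Q. scale (u e) e) w = (\<Sum>e\<in>Q. u e * B w e)" if "finite Q" for Q w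
    using that by (induction Q) (simp_all add: B_add B_scale B_sym[of w])
  have "B v v = (\<Sum>e\<in>P. u e * B v e)"
    using sumB[OF P(1), of v] by (simp add: u[symmetric])
  also have "\<dots> = (\<Sum>e\<in>P. u e * (u e * B e e))" by (intro sum.cong) (simp_all add: Bv)
  finally have "(\<Sum>e\<in>P. (u e)\<^sup>2 * (s * B e e)) = s * B v v"
    by (simp add: sum_distrib_left power2_eq_square mult_ac)
  then have "(\<Sum>e\<in>P. (u e)\<^sup>2 * (s * B e e)) = 0" using v(2) by simp
  then have "\<forall>e\<in>P. (u e)\<^sup>2 * (s * B e e) = 0"
    using sum_nonneg_eq_0_iff[OF P(1), of "\<lambda>e. (u e)\<^sup>2 * (s * B e e)"] s by (simp add: less_imp_le)
  then have "\<forall>e\<in>P. u e = 0" using s by fastforce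
  then show ?thesis by (simp add: u)
qed

text \<open>
  An isotropic subspace meets a definite one only in zero.
\<close>

lemma isotropic_dim_bound:
  assumes E: "orth_basis K E" and W: "subspace W" "W \<subseteq> K" "\<And>x. x \<in> W \<Longrightarrow> B x x = 0"
    and P: "P \<subseteq> E" and s: "\<And>e. e \<in> P \<Longrightarrow> 0 < s * B e e"
  shows "dim W + card P \<le> dim K"
proof -
  have ind: "independent E" and sp: "span E = K" and orth: "\<forall>e\<in>E. \<forall>f\<in>E. e \<noteq> f \<longrightarrow> B e f = 0"
    using E by (auto simp: orth_basis_def)
  have fin: "finite P" using ind P finiteI_independent finite_subset by blast
  have indP: "independent P" using ind P by (rule independent_mono)
  have orthP: "\<forall>e\<in>P. \<forall>f\<in>P. e \<noteq> f \<longrightarrow> B e f = 0" using orth P by blast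
  have int: "W \<inter> span P = {0}"
  proof -
    have "v = 0" if "v \<in> W" "v \<in> span P" for v
      by (rule definite_span[OF fin orthP s that(2) W(3)[OF that(1)]])
    then show ?thesis using subspace_0[OF W(1)] span_zero by blast
  qed
  have "dim {x + y | x y. x \<in> W \<and> y \<in> span P} + dim (W \<inter> span P) = dim W + dim (span P)"
    by (intro dim_sums_Int W subspace_span)
  moreover have "{x + y | x y. x \<in> W \<and> y \<in> span P} \<subseteq> K"
    using W(2) span_mono[OF P] sp subspace_add[OF subspace_span, of _ E] by blast
  ultimately show ?thesis using dim_subset[of "{x + y | x y. x \<in> W \<and> y \<in> span P}" K] int
    dim_span_eq_card_independent[OF indP] by simp
qed

text \<open>
  The positive and the negative part of an orthogonal basis each have size at most \<open>dim V\<close> and at most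
  \<open>dim W\<close>, and there is no null part, so all these inequalities are equalities.
\<close>

lemma hyperbolic_signature:
  assumes sub: "subspace V" "subspace W" and iso: "\<And>x y. x \<in> V \<Longrightarrow> y \<in> V \<Longrightarrow> B x y = 0" "\<And>x y. x \<in> W \<Longrightarrow> y \<in> W \<Longrightarrow> B x y = 0"
    and K: "V \<inter> W = {0}" "K = {x + y | x y. x \<in> V \<and> y \<in> W}"
    and nondeg: "\<And>x. x \<in> K \<Longrightarrow> (\<And>y. y \<in> K \<Longrightarrow> B x y = 0) \<Longrightarrow> x = 0"
  shows "\<exists>E. orth_basis K E \<and> 2 * card {e\<in>E. B e e > 0} = dim K \<and> 2 * card {e\<in>E. B e e < 0} = dim K"
proof -
  have sK: "subspace K" unfolding K(2) using sub by (rule subspace_sums)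
  have VK: "V \<subseteq> K" "W \<subseteq> K" unfolding K(2) using subspace_0[OF sub(1)] subspace_0[OF sub(2)] by force+
  obtain E where E: "orth_basis K E" using orth_basis_exists[OF sK] by blast
  have ind: "independent E" and sp: "span E = K" and orth: "\<forall>e\<in>E. \<forall>f\<in>E. e \<noteq> f \<longrightarrow> B e f = 0"
    using E by (auto simp: orth_basis_def)
  have fin: "finite E" using ind finiteI_independent by blast
  define P where "P = {e\<in>E. B e e > 0}"
  define M where "M = {e\<in>E. B e e < 0}"
  have "B e e \<noteq> 0" if e: "e \<in> E" for e
  proof
    assume z: "B e e = 0"
    have "B e y = 0" if "y \<in> K" for y
    proof -
      have "subspace {y. B e y = 0}" unfolding subspace_def by (simp add: B_add_right B_scale_right)
      moreover have "E \<subseteq> {y. B e y = 0}" using orth z e by auto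
      ultimately have "span E \<subseteq> {y. B e y = 0}" by (intro span_minimal)
      then show ?thesis using sp that by blast
    qed
    moreover have "e \<in> K" using sp span_base[OF e] by simp
    ultimately have "e = 0" using nondeg by blast
    then show False using ind e dependent_zero by blast
  qed
  then have EPM: "E = P \<union> M" unfolding P_def M_def by (auto simp: neq_iff)
  have "card P + card M = card E"
    unfolding EPM using fin by (intro card_Un_disjoint[symmetric]) (auto simp: P_def M_def)
  also have "card E = dim K" using dim_span_eq_card_independent[OF ind] sp by simp
  finally have c: "card P + card M = dim K" .
  have "dim K + dim (V \<inter> W) = dim V + dim W" unfolding K(2) by (intro dim_sums_Int sub)
  then have d: "dim K = dim V + dim W" using K(1) by simp
  have "dim V + card P \<le> dim K" "dim W + card P \<le> dim K" "dim V + card M \<le> dim K" "dim W + card M \<le> dim K"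
    using isotropic_dim_bound[OF E sub(1) VK(1) iso(1), of P 1] isotropic_dim_bound[OF E sub(2) VK(2) iso(2), of P 1]
      isotropic_dim_bound[OF E sub(1) VK(1) iso(1), of M "-1"] isotropic_dim_bound[OF E sub(2) VK(2) iso(2), of M "-1"]
    by (auto simp: P_def M_def)
  then have "2 * card P = dim K" "2 * card M = dim K" using c d by linarith+
  then show ?thesis using E unfolding P_def M_def by blast
qed

end

section \<open>Cartan, Borel and Lagrangian subalgebras\<close>


context fd_complex_lie_algebra
begin

lemma nilpotent_funpow:
  assumes "nilpotent N" "h \<in> N" "x \<in> N" shows "\<exists>k. (bracket h ^^ k) x = 0"
proof -
  obtain k where k: "((\<lambda>U. brackets N U) ^^ k) N = {0}" using assms(1) by (auto simp: nilpotent_def)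
  have "(bracket h ^^ j) x \<in> ((\<lambda>U. brackets N U) ^^ j) N" for j
    by (induction j) (use assms in \<open>auto intro: bracket_in_brackets\<close>)
  then show ?thesis using k by (metis singletonD)
qed

text \<open>
  The opposite Borel subalgebra \<open>b\<close> is spanned by weight vectors of \<open>H\<close>, hence normalized by \<open>H\<close>, and
  \<open>b + H\<close> is solvable since \<open>H\<close> is nilpotent. By maximality \<open>H\<close> is contained in \<open>b\<close>. So each \<open>ad h\<close> is
  diagonalizable on \<open>H\<close>, but it is also nilpotent there: \<open>H\<close> is abelian.
\<close>

lemma cartan_in_opposite_borel:
  assumes car: "cartan H" and opp: "opposite_borel H b0 b"
  shows "H \<subseteq> b" "b = span (\<Union>{b \<inter> weight_space H \<alpha> | \<alpha>. True})" "\<And>x y. x \<in> H \<Longrightarrow> y \<in> H \<Longrightarrow> bracket x y = 0"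
proof -
  have sH: "subspace H" and HH: "\<And>x y. x \<in> H \<Longrightarrow> y \<in> H \<Longrightarrow> bracket x y \<in> H" and nilH: "nilpotent H"
    using car by (auto simp: cartan_def subalgebra_def)
  have bor: "borel b" and b_eq: "b = span (\<Union>{weight_space H (\<lambda>h. - \<alpha> h) | \<alpha>. weight_space H \<alpha> \<noteq> {0} \<and> weight_space H \<alpha> \<subseteq> b0})"
    using opp by (auto simp: opposite_borel_def)
  have sb: "subspace b" and bb: "\<And>x y. x \<in> b \<Longrightarrow> y \<in> b \<Longrightarrow> bracket x y \<in> b" and solv: "solvable b"
    and mx: "\<And>c. subalgebra c \<Longrightarrow> solvable c \<Longrightarrow> b \<subseteq> c \<Longrightarrow> c = b"
    using bor by (auto simp: borel_def subalgebra_def)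
  define A where "A = \<Union>{weight_space H (\<lambda>h. - \<alpha> h) | \<alpha>. weight_space H \<alpha> \<noteq> {0} \<and> weight_space H \<alpha> \<subseteq> b0}"
  have bA: "b = span A" unfolding A_def by (rule b_eq)
  have Ab: "A \<subseteq> b" unfolding bA by (rule span_superset)
  have AW: "A \<subseteq> \<Union>{b \<inter> weight_space H \<alpha> | \<alpha>. True}"
  proof
    fix x assume x: "x \<in> A"
    then obtain \<alpha> where "x \<in> weight_space H (\<lambda>h. - \<alpha> h)" unfolding A_def by blast
    then show "x \<in> \<Union>{b \<inter> weight_space H \<alpha> | \<alpha>. True}" using Ab x by blast
  qed
  show diag: "b = span (\<Union>{b \<inter> weight_space H \<alpha> | \<alpha>. True})"
  proof
    show "b \<subseteq> span (\<Union>{b \<inter> weight_space H \<alpha> | \<alpha>. True})" using span_mono[OF AW] bA by simp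
    show "span (\<Union>{b \<inter> weight_space H \<alpha> | \<alpha>. True}) \<subseteq> b" using sb by (intro span_minimal) auto
  qed
  have Hb: "bracket h x \<in> b" if h: "h \<in> H" and x: "x \<in> b" for h x
  proof (rule bracket_span_right[OF sb])
    show "x \<in> span A" using x bA by simp
    fix z assume z: "z \<in> A"
    then obtain \<alpha> where "z \<in> weight_space H \<alpha>" using AW by blast
    then have "bracket h z = scale (\<alpha> h) z" using h by (simp add: weight_space_def)
    then show "bracket h z \<in> b" using subspace_scale[OF sb] Ab z by auto
  qed
  have bH: "bracket x h \<in> b" if "h \<in> H" "x \<in> b" for h x
    using subspace_neg[OF sb Hb[OF that]] bracket_swap[of x h] by simp
  define N where "N k = ((\<lambda>U. brackets H U) ^^ k) H" for k
  have N_S: "N (Suc k) = brackets H (N k)" and N0: "N 0 = H" for k by (simp_all add: N_def)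
  have sN: "subspace (N k)" for k by (cases k) (simp_all add: N0 N_S sH brackets_def)
  have NH: "N k \<subseteq> H" for k
  proof (induction k)
    case (Suc k)
    then show ?case unfolding N_S using HH by (intro brackets_subset[OF sH]) blast
  qed (simp add: N0)
  obtain K where K: "N K = {0}" using nilH by (auto simp: nilpotent_def N_def)
  define S where "S k = {u + v | u v. u \<in> b \<and> v \<in> N k}" for k
  have sS: "subspace (S k)" for k unfolding S_def by (rule subspace_sums[OF sb sN])
  have brS: "bracket x y \<in> S (Suc k)" if x: "x \<in> S k" and y: "y \<in> S k" for x y k
  proof -
    obtain u v where uv: "x = u + v" "u \<in> b" "v \<in> N k" using x by (auto simp: S_def)
    obtain u' v' where uv': "y = u' + v'" "u' \<in> b" "v' \<in> N k" using y by (auto simp: S_def)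
    have "bracket x y = (bracket u u' + bracket u v' + bracket v u') + bracket v v'"
      by (simp add: uv uv' bracket_add_left bracket_add_right)
    moreover have "bracket u u' + bracket u v' + bracket v u' \<in> b"
      using bb uv uv' bH Hb NH by (intro subspace_add[OF sb]) blast+
    moreover have "bracket v v' \<in> N (Suc k)"
      unfolding N_S using uv(3) uv'(3) NH by (intro bracket_in_brackets) blast+
    ultimately show ?thesis unfolding S_def by blast
  qed
  have der: "derived k (S 0) \<subseteq> S k" for k
  proof (induction k)
    case (Suc k)
    have "brackets (derived k (S 0)) (derived k (S 0)) \<subseteq> brackets (S k) (S k)" using Suc by (intro brackets_mono)
    also have "\<dots> \<subseteq> S (Suc k)" using sS brS by (rule brackets_subset)
    finally show ?case by simp
  qed simp
  have "S K = b" unfolding S_def K by simp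
  then have "solvable (S 0)" using der[of K] subspace_0[OF sS] by (intro solvable_derived[OF solv]) auto
  moreover have "subalgebra (S 0)"
  proof -
    have "S (Suc 0) \<subseteq> S 0" unfolding S_def using NH[of "Suc 0"] N0 by blast
    then show ?thesis unfolding subalgebra_def using sS brS by blast
  qed
  moreover have bS: "b \<subseteq> S 0"
  proof
    fix x assume "x \<in> b"
    then have "x = x + 0 \<and> x \<in> b \<and> 0 \<in> N 0" using subspace_0[OF sN] by simp
    then show "x \<in> S 0" unfolding S_def by blast
  qed
  ultimately have "S 0 = b" using mx by blast
  show HB: "H \<subseteq> b"
  proof
    fix x assume "x \<in> H"
    then have "x = 0 + x \<and> 0 \<in> b \<and> x \<in> N 0" using subspace_0[OF sb] N0 by simp
    then have "x \<in> S 0" unfolding S_def by blast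
    then show "x \<in> b" using \<open>S 0 = b\<close> by simp
  qed
  fix x h assume hx: "x \<in> H" "h \<in> H"
  have "bracket h x = 0"
  proof -
    \<comment> \<open>\<open>H\<close> is not yet known to be abelian, but the line through \<open>h\<close> is\<close>
    interpret L: abelian_subspace scale bracket "span {h}"
    proof unfold_locales
      fix x y assume "x \<in> span {h}" "y \<in> span {h}"
      then obtain c d where "x = scale c h" "y = scale d h" by (auto simp: span_singleton)
      then show "bracket x y = 0" by (simp add: bracket_scale_left bracket_scale_right bracket_self)
    qed simp
    obtain k where k: "(bracket h ^^ k) x = 0" using nilpotent_funpow[OF nilH hx(2,1)] by blast
    have "x \<in> L.gw (\<lambda>_. 0)"
      unfolding L.gw_def
    proof (intro CollectI ballI)
      fix h' assume "h' \<in> span {h}"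
      then obtain c where c: "h' = scale c h" by (auto simp: span_singleton)
      have "(L.shift h' 0 ^^ j) x = scale (c ^ j) ((bracket h ^^ j) x)" for j
        by (induction j) (simp_all add: L.shift_def c bracket_scale_left bracket_scale_right mult.commute)
      from this[of k] show "\<exists>m. (L.shift h' 0 ^^ m) x = 0" using k by auto
    qed
    moreover have "x \<in> span (\<Union>{weight_space (span {h}) \<beta> | \<beta>. True})"
    proof -
      have "span {h} \<subseteq> H" using hx sH by (intro span_minimal) auto
      then have "weight_space H \<alpha> \<subseteq> weight_space (span {h}) \<alpha>" for \<alpha> unfolding weight_space_def by blast
      then have "span (\<Union>{b \<inter> weight_space H \<alpha> | \<alpha>. True}) \<subseteq> span (\<Union>{weight_space (span {h}) \<beta> | \<beta>. True})"
        by (intro span_mono) blast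
      then show ?thesis using hx HB diag by blast
    qed
    ultimately have "x \<in> weight_space (span {h}) (\<lambda>_. 0)" by (rule L.weight_space_of_gw)
    then show ?thesis using span_base[of h "{h}"] by (simp add: weight_space_def)
  qed
  then show "bracket x h = 0" using bracket_swap[of x h] by simp
qed

lemma under_subset:
  assumes "re.subalgebra i" "under i p" shows "i \<subseteq> p"
  using re.nilpotent_radical(1)[OF assms(1)] assms(2)
  unfolding under_def normalizer_def re.ideal_in_def re.stable_def by blast

lemma manin_nondegenerate:
  assumes B: "manin_form UNIV B" and x: "\<And>y. B x y = 0"
  shows "x = 0"
proof -
  interpret rf: real_form "\<lambda>r. scale (complex_of_real r)" bracket B
    by unfold_locales (use B in \<open>auto simp: manin_form_def\<close>)
  obtain E where E: "re.independent E" "re.span E = UNIV" "\<forall>e\<in>E. \<forall>f\<in>E. e \<noteq> f \<longrightarrow> B e f = 0"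
    "card {e\<in>E. B e e > 0} = dim UNIV" "card {e\<in>E. B e e < 0} = dim UNIV"
    using B unfolding manin_form_def has_signature_def by blast
  have fin: "finite E" using E(1) re.finiteI_independent by blast
  have cE: "card E = 2 * dim UNIV"
    using re.dim_span_eq_card_independent[OF E(1)] E(2) re_dim[OF subspace_UNIV] by simp
  have "card ({e\<in>E. B e e > 0} \<union> {e\<in>E. B e e < 0}) = card {e\<in>E. B e e > 0} + card {e\<in>E. B e e < 0}"
    using fin by (intro card_Un_disjoint) auto
  then have "card ({e\<in>E. B e e > 0} \<union> {e\<in>E. B e e < 0}) = card E" using E cE by simp
  then have all: "{e\<in>E. B e e > 0} \<union> {e\<in>E. B e e < 0} = E" using fin by (intro card_subset_eq) auto
  have nz: "B e e \<noteq> 0" if "e \<in> E" for e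
  proof -
    have "e \<in> {e\<in>E. B e e > 0} \<union> {e\<in>E. B e e < 0}" unfolding all by (rule that)
    then show ?thesis by auto
  qed
  have "rf.orth_basis UNIV E" using E by (simp add: rf.orth_basis_def)
  then show ?thesis using rf.orth_basis_nondegenerate[of UNIV E x] nz x by blast
qed

end

context cartan_with_form
begin

sublocale rf: real_form "\<lambda>r. scale (complex_of_real r)" bracket B
  by unfold_locales (rule B_add B_scale B_sym)+

lemma B_span_zero:
  assumes X: "\<And>x c. x \<in> X \<Longrightarrow> scale c x \<in> X" and Y: "\<And>y c. y \<in> Y \<Longrightarrow> scale c y \<in> Y"
    and z: "\<And>x y. x \<in> X \<Longrightarrow> y \<in> Y \<Longrightarrow> B x y = 0" and xy: "x \<in> span X" "y \<in> span Y"
  shows "B x y = 0"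
proof -
  have half: "B x' y' = 0" if X': "\<And>x c. x \<in> X' \<Longrightarrow> scale c x \<in> X'" and z': "\<And>x. x \<in> X' \<Longrightarrow> B x y' = 0"
    and x': "x' \<in> span X'" for X' x' y'
  proof -
    have "subspace {x. \<forall>c. B (scale c x) y' = 0}"
      unfolding subspace_def by (simp add: scale_right_distrib B_add)
    moreover have "X' \<subseteq> {x. \<forall>c. B (scale c x) y' = 0}" using X' z' by blast
    ultimately have "span X' \<subseteq> {x. \<forall>c. B (scale c x) y' = 0}" by (intro span_minimal)
    then have "B (scale 1 x') y' = 0" using x' by blast
    then show ?thesis by simp
  qed
  have "B x y' = 0" if "y' \<in> Y" for y' by (rule half[OF X _ xy(1)]) (use z that in auto)
  then have "B y' x = 0" if "y' \<in> Y" for y' using that B_sym[of y' x] by simp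
  then have "B y x = 0" by (intro half[OF Y _ xy(2)])
  then show ?thesis using B_sym[of x y] by simp
qed

text \<open>
  Otherwise \<open>i\<close> and \<open>x\<close> would span an isotropic subspace of more than half the real dimension.
\<close>

lemma lagrangian_maximal:
  assumes sig: "has_signature UNIV B (dim UNIV) (dim UNIV)" and i: "lagrangian B i"
    and x: "B x x = 0" "\<And>y. y \<in> i \<Longrightarrow> B x y = 0"
  shows "x \<in> i"
proof (rule ccontr)
  assume xi: "x \<notin> i"
  have si: "re.subspace i" and iso: "\<And>y z. y \<in> i \<Longrightarrow> z \<in> i \<Longrightarrow> B y z = 0" and di: "re.dim i = dim UNIV"
    using i by (auto simp: lagrangian_def re.subalgebra_def isotropic_def)
  obtain E where E: "re.independent E" "re.span E = UNIV" "\<forall>e\<in>E. \<forall>f\<in>E. e \<noteq> f \<longrightarrow> B e f = 0"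
    "card {e\<in>E. B e e > 0} = dim UNIV"
    using sig unfolding has_signature_def by blast
  have OE: "rf.orth_basis UNIV E" using E by (simp add: rf.orth_basis_def)
  define W where "W = re.span (insert x i)"
  have "x' \<in> W \<Longrightarrow> B x' x' = 0" for x'
  proof -
    assume "x' \<in> W"
    then obtain k where k: "x' - rscale k x \<in> re.span i" unfolding W_def by (auto simp: re.span_insert)
    moreover have "re.span i = i" using si by (simp only: re.span_eq_iff)
    ultimately have "x' - rscale k x \<in> i" by simp
    then obtain y where y: "y \<in> i" "x' = y + rscale k x" by (metis diff_add_cancel)
    then show ?thesis
      using x iso[OF y(1) y(1)] x(2)[OF y(1)] B_sym[of y x] by (simp add: B_add B_add_right B_scale rf.B_scale_right)
  qed
  then have "re.dim W + card {e\<in>E. B e e > 0} \<le> re.dim UNIV"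
    by (intro rf.isotropic_dim_bound[OF OE, where s = 1]) (auto simp: W_def)
  moreover have "re.dim W = re.dim i + 1"
  proof -
    have sp: "re.span i = i" using si by (simp only: re.span_eq_iff)
    have "x \<notin> re.span i" unfolding sp by (rule xi)
    then show ?thesis unfolding W_def re.dim_span using re.dim_insert[of x i] by simp
  qed
  ultimately show False using E(4) di re_dim[OF subspace_UNIV] by simp
qed

end

section \<open>Sums of weight spaces\<close>


context cartan_with_borel
begin

abbreviation ws :: "('a \<Rightarrow> complex) \<Rightarrow> 'a set" where "ws \<equiv> weight_space H"

text \<open>
  A sum of full weight spaces. For nonzero weights these are lines, so that a stable subspace can fail to
  be of this form only through its intersection with \<open>H\<close>.
\<close>

definition weight_sum :: "'a set \<Rightarrow> bool" where
  "weight_sum W \<longleftrightarrow> subspace W \<and> W \<subseteq> span (\<Union>{ws \<alpha> | \<alpha>. ws \<alpha> \<subseteq> W})"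

lemma ws_zero: "\<not> nonzero_wt \<alpha> \<Longrightarrow> ws \<alpha> = H"
  using gw_zero' gw_weight_space by simp

lemma ws_scale: "x \<in> ws \<alpha> \<Longrightarrow> scale c x \<in> ws \<alpha>"
  by (rule subspace_scale[OF subspace_weight_space])

lemma zero_in_ws: "0 \<in> ws \<alpha>"
  by (rule subspace_0[OF subspace_weight_space])

lemma ws_subset:
  assumes W: "subspace W" and x: "x \<in> ws \<alpha>" "x \<in> W" "x \<noteq> 0" and nz: "nonzero_wt \<alpha>"
  shows "ws \<alpha> \<subseteq> W"
proof
  fix y assume "y \<in> ws \<alpha>"
  then obtain c where "y = scale c x" using gw_line[of x \<alpha> y] x nz by (auto simp: gw_weight_space)
  then show "y \<in> W" using subspace_scale[OF W x(2)] by simp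
qed

lemma weight_sumI:
  assumes W: "subspace W" "stable H W" and HW: "H \<subseteq> W \<or> H \<inter> W = {0}"
  shows "weight_sum W"
proof -
  have "W \<inter> gw \<alpha> \<subseteq> span (\<Union>{ws \<alpha> | \<alpha>. ws \<alpha> \<subseteq> W})" for \<alpha>
  proof
    fix x assume x: "x \<in> W \<inter> gw \<alpha>"
    show "x \<in> span (\<Union>{ws \<alpha> | \<alpha>. ws \<alpha> \<subseteq> W})"
    proof (cases "x = 0")
      case True then show ?thesis by (simp add: span_zero)
    next
      case False
      have xw: "x \<in> ws \<alpha>" using x by (simp add: gw_weight_space)
      have "ws \<alpha> \<subseteq> W"
      proof (cases "nonzero_wt \<alpha>")
        case True then show ?thesis using ws_subset[OF W(1) xw _ False] x by blast
      next
        case Z: False then show ?thesis using HW ws_zero[OF Z] x xw False by blast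
      qed
      then show ?thesis using xw by (intro span_base) blast
    qed
  qed
  then have "span (\<Union>{W \<inter> gw \<alpha> | \<alpha>. True}) \<subseteq> span (\<Union>{ws \<alpha> | \<alpha>. ws \<alpha> \<subseteq> W})"
    by (intro span_minimal) blast+
  then show ?thesis unfolding weight_sum_def using gw_decomposition[OF W] W(1) by blast
qed

lemma ws_independent:
  assumes x: "x \<in> ws \<alpha>" "x \<noteq> 0" "x \<in> span (\<Union>{ws \<beta> | \<beta>. P \<beta>})"
  obtains \<beta> where "P \<beta>" "ws \<beta> = ws \<alpha>"
proof -
  have "\<exists>\<beta>. P \<beta> \<and> (\<forall>h\<in>H. \<beta> h = \<alpha> h)"
  proof (rule ccontr)
    assume neg: "\<not> ?thesis"
    have "\<Union>{ws \<beta> | \<beta>. P \<beta>} \<subseteq> \<Union>{gw \<beta> | \<beta>. \<exists>h\<in>H. \<beta> h \<noteq> \<alpha> h}"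
    proof
      fix z assume "z \<in> \<Union>{ws \<beta> | \<beta>. P \<beta>}"
      then obtain \<beta> where "z \<in> ws \<beta>" "P \<beta>" by blast
      moreover from this have "\<exists>h\<in>H. \<beta> h \<noteq> \<alpha> h" using neg by blast
      ultimately show "z \<in> \<Union>{gw \<beta> | \<beta>. \<exists>h\<in>H. \<beta> h \<noteq> \<alpha> h}" using weight_space_gw by blast
    qed
    from span_mono[OF this] have "x \<in> span (\<Union>{gw \<beta> | \<beta>. \<exists>h\<in>H. \<beta> h \<noteq> \<alpha> h})" using x(3) by blast
    moreover have "x \<in> gw \<alpha>" using x(1) by (simp add: gw_weight_space)
    ultimately show False using gw_independent x(2) by blast
  qed
  then obtain \<beta> where \<beta>: "P \<beta>" "\<forall>h\<in>H. \<beta> h = \<alpha> h" by blast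
  then have "ws \<beta> = ws \<alpha>" by (intro weight_space_cong) blast
  then show ?thesis using that \<beta>(1) by blast
qed

lemma weight_sum_contains_weight:
  assumes W: "subspace W" "stable H W" and x: "x \<in> W" "x \<noteq> 0"
  obtains y \<alpha> where "y \<in> W" "y \<in> ws \<alpha>" "y \<noteq> 0"
proof -
  have "\<exists>y \<alpha>. y \<in> W \<and> y \<in> ws \<alpha> \<and> y \<noteq> 0"
  proof (rule ccontr)
    assume neg: "\<not> ?thesis"
    have "\<Union>{W \<inter> gw \<alpha> | \<alpha>. True} \<subseteq> {0}" using neg unfolding gw_weight_space by blast
    then have "span (\<Union>{W \<inter> gw \<alpha> | \<alpha>. True}) \<subseteq> {0}" by (rule span_minimal[OF _ subspace_single_0])
    then show False using gw_decomposition[OF W] x by blast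
  qed
  then show ?thesis using that by blast
qed

lemma B_ws_orth:
  "x \<in> ws \<alpha> \<Longrightarrow> y \<in> ws \<beta> \<Longrightarrow> h \<in> H \<Longrightarrow> \<alpha> h + \<beta> h \<noteq> 0 \<Longrightarrow> B x y = 0"
  using B_gw_orth by (simp add: gw_weight_space)

lemma ws_opp:
  assumes "\<And>h. h \<in> H \<Longrightarrow> \<alpha> h + \<beta> h = 0" shows "ws \<beta> = ws (\<lambda>h. - \<alpha> h)"
  by (rule weight_space_cong) (metis assms add.commute eq_neg_iff_add_eq_0)

lemma B_ws_pairing:
  assumes "ws \<alpha> \<noteq> {0}"
  obtains x y where "x \<in> ws \<alpha>" "y \<in> ws (\<lambda>h. - \<alpha> h)" "B x y \<noteq> 0" "y \<noteq> 0"
proof -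
  obtain x where x: "x \<in> ws \<alpha>" "x \<noteq> 0" using assms zero_in_ws by blast
  then obtain y where y: "y \<in> gw (\<lambda>h. - \<alpha> h)" "B x y \<noteq> 0" using B_pairing[of x \<alpha>] by (auto simp: gw_weight_space)
  then have "y \<noteq> 0" by auto
  then show ?thesis using that x y by (simp add: gw_weight_space)
qed

lemma weight_sum_orth:
  assumes "weight_sum M" "weight_sum N"
    and z: "\<And>\<alpha> \<beta> x y. ws \<alpha> \<subseteq> M \<Longrightarrow> ws \<beta> \<subseteq> N \<Longrightarrow> x \<in> ws \<alpha> \<Longrightarrow> y \<in> ws \<beta> \<Longrightarrow> B x y = 0"
    and xy: "x \<in> M" "y \<in> N"
  shows "B x y = 0"
proof (rule B_span_zero)
  show "x \<in> span (\<Union>{ws \<alpha> | \<alpha>. ws \<alpha> \<subseteq> M})" "y \<in> span (\<Union>{ws \<alpha> | \<alpha>. ws \<alpha> \<subseteq> N})"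
    using assms(1,2) xy by (auto simp: weight_sum_def)
  show "scale c u \<in> \<Union>{ws \<alpha> | \<alpha>. ws \<alpha> \<subseteq> M}" if "u \<in> \<Union>{ws \<alpha> | \<alpha>. ws \<alpha> \<subseteq> M}" for u c
    using that ws_scale by blast
  show "scale c u \<in> \<Union>{ws \<alpha> | \<alpha>. ws \<alpha> \<subseteq> N}" if "u \<in> \<Union>{ws \<alpha> | \<alpha>. ws \<alpha> \<subseteq> N}" for u c
    using that ws_scale by blast
  show "B u v = 0" if "u \<in> \<Union>{ws \<alpha> | \<alpha>. ws \<alpha> \<subseteq> M}" "v \<in> \<Union>{ws \<alpha> | \<alpha>. ws \<alpha> \<subseteq> N}" for u v
    using that z by blast
qed

lemma subalgebra_stable: "subalgebra W \<Longrightarrow> H \<subseteq> W \<Longrightarrow> stable H W"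
  unfolding subalgebra_def stable_def by blast

lemma subalgebra_weight_sum: "subalgebra W \<Longrightarrow> H \<subseteq> W \<Longrightarrow> weight_sum W"
  by (intro weight_sumI subalgebra_stable) (auto simp: subalgebra_def)

lemma H_Int_orth:
  assumes "v \<in> H" "\<And>y. y \<in> H \<Longrightarrow> B v y = 0" shows "v = 0"
proof (rule ccontr)
  assume "v \<noteq> 0"
  then obtain y where y: "y \<in> gw (\<lambda>h. - 0)" "B v y \<noteq> 0"
    using B_pairing[of v "\<lambda>_. 0"] gw_zero assms(1) by blast
  have "y \<in> H" using y(1) gw_zero by simp
  then show False using y(2) assms(2) by blast
qed

text \<open>
  For \<open>x\<close> of weight \<open>\<alpha>\<close> and \<open>y\<close> of weight \<open>- \<alpha>\<close> the bracket lies in \<open>n\<close> and in \<open>H\<close>, so it vanishes. With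
  \<open>[k, x] = x\<close> for some \<open>k\<close> in \<open>H\<close>, invariance gives \<open>B x y = B k [x, y] = 0\<close>.
\<close>

lemma ideal_orthogonal:
  assumes n: "weight_sum n" "H \<inter> n = {0}" and p: "weight_sum p"
    and np: "\<And>x y. x \<in> n \<Longrightarrow> y \<in> p \<Longrightarrow> bracket x y \<in> n" and xy: "x \<in> n" "y \<in> p"
  shows "B x y = 0"
proof (rule weight_sum_orth[OF n(1) p _ xy])
  fix \<alpha> \<beta> x y assume sub: "ws \<alpha> \<subseteq> n" "ws \<beta> \<subseteq> p" and x: "x \<in> ws \<alpha>" and y: "y \<in> ws \<beta>"
  show "B x y = 0"
  proof (cases "\<exists>h\<in>H. \<alpha> h + \<beta> h \<noteq> 0")
    case True then show ?thesis using B_ws_orth[OF x y] by blast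
  next
    case False
    show ?thesis
    proof (cases "nonzero_wt \<alpha>")
      case Z: False
      have "x = 0" using n(2) ws_zero[OF Z] sub x by blast
      then show ?thesis by simp
    next
      case True
      then obtain h where h: "h \<in> H" "\<alpha> h \<noteq> 0" by blast
      have "bracket x y \<in> n" using np sub x y by blast
      moreover have "bracket x y \<in> H" using gw_opp[of x \<alpha> y \<beta>] x y False by (simp add: gw_weight_space)
      ultimately have xy0: "bracket x y = 0" using n(2) by blast
      define k where "k = scale (1 / \<alpha> h) h"
      have "bracket k x = x" using x h by (simp add: k_def weight_space_def bracket_scale_left)
      then have "bracket x k = - x" using bracket_swap[of x k] by simp
      then have "B (- x) y = 0" using B_inv[of x k y] xy0 by simp
      then show ?thesis by (simp add: B_minus)
    qed
  qed
qed

text \<open>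
  An element of both is nilpotent, so central, and by reductivity it is not a commutator unless it is
  zero; but then some character of \<open>p\<close> does not vanish on it.
\<close>

lemma nilpotent_radical_Int:
  assumes p: "subalgebra p" "H \<subseteq> p" shows "H \<inter> nilpotent_radical p = {0}"
proof -
  have "x = 0" if x: "x \<in> H" "x \<in> nilpotent_radical p" for x
  proof (rule ccontr)
    assume x0: "x \<noteq> 0"
    have xp: "x \<in> p" using p x by blast
    have nil: "acts_nilpotently p x" by (rule nilpotent_radical(2)[OF p(1) x(2)])
    have "ad_nilp x" unfolding ad_nilp_def by (rule ad_nilpotent[OF p(1) xp nil])
    then have "bracket x y = 0" for y by (rule ad_nilp_central[OF x(1)])
    then have "x \<notin> D" using central_commutator_zero[OF red] x0 by blast
    moreover have "bracket y z \<in> D" for y z by (rule bracket_in_brackets) auto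
    ultimately show False using character_zero[OF p(1) xp nil subspace_D] by blast
  qed
  moreover have "0 \<in> nilpotent_radical p"
    using nilpotent_radical(1)[OF p(1)] subspace_0 unfolding ideal_in_def by blast
  ultimately show ?thesis using subspace_0[OF subspace_H] by blast
qed

text \<open>
  The radical \<open>r\<close> of \<open>B\<close> on \<open>l\<close> is an ideal that meets \<open>H\<close> in zero, so it acts nilpotently, hence trivially
  because \<open>l\<close> acts completely reducibly on the ambient algebra. If \<open>\<alpha>\<close> were a weight of \<open>l\<close> and \<open>- \<alpha>\<close> were not, \<open>r\<close>
  would contain \<open>ws \<alpha>\<close>, on which \<open>H\<close> acts nontrivially.
\<close>

lemma levi_symmetric:
  assumes l: "reductive_in_ambient l" "H \<subseteq> l" and a: "ws \<alpha> \<subseteq> l" "ws \<alpha> \<noteq> {0}"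
  shows "ws (\<lambda>h. - \<alpha> h) \<subseteq> l"
proof (rule ccontr)
  assume neg: "\<not> ws (\<lambda>h. - \<alpha> h) \<subseteq> l"
  have subl: "subalgebra l" and cr: "completely_reducible l UNIV" using l by (auto simp: reductive_in_ambient_def)
  have sl: "subspace l" and ll: "\<And>x y. x \<in> l \<Longrightarrow> y \<in> l \<Longrightarrow> bracket x y \<in> l" using subl by (auto simp: subalgebra_def)
  have nza: "nonzero_wt \<alpha>"
  proof (rule ccontr)
    assume "\<not> nonzero_wt \<alpha>"
    then have "ws (\<lambda>h. - \<alpha> h) = H" by (intro ws_zero) auto
    then show False using neg l by simp
  qed
  define r where "r = l \<inter> complex_orth l"
  have sr: "subspace r" unfolding r_def using sl subspace_complex_orth by (rule subspace_inter)
  have lr: "bracket x v \<in> r" if x: "x \<in> l" and v: "v \<in> r" for x v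
  proof -
    have "bracket x v \<in> complex_orth l"
      unfolding complex_orth_def
    proof (intro CollectI allI ballI)
      fix c z assume z: "z \<in> l"
      have "B (scale c (bracket x v)) z = B (bracket x (scale c v)) z" by (simp add: bracket_scale_right)
      also have "\<dots> = - B (scale c v) (bracket x z)" by (rule B_inv)
      also have "\<dots> = 0" using v ll[OF x z] by (simp add: r_def complex_orth_def)
      finally show "B (scale c (bracket x v)) z = 0" .
    qed
    then show ?thesis using ll x v by (simp add: r_def)
  qed
  have rH: "v = 0" if v: "v \<in> r" "v \<in> H" for v
  proof (rule H_Int_orth[OF v(2)])
    fix y assume "y \<in> H"
    then have "B (scale 1 v) y = 0" using v(1) l(2) unfolding r_def complex_orth_def by blast
    then show "B v y = 0" by simp
  qed
  define R where "R = {x\<in>r. \<exists>\<beta>. nonzero_wt \<beta> \<and> x \<in> ws \<beta>}"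
  have Rl: "R \<subseteq> l" by (auto simp: R_def r_def)
  have nilR: "ad.nil R"
  proof (rule ad.nil_weakly_closed)
    fix x y assume x: "x \<in> R" and y: "y \<in> R"
    obtain \<beta> \<gamma> where bg: "nonzero_wt \<beta>" "x \<in> ws \<beta>" "y \<in> ws \<gamma>" using x y by (auto simp: R_def)
    have "x \<in> l" "y \<in> r" using x y Rl by (auto simp: R_def)
    then have xyr: "bracket x y \<in> r" by (rule lr)
    have xyw: "bracket x y \<in> ws (\<lambda>h. \<beta> h + \<gamma> h)" by (rule weight_space_bracket[OF bg(2,3)])
    show "bracket x y \<in> R"
    proof (cases "nonzero_wt (\<lambda>h. \<beta> h + \<gamma> h)")
      case True
      then show ?thesis unfolding R_def
        by (intro CollectI conjI exI[of _ "\<lambda>h. \<beta> h + \<gamma> h"] xyr xyw)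
    next
      case False
      have "bracket x y \<in> H" using xyw ws_zero[OF False] by simp
      then have "bracket x y = 0" by (rule rH[OF xyr])
      then show ?thesis unfolding R_def using subspace_0[OF sr] zero_in_ws[of \<beta>] bg(1)
        by (intro CollectI conjI exI[of _ \<beta>]) simp_all
    qed
  next
    fix x assume "x \<in> R"
    then obtain \<beta> h where "x \<in> gw \<beta>" "h \<in> H" "\<beta> h \<noteq> 0" by (auto simp: R_def gw_weight_space)
    then have "ad_nilp x" by (rule gw_ad_nilp)
    then show "\<exists>k. \<forall>v. (bracket x ^^ k) v = 0" by (simp add: ad_nilp_def)
  qed simp
  have rR: "r \<subseteq> span R"
  proof -
    have "stable H r" using lr l(2) by (auto simp: stable_def)
    then have "r \<subseteq> span (\<Union>{r \<inter> gw \<alpha> | \<alpha>. True})" by (rule gw_decomposition[OF sr])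
    moreover have "r \<inter> gw \<beta> \<subseteq> span R" for \<beta>
    proof
      fix x assume x: "x \<in> r \<inter> gw \<beta>"
      show "x \<in> span R"
      proof (cases "nonzero_wt \<beta>")
        case True
        then have "x \<in> R" using x unfolding R_def gw_weight_space by (intro CollectI conjI exI[of _ \<beta>]) simp_all
        then show ?thesis by (rule span_base)
      next
        case False
        then have "x = 0" using x rH gw_zero'[OF False] by blast
        then show ?thesis by (simp add: span_zero)
      qed
    qed
    then have "span (\<Union>{r \<inter> gw \<alpha> | \<alpha>. True}) \<subseteq> span R" by (intro span_minimal) blast+
    ultimately show ?thesis by blast
  qed
  obtain x where x: "x \<in> ws \<alpha>" "x \<noteq> 0" using a(2) zero_in_ws by blast
  have wl: "weight_sum l" by (rule subalgebra_weight_sum[OF subl l(2)])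
  have "B v y = 0" if v: "v \<in> ws \<alpha>" and y: "y \<in> l" for v y
  proof (rule B_span_zero)
    show "v \<in> span (ws \<alpha>)" using v by (rule span_base)
    show "y \<in> span (\<Union>{ws \<beta> | \<beta>. ws \<beta> \<subseteq> l})" using wl y by (auto simp: weight_sum_def)
    show "B u w = 0" if u: "u \<in> ws \<alpha>" and w: "w \<in> \<Union>{ws \<beta> | \<beta>. ws \<beta> \<subseteq> l}" for u w
    proof -
      obtain \<beta> where b: "ws \<beta> \<subseteq> l" "w \<in> ws \<beta>" using w by blast
      have "\<exists>h\<in>H. \<alpha> h + \<beta> h \<noteq> 0" using ws_opp[of \<alpha> \<beta>] b(1) neg by auto
      then show ?thesis using B_ws_orth[OF u b(2)] by blast
    qed
  qed (use ws_scale in blast)+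
  then have "B (scale c x) y = 0" if "y \<in> l" for c y using that ws_scale[OF x(1)] by blast
  then have "x \<in> r" using x a(1) unfolding r_def complex_orth_def by blast
  then have xR: "x \<in> R" using x nza unfolding R_def by (intro CollectI conjI exI[of _ \<alpha>]) simp_all
  obtain h where h: "h \<in> H" "\<alpha> h \<noteq> 0" using nza by blast
  have "bracket x h = 0"
    by (rule completely_reducible_trivial[OF cr Rl nilR _ xR]) (use lr rR in \<open>auto simp: R_def\<close>)
  then have "bracket h x = 0" using bracket_swap[of h x] by simp
  then show False using x h by (simp add: weight_space_def)
qed

text \<open>
  For a common weight \<open>\<alpha>\<close> of \<open>n\<close> and \<open>n'\<close>, the weight \<open>- \<alpha>\<close> occurs neither in \<open>p\<close> nor in \<open>p'\<close>, hence neither in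
  \<open>b0\<close> nor in \<open>b'\<close>. The first means that \<open>ws \<alpha>\<close> is orthogonal to \<open>b0\<close> and so contained in \<open>b0\<close>, the second
  that it is not contained in \<open>b0\<close>.
\<close>

lemma opposite_nilradicals_Int:
  assumes b0: "borel b0" "H \<subseteq> b0" and opp: "opposite_borel H b0 b'"
    and p: "b0 \<subseteq> p" "b' \<subseteq> p'"
    and n: "subspace n" "stable H n" "H \<inter> n = {0}" "\<And>x y. x \<in> n \<Longrightarrow> y \<in> p \<Longrightarrow> B x y = 0"
    and n': "subspace n'" "stable H n'" "\<And>x y. x \<in> n' \<Longrightarrow> y \<in> p' \<Longrightarrow> B x y = 0"
  shows "n \<inter> n' = {0}"
proof (rule ccontr)
  assume "n \<inter> n' \<noteq> {0}"
  then obtain x where x: "x \<in> n \<inter> n'" "x \<noteq> 0" using subspace_0[OF n(1)] subspace_0[OF n'(1)] by blast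
  have sn: "subspace (n \<inter> n')" "stable H (n \<inter> n')"
    using n(1) n'(1) subspace_inter n(2) n'(2) unfolding stable_def by blast+
  obtain y \<alpha> where y: "y \<in> n \<inter> n'" "y \<in> ws \<alpha>" "y \<noteq> 0" using weight_sum_contains_weight[OF sn x] by blast
  have nz: "nonzero_wt \<alpha>" using ws_zero[of \<alpha>] y n(3) by blast
  have wn: "ws \<alpha> \<subseteq> n" "ws \<alpha> \<subseteq> n'" using ws_subset[OF _ y(2) _ y(3) nz] n(1) n'(1) y(1) by blast+
  have wsn: "ws \<alpha> \<noteq> {0}" using y by blast
  then obtain u v where uv: "u \<in> ws \<alpha>" "v \<in> ws (\<lambda>h. - \<alpha> h)" "B u v \<noteq> 0" "v \<noteq> 0" using B_ws_pairing by blast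
  have np: "v \<notin> p" "v \<notin> p'" using uv wn n(4) n'(3) by blast+
  have b'_eq: "b' = span (\<Union>{ws (\<lambda>h. - \<beta> h) | \<beta>. ws \<beta> \<noteq> {0} \<and> ws \<beta> \<subseteq> b0})"
    using opp by (simp add: opposite_borel_def)
  have nb: "\<not> ws \<alpha> \<subseteq> b0"
  proof
    assume "ws \<alpha> \<subseteq> b0"
    then have "v \<in> b'" unfolding b'_eq using uv(2) wsn by (intro span_base) blast
    then show False using np p by blast
  qed
  have subb: "subalgebra b0" using b0 by (simp add: borel_def)
  have wb: "weight_sum b0" by (rule subalgebra_weight_sum[OF subb b0(2)])
  have "b0 \<subseteq> span (\<Union>{b0 \<inter> ws \<beta> | \<beta>. True})"
  proof -
    have "\<Union>{ws \<beta> | \<beta>. ws \<beta> \<subseteq> b0} \<subseteq> \<Union>{b0 \<inter> ws \<beta> | \<beta>. True}" by blast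
    from span_mono[OF this] show ?thesis using wb unfolding weight_sum_def by blast
  qed
  then have orth: "complex_orth b0 \<subseteq> b0" by (rule complex_orth_subset[OF b0])
  have "B w z = 0" if w: "w \<in> ws \<alpha>" and z: "z \<in> b0" for w z
  proof (rule B_span_zero)
    show "w \<in> span (ws \<alpha>)" using w by (rule span_base)
    show "z \<in> span (\<Union>{ws \<beta> | \<beta>. ws \<beta> \<subseteq> b0})" using wb z by (auto simp: weight_sum_def)
    show "B s t = 0" if s: "s \<in> ws \<alpha>" and t: "t \<in> \<Union>{ws \<beta> | \<beta>. ws \<beta> \<subseteq> b0}" for s t
    proof -
      obtain \<beta> where b: "ws \<beta> \<subseteq> b0" "t \<in> ws \<beta>" using t by blast
      have "\<not> ws (\<lambda>h. - \<alpha> h) \<subseteq> b0" using np p uv by blast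
      then have "\<exists>h\<in>H. \<alpha> h + \<beta> h \<noteq> 0" using ws_opp[of \<alpha> \<beta>] b(1) by auto
      then show ?thesis using B_ws_orth[OF s b(2)] by blast
    qed
  qed (use ws_scale in blast)+
  then have "B (scale c w) z = 0" if "w \<in> ws \<alpha>" "z \<in> b0" for w z c using that ws_scale by blast
  then have "ws \<alpha> \<subseteq> complex_orth b0" unfolding complex_orth_def by blast
  then show False using orth nb by blast
qed

end

section \<open>Parabolic subalgebras and predecessors\<close>


locale manin_form_with_borel = cartan_with_borel scale bracket H B b
  for scale :: "complex \<Rightarrow> 'a::ab_group_add \<Rightarrow> 'a" and bracket :: "'a \<Rightarrow> 'a \<Rightarrow> 'a"
    and H :: "'a set" and B :: "'a \<Rightarrow> 'a \<Rightarrow> real" and b :: "'a set" +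
  assumes manin: "manin_form UNIV B"

locale parabolic_lagrangian = manin_form_with_borel scale bracket H B b
  for scale :: "complex \<Rightarrow> 'a::ab_group_add \<Rightarrow> 'a" and bracket :: "'a \<Rightarrow> 'a \<Rightarrow> 'a"
    and H :: "'a set" and B :: "'a \<Rightarrow> 'a \<Rightarrow> real" and b :: "'a set" +
  fixes p l n i :: "'a set"
  assumes p_subalgebra: "subalgebra p" and langlands: "langlands_decomposition p l n" and H_l: "H \<subseteq> l"
    and lagr: "lagrangian B i" and i_p: "i \<subseteq> p"
begin

lemma l_reductive: "reductive_in_ambient l" using langlands by (simp add: langlands_decomposition_def)
lemma l_subalgebra: "subalgebra l" using l_reductive by (simp add: reductive_in_ambient_def)
lemma subspace_l: "subspace l" using l_subalgebra by (simp add: subalgebra_def)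
lemma l_closed: "x \<in> l \<Longrightarrow> y \<in> l \<Longrightarrow> bracket x y \<in> l" using l_subalgebra by (simp add: subalgebra_def)
lemma subspace_p: "subspace p" using p_subalgebra by (simp add: subalgebra_def)
lemma p_closed: "x \<in> p \<Longrightarrow> y \<in> p \<Longrightarrow> bracket x y \<in> p" using p_subalgebra by (simp add: subalgebra_def)
lemma n_nilpotent_radical: "n = nilpotent_radical p" using langlands by (simp add: langlands_decomposition_def)
lemma n_ideal: "ideal_in n p" unfolding n_nilpotent_radical by (rule nilpotent_radical(1)[OF p_subalgebra])
lemma subspace_n: "subspace n" using n_ideal by (simp add: ideal_in_def)
lemma n_p: "n \<subseteq> p" using n_ideal by (simp add: ideal_in_def)
lemma p_n: "x \<in> p \<Longrightarrow> y \<in> n \<Longrightarrow> bracket x y \<in> n" using n_ideal by (simp add: ideal_in_def stable_def)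
lemma n_pr: "y \<in> n \<Longrightarrow> x \<in> p \<Longrightarrow> bracket y x \<in> n"
  using subspace_neg[OF subspace_n p_n] bracket_swap[of y x] by simp
lemma direct: "direct_sum_of l n p" using langlands unfolding langlands_decomposition_def by blast
lemma l_n: "l \<inter> n = {0}" using direct by (simp add: direct_sum_of_def)
lemma p_sum: "p = {x + y | x y. x \<in> l \<and> y \<in> n}" using direct by (simp add: direct_sum_of_def)
lemma l_p: "l \<subseteq> p"
proof
  fix x assume "x \<in> l"
  then have "x = x + 0 \<and> x \<in> l \<and> 0 \<in> n" using subspace_0[OF subspace_n] by simp
  then show "x \<in> p" unfolding p_sum by blast
qed
lemma H_p: "H \<subseteq> p" using H_l l_p by blast
lemma H_n: "H \<inter> n = {0}" unfolding n_nilpotent_radical by (rule nilpotent_radical_Int[OF p_subalgebra H_p])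

lemma l_n_unique:
  assumes "x + y = x' + y'" "x \<in> l" "x' \<in> l" "y \<in> n" "y' \<in> n" shows "x = x' \<and> y = y'"
proof -
  have e: "x - x' = y' - y" using assms(1) by (simp add: algebra_simps)
  have "x - x' \<in> l" "y' - y \<in> n" using assms subspace_l subspace_n by (auto intro: subspace_diff)
  then have "x - x' \<in> l \<inter> n" using e by simp
  then have "x - x' = 0" unfolding l_n by blast
  then show ?thesis using assms(1) by simp
qed

lemma stable_H: "stable H l" "stable H n" "stable H p"
  using subalgebra_stable l_subalgebra p_subalgebra H_l H_p p_n unfolding stable_def[of H n] by blast+

lemma weight_sums: "weight_sum l" "weight_sum n" "weight_sum p"
  using subalgebra_weight_sum l_subalgebra p_subalgebra H_l H_p weight_sumI[OF subspace_n stable_H(2)] H_n by blast+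

lemma B_n_p: "x \<in> n \<Longrightarrow> y \<in> p \<Longrightarrow> B x y = 0"
  by (rule ideal_orthogonal[OF weight_sums(2) H_n weight_sums(3) n_pr])

lemma subspace_i: "re.subspace i" and i_closed: "x \<in> i \<Longrightarrow> y \<in> i \<Longrightarrow> bracket x y \<in> i"
  and i_isotropic: "x \<in> i \<Longrightarrow> y \<in> i \<Longrightarrow> B x y = 0"
  using lagr by (auto simp: lagrangian_def re.subalgebra_def isotropic_def)

text \<open>
  Since \<open>n\<close> is orthogonal to \<open>p\<close>, it is orthogonal to \<open>i\<close>.
\<close>

lemma n_i: "n \<subseteq> i"
proof
  fix x assume x: "x \<in> n"
  show "x \<in> i"
  proof (rule lagrangian_maximal[OF _ lagr])
    show "has_signature UNIV B (dim UNIV) (dim UNIV)" using manin by (simp add: manin_form_def)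
    show "B x x = 0" using B_n_p x n_p by blast
    show "B x y = 0" if "y \<in> i" for y using B_n_p x i_p that by blast
  qed
qed

lemma weight_in_l_or_n: "ws \<alpha> \<subseteq> p \<Longrightarrow> ws \<alpha> \<subseteq> l \<or> ws \<alpha> \<subseteq> n"
proof (cases "ws \<alpha> = {0}")
  case True
  then show ?thesis using subspace_0[OF subspace_l] by simp
next
  case False
  assume a: "ws \<alpha> \<subseteq> p"
  obtain x where x: "x \<in> ws \<alpha>" "x \<noteq> 0" using False zero_in_ws by blast
  define A where "A = \<Union>{ws \<beta> | \<beta>. ws \<beta> \<subseteq> l \<or> ws \<beta> \<subseteq> n}"
  have "l \<subseteq> span A" "n \<subseteq> span A"
  proof -
    have "\<Union>{ws \<beta> | \<beta>. ws \<beta> \<subseteq> l} \<subseteq> A" "\<Union>{ws \<beta> | \<beta>. ws \<beta> \<subseteq> n} \<subseteq> A" unfolding A_def by blast+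
    from this[THEN span_mono] show "l \<subseteq> span A" "n \<subseteq> span A"
      using weight_sums unfolding weight_sum_def by blast+
  qed
  then have "p \<subseteq> span A" unfolding p_sum by (blast intro: span_add)
  then have "x \<in> span A" using a x by blast
  then obtain \<beta> where "ws \<beta> \<subseteq> l \<or> ws \<beta> \<subseteq> n" "ws \<beta> = ws \<alpha>"
    using ws_independent[OF x, of "\<lambda>\<beta>. ws \<beta> \<subseteq> l \<or> ws \<beta> \<subseteq> n"] unfolding A_def by blast
  then show ?thesis by simp
qed

lemma weight_sum_split:
  assumes X: "weight_sum X" "X \<subseteq> p" and x: "x \<in> X"
  obtains u v where "x = u + v" "u \<in> X" "u \<in> l" "v \<in> X" "v \<in> n"
proof -
  have sX: "subspace X" using X by (simp add: weight_sum_def)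
  define S where "S = {u + v | u v. u \<in> X \<inter> l \<and> v \<in> X \<inter> n}"
  have sS: "subspace S"
    unfolding S_def using sX subspace_l subspace_n by (intro subspace_sums subspace_inter)
  have "\<Union>{ws \<alpha> | \<alpha>. ws \<alpha> \<subseteq> X} \<subseteq> S"
  proof
    fix y assume "y \<in> \<Union>{ws \<alpha> | \<alpha>. ws \<alpha> \<subseteq> X}"
    then obtain \<alpha> where a: "ws \<alpha> \<subseteq> X" "y \<in> ws \<alpha>" by blast
    have z: "0 \<in> X \<inter> l" "0 \<in> X \<inter> n" using subspace_0 sX subspace_l subspace_n by blast+
    have "ws \<alpha> \<subseteq> l \<or> ws \<alpha> \<subseteq> n" using weight_in_l_or_n a X by blast
    then have "y \<in> X \<inter> l \<or> y \<in> X \<inter> n" using a by blast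
    moreover have "y = y + 0" "y = 0 + y" by simp_all
    ultimately show "y \<in> S" unfolding S_def using z by blast
  qed
  then have "span (\<Union>{ws \<alpha> | \<alpha>. ws \<alpha> \<subseteq> X}) \<subseteq> S" using sS by (rule span_minimal)
  then have "x \<in> S" using X x unfolding weight_sum_def by blast
  then show ?thesis using that unfolding S_def by blast
qed

lemma proj_l_n:
  assumes a: "a \<in> l" and c: "c \<in> n" shows "weight_proj H n (a + c) = a"
proof -
  define W where "W = weight_complement H n"
  have sW: "subspace W" by (simp add: W_def weight_complement_def)
  have lW: "l \<subseteq> W"
  proof -
    have "ws \<alpha> \<subseteq> W" if "ws \<alpha> \<subseteq> l" for \<alpha>
    proof (cases "ws \<alpha> \<subseteq> n")
      case True
      then have "ws \<alpha> \<subseteq> {0}" using that l_n by blast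
      then show ?thesis using subspace_0[OF sW] by blast
    next
      case False
      then have "ws \<alpha> \<subseteq> \<Union>{ws \<beta> | \<beta>. \<not> ws \<beta> \<subseteq> n}" by blast
      then show ?thesis unfolding W_def weight_complement_def using span_superset by (rule order_trans)
    qed
    then have "span (\<Union>{ws \<alpha> | \<alpha>. ws \<alpha> \<subseteq> l}) \<subseteq> W" using sW by (intro span_minimal) blast+
    then show ?thesis using weight_sums(1) unfolding weight_sum_def by blast
  qed
  have Wn: "W \<inter> n = {0}"
  proof (rule ccontr)
    assume "W \<inter> n \<noteq> {0}"
    then obtain x where x: "x \<in> W \<inter> n" "x \<noteq> 0" using subspace_0[OF sW] subspace_0[OF subspace_n] by blast
    have "stable H W"
      unfolding stable_def
    proof (intro ballI)
      fix h w assume h: "h \<in> H" and w: "w \<in> W"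
      show "bracket h w \<in> W"
      proof (rule bracket_span_right[OF sW])
        show "w \<in> span (\<Union>{ws \<beta> | \<beta>. \<not> ws \<beta> \<subseteq> n})" using w by (simp add: W_def weight_complement_def)
        fix z assume "z \<in> \<Union>{ws \<beta> | \<beta>. \<not> ws \<beta> \<subseteq> n}"
        then obtain \<beta> where z: "z \<in> ws \<beta>" "\<not> ws \<beta> \<subseteq> n" by blast
        then have "bracket h z = scale (\<beta> h) z" using h by (simp add: weight_space_def)
        moreover have "z \<in> W" unfolding W_def weight_complement_def using z by (intro span_base) blast
        ultimately show "bracket h z \<in> W" using subspace_scale[OF sW] by simp
      qed
    qed
    then have "stable H (W \<inter> n)" using stable_H(2) unfolding stable_def by blast
    then obtain y \<alpha> where y: "y \<in> W \<inter> n" "y \<in> ws \<alpha>" "y \<noteq> 0"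
      using weight_sum_contains_weight[OF subspace_inter[OF sW subspace_n] _ x] by blast
    have nz: "nonzero_wt \<alpha>"
    proof (rule ccontr)
      assume "\<not> nonzero_wt \<alpha>"
      then have "y \<in> H" using y(2) ws_zero by blast
      then show False using y H_n by blast
    qed
    have sub: "ws \<alpha> \<subseteq> n" using y by (intro ws_subset[OF subspace_n y(2) _ y(3) nz]) blast
    have "y \<in> span (\<Union>{ws \<beta> | \<beta>. \<not> ws \<beta> \<subseteq> n})" using y by (simp add: W_def weight_complement_def)
    then obtain \<beta> where "\<not> ws \<beta> \<subseteq> n" "ws \<beta> = ws \<alpha>" using ws_independent[OF y(2,3), of "\<lambda>\<beta>. \<not> ws \<beta> \<subseteq> n"] by blast
    then show False using sub by simp
  qed
  show ?thesis
    unfolding weight_proj_def proj_along_def W_def[symmetric]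
  proof (rule the_equality)
    show "a \<in> W \<and> a + c - a \<in> n" using lW a c by auto
    fix w assume w: "w \<in> W \<and> a + c - w \<in> n"
    have "w - a \<in> W" using w lW a subspace_diff[OF sW] by blast
    moreover have "c - (a + c - w) \<in> n" using w c subspace_diff[OF subspace_n] by blast
    then have "w - a \<in> n" by (simp add: algebra_simps)
    ultimately have "w - a = 0" using Wn by blast
    then show "w = a" by simp
  qed
qed

lemma Int_in_derived:
  assumes X: "weight_sum X" "X \<subseteq> l" "H \<inter> X = {0}" shows "X \<subseteq> brackets l l"
proof -
  have "ws \<alpha> \<subseteq> brackets l l" if a: "ws \<alpha> \<subseteq> X" for \<alpha>
  proof
    fix x assume x: "x \<in> ws \<alpha>"
    show "x \<in> brackets l l"
    proof (cases "nonzero_wt \<alpha>")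
      case True
      then obtain h where h: "h \<in> H" "\<alpha> h \<noteq> 0" by blast
      have "bracket (scale (1 / \<alpha> h) h) x = x" using x h by (simp add: weight_space_def bracket_scale_left)
      moreover have "scale (1 / \<alpha> h) h \<in> l" using subspace_scale[OF subspace_l] H_l h by blast
      moreover have "x \<in> l" using x a X by blast
      ultimately show ?thesis using bracket_in_brackets by metis
    next
      case False
      then have "x = 0" using ws_zero[OF False] x a X(3) by blast
      then show ?thesis by (simp add: brackets_def span_zero)
    qed
  qed
  then have "span (\<Union>{ws \<alpha> | \<alpha>. ws \<alpha> \<subseteq> X}) \<subseteq> brackets l l"
    by (intro span_minimal) (auto simp: brackets_def)
  then show ?thesis using X(1) unfolding weight_sum_def by blast
qed

lemma derived_l: "brackets l l \<subseteq> l"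
  by (rule brackets_subset[OF subspace_l l_closed])

end

locale manin_pair = manin_form_with_borel scale bracket H B b
    + s: parabolic_lagrangian scale bracket H B b p l n i
    + s': parabolic_lagrangian scale bracket H B b p' l' n' i'
  for scale :: "complex \<Rightarrow> 'a::ab_group_add \<Rightarrow> 'a" and bracket :: "'a \<Rightarrow> 'a \<Rightarrow> 'a"
    and H :: "'a set" and B :: "'a \<Rightarrow> 'a \<Rightarrow> real" and b p l n i p' l' n' i' :: "'a set" +
  assumes n_n': "n \<inter> n' = {0}"
begin

text \<open>
  An explicit form of the image of \<open>i \<inter> l \<inter> p'\<close> under the projection along \<open>n'\<close>, see \<open>predecessor_eq\<close>.
\<close>

definition predecessor :: "'a set" where
  "predecessor = {a \<in> l \<inter> l'. \<exists>c \<in> l \<inter> n'. a + c \<in> i}"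

lemma l_p'_split:
  assumes "x \<in> l" "x \<in> p'"
  obtains a c where "x = a + c" "a \<in> l \<inter> l'" "c \<in> l \<inter> n'"
proof -
  have "subalgebra (l \<inter> p')" unfolding subalgebra_def
    using subspace_inter[OF s.subspace_l s'.subspace_p] s.l_closed s'.p_closed by blast
  then have "weight_sum (l \<inter> p')" using s.H_l s'.H_p by (intro subalgebra_weight_sum) blast+
  then show ?thesis using s'.weight_sum_split[of "l \<inter> p'" x] assms that by blast
qed

text \<open>
  A fourth component in \<open>n \<inter> n'\<close> is zero.
\<close>

lemma p_p'_split:
  assumes "x \<in> p" "x \<in> p'"
  obtains a c d where "x = a + c + d" "a \<in> l \<inter> l'" "c \<in> l \<inter> n'" "d \<in> n \<inter> l'"
proof -
  have "subalgebra (p \<inter> p')" unfolding subalgebra_def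
    using subspace_inter[OF s.subspace_p s'.subspace_p] s.p_closed s'.p_closed by blast
  then have "weight_sum (p \<inter> p')" using s.H_p s'.H_p by (intro subalgebra_weight_sum) blast+
  then obtain u v where uv: "x = u + v" "u \<in> l" "u \<in> p'" "v \<in> n" "v \<in> p'"
    using s.weight_sum_split[of "p \<inter> p'" x] assms by blast
  obtain a c where ac: "u = a + c" "a \<in> l \<inter> l'" "c \<in> l \<inter> n'" using l_p'_split[OF uv(2,3)] by blast
  have "weight_sum (n \<inter> p')"
  proof (rule weight_sumI)
    show "subspace (n \<inter> p')" by (rule subspace_inter[OF s.subspace_n s'.subspace_p])
    show "stable H (n \<inter> p')" using s.stable_H(2) s'.stable_H(3) unfolding stable_def by blast
    have "0 \<in> p'" by (rule subspace_0[OF s'.subspace_p])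
    then show "H \<subseteq> n \<inter> p' \<or> H \<inter> (n \<inter> p') = {0}" using s.H_n by blast
  qed
  then obtain d d' where d: "v = d + d'" "d \<in> n" "d \<in> l'" "d' \<in> n" "d' \<in> n'"
    using s'.weight_sum_split[of "n \<inter> p'" v] uv by blast
  then have "d' = 0" using n_n' by blast
  then show ?thesis using that[of a c d] uv ac d by simp
qed

lemma predecessor_eq: "weight_proj H n' ` (i \<inter> l \<inter> p') = predecessor"
proof
  show "weight_proj H n' ` (i \<inter> l \<inter> p') \<subseteq> predecessor"
  proof
    fix y assume "y \<in> weight_proj H n' ` (i \<inter> l \<inter> p')"
    then obtain x where x: "x \<in> i" "x \<in> l" "x \<in> p'" "y = weight_proj H n' x" by blast
    obtain a c where ac: "x = a + c" "a \<in> l \<inter> l'" "c \<in> l \<inter> n'" using l_p'_split[OF x(2,3)] by blast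
    then have "y = a" using x(4) s'.proj_l_n[of a c] by simp
    then show "y \<in> predecessor" unfolding predecessor_def using ac x(1) by blast
  qed
  show "predecessor \<subseteq> weight_proj H n' ` (i \<inter> l \<inter> p')"
  proof
    fix a assume "a \<in> predecessor"
    then obtain c where ac: "a \<in> l \<inter> l'" "c \<in> l \<inter> n'" "a + c \<in> i" by (auto simp: predecessor_def)
    have "a + c \<in> l" using ac subspace_add[OF s.subspace_l] by blast
    moreover have "a + c \<in> p'" using ac s'.l_p s'.n_p subspace_add[OF s'.subspace_p] by blast
    moreover have "a = weight_proj H n' (a + c)" using s'.proj_l_n[of a c] ac by simp
    ultimately show "a \<in> weight_proj H n' ` (i \<inter> l \<inter> p')" using ac(3) by blast
  qed
qed

lemma predecessor_subset: "predecessor \<subseteq> l \<inter> l'" by (auto simp: predecessor_def)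

lemma predecessor_subalgebra: "re.subalgebra predecessor"
  unfolding re.subalgebra_def re.subspace_def
proof (intro conjI ballI allI)
  have sL: "subspace (l \<inter> l')" and sN: "subspace (l \<inter> n')"
    using subspace_inter s.subspace_l s'.subspace_l s'.subspace_n by blast+
  have "0 + 0 \<in> i" using re.subspace_0[OF s.subspace_i] by simp
  then show "0 \<in> predecessor" unfolding predecessor_def using subspace_0[OF sL] subspace_0[OF sN] by blast
  fix x assume "x \<in> predecessor"
  then obtain c where x: "x \<in> l \<inter> l'" "c \<in> l \<inter> n'" "x + c \<in> i" by (auto simp: predecessor_def)
  {
    fix r
    have "rscale r x + rscale r c \<in> i" using re.subspace_scale[OF s.subspace_i x(3), of r] by (simp add: scale_right_distrib)
    then show "rscale r x \<in> predecessor" unfolding predecessor_def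
      using subspace_scale[OF sL x(1)] subspace_scale[OF sN x(2)] by blast
  }
  fix y assume "y \<in> predecessor"
  then obtain d where y: "y \<in> l \<inter> l'" "d \<in> l \<inter> n'" "y + d \<in> i" by (auto simp: predecessor_def)
  have xycd: "(x + y) + (c + d) = (x + c) + (y + d)" by (simp add: add_ac)
  have "(x + y) + (c + d) \<in> i" unfolding xycd by (rule re.subspace_add[OF s.subspace_i x(3) y(3)])
  then show "x + y \<in> predecessor" unfolding predecessor_def
    using subspace_add[OF sL x(1) y(1)] subspace_add[OF sN x(2) y(2)] by blast
  have lp: "x \<in> p'" "y \<in> p'" "c \<in> p'" using x y s'.l_p s'.n_p by blast+
  have cd: "c \<in> n'" "d \<in> n'" "c \<in> l" "d \<in> l" and xy: "x \<in> l" "y \<in> l" using x y by blast+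
  have "bracket x d + bracket c y + bracket c d \<in> n'"
    by (intro subspace_add[OF s'.subspace_n] s'.p_n[OF lp(1) cd(2)] s'.n_pr[OF cd(1) lp(2)] s'.p_n[OF lp(3) cd(2)])
  moreover have "bracket x d + bracket c y + bracket c d \<in> l"
    by (intro subspace_add[OF s.subspace_l] s.l_closed cd xy)
  moreover have "bracket x y + (bracket x d + bracket c y + bracket c d) = bracket (x + c) (y + d)"
    by (simp add: bracket_add_left bracket_add_right add_ac)
  moreover have "bracket (x + c) (y + d) \<in> i" using s.i_closed x y by blast
  moreover have "bracket x y \<in> l \<inter> l'" using x y s.l_closed s'.l_closed by blast
  ultimately show "bracket x y \<in> predecessor" unfolding predecessor_def by (metis (mono_tags, lifting) IntI mem_Collect_eq)
qed

lemma predecessor_isotropic: "isotropic B predecessor"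
  unfolding isotropic_def
proof (intro ballI)
  fix x y assume "x \<in> predecessor" "y \<in> predecessor"
  then obtain c d where x: "x \<in> l \<inter> l'" "c \<in> l \<inter> n'" "x + c \<in> i" and y: "y \<in> l \<inter> l'" "d \<in> l \<inter> n'" "y + d \<in> i"
    by (auto simp: predecessor_def)
  have "B c (y + d) = 0" using x y s'.l_p s'.n_p subspace_add[OF s'.subspace_p] by (intro s'.B_n_p) blast+
  moreover have "B d x = 0" using x y s'.l_p by (intro s'.B_n_p) blast+
  moreover have "B (x + c) (y + d) = 0" using s.i_isotropic x y by blast
  ultimately show "B x y = 0" using B_sym[of x d] by (simp add: B_add B_add_right)
qed

text \<open>
  By \<open>levi_symmetric\<close> the weights of \<open>l \<inter> l'\<close> are symmetric, so \<open>B\<close> pairs this subspace only with itself.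
\<close>

lemma l_l'_nondegenerate:
  assumes x: "x \<in> l \<inter> l'" and z: "\<And>y. y \<in> l \<inter> l' \<Longrightarrow> B x y = 0" shows "x = 0"
proof (rule B_zero_of_gw)
  fix \<beta> y assume "y \<in> gw \<beta>"
  then have y: "y \<in> ws \<beta>" by (simp add: gw_weight_space)
  show "B x y = 0"
  proof (cases "ws \<beta> \<subseteq> l \<inter> l'")
    case True then show ?thesis using z y by blast
  next
    case False
    have "subalgebra (l \<inter> l')" unfolding subalgebra_def
      using subspace_inter[OF s.subspace_l s'.subspace_l] s.l_closed s'.l_closed by blast
    then have "weight_sum (l \<inter> l')" using s.H_l s'.H_l by (intro subalgebra_weight_sum) blast+
    then have xs: "x \<in> span (\<Union>{ws \<alpha> | \<alpha>. ws \<alpha> \<subseteq> l \<inter> l'})" using x unfolding weight_sum_def by blast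
    show ?thesis
    proof (rule B_span_zero[OF _ _ _ xs])
      show "y \<in> span (ws \<beta>)" using y by (rule span_base)
      show "B u v = 0" if u: "u \<in> \<Union>{ws \<alpha> | \<alpha>. ws \<alpha> \<subseteq> l \<inter> l'}" and v: "v \<in> ws \<beta>" for u v
      proof -
        obtain \<alpha> where a: "ws \<alpha> \<subseteq> l \<inter> l'" "u \<in> ws \<alpha>" using u by blast
        show ?thesis
        proof (cases "\<exists>h\<in>H. \<alpha> h + \<beta> h \<noteq> 0")
          case True then show ?thesis using B_ws_orth[OF a(2) v] by blast
        next
          case opp: False
          have "ws \<alpha> = {0}"
          proof (rule ccontr)
            assume nz: "ws \<alpha> \<noteq> {0}"
            have "ws (\<lambda>h. - \<alpha> h) \<subseteq> l" "ws (\<lambda>h. - \<alpha> h) \<subseteq> l'"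
              using levi_symmetric[OF s.l_reductive s.H_l _ nz] levi_symmetric[OF s'.l_reductive s'.H_l _ nz] a(1) by blast+
            moreover have "ws \<beta> = ws (\<lambda>h. - \<alpha> h)" using opp by (intro ws_opp) blast
            ultimately show False using False by blast
          qed
          then show ?thesis using a(2) by simp
        qed
      qed
    qed (use ws_scale in blast)+
  qed
qed

lemma components_zero:
  assumes "a \<in> l \<inter> l'" "c \<in> l \<inter> n'" "d \<in> n \<inter> l'" "a + c + d = 0" shows "a = 0"
proof -
  have z: "0 \<in> n" "0 \<in> n'" "0 \<in> l" "0 \<in> l'"
    using subspace_0 s.subspace_n s'.subspace_n s.subspace_l s'.subspace_l by blast+
  have "a + c \<in> l" using assms subspace_add[OF s.subspace_l] by blast
  then have "a + c = 0 \<and> d = 0" using s.l_n_unique[of "a + c" d 0 0] assms z by simp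
  then show ?thesis using s'.l_n_unique[of a c 0 0] assms z by simp
qed

text \<open>
  The dimensions of \<open>i\<close> and \<open>i'\<close> add up to that of the whole space.
\<close>

lemma triple_iff_Int: "manin_triple UNIV B i i' \<longleftrightarrow> i \<inter> i' = {0}"
proof
  assume "manin_triple UNIV B i i'"
  then show "i \<inter> i' = {0}" by (simp add: manin_triple_def direct_sum_of_def)
next
  assume int: "i \<inter> i' = {0}"
  define S where "S = {u + v | u v. u \<in> i \<and> v \<in> i'}"
  have "re.dim S + re.dim (i \<inter> i') = re.dim i + re.dim i'"
    unfolding S_def by (rule re.dim_sums_Int[OF s.subspace_i s'.subspace_i])
  then have "re.dim S = re.dim UNIV"
    using int s.lagr s'.lagr re_dim[OF subspace_UNIV] by (simp add: lagrangian_def)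
  moreover have "re.subspace S" unfolding S_def by (rule re.subspace_sums[OF s.subspace_i s'.subspace_i])
  ultimately have "S = UNIV" using re.subspace_dim_equal[of S UNIV] by simp
  then have "direct_sum_of i i' UNIV" using int by (simp add: direct_sum_of_def S_def)
  then show "manin_triple UNIV B i i'"
    using manin s.lagr s'.lagr by (simp add: manin_triple_def lagrangian_def)
qed

text \<open>
  The space \<open>l \<inter> n'\<close> has only nonzero weights, so it consists of brackets with elements of \<open>H\<close>. Here the
  derived algebra of \<open>l\<close> can be replaced by \<open>l\<close>.
\<close>

lemma Int_derived_eq: "n' \<inter> (i \<inter> brackets l l) = n' \<inter> (i \<inter> l)"
proof -
  have "weight_sum (l \<inter> n')"
  proof (rule weight_sumI)
    show "subspace (l \<inter> n')" by (rule subspace_inter[OF s.subspace_l s'.subspace_n])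
    show "stable H (l \<inter> n')" using s.stable_H(1) s'.stable_H(2) unfolding stable_def by blast
    have "0 \<in> l" by (rule subspace_0[OF s.subspace_l])
    then show "H \<subseteq> l \<inter> n' \<or> H \<inter> (l \<inter> n') = {0}" using s'.H_n by blast
  qed
  moreover have "H \<inter> (l \<inter> n') = {0}" using s'.H_n subspace_0[OF s.subspace_l] by blast
  ultimately have "l \<inter> n' \<subseteq> brackets l l" by (intro s.Int_in_derived) blast+
  then show ?thesis using s.derived_l by blast
qed

end

text \<open>
  Both predecessors at once: \<open>swap.predecessor\<close> is the construction with the roles of the two sides
  exchanged.
\<close>

locale manin_pair_symmetric = manin_pair scale bracket H B b p l n i p' l' n' i'
    + swap: manin_pair scale bracket H B b p' l' n' i' p l n i
  for scale :: "complex \<Rightarrow> 'a::ab_group_add \<Rightarrow> 'a" and bracket :: "'a \<Rightarrow> 'a \<Rightarrow> 'a"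
    and H :: "'a set" and B :: "'a \<Rightarrow> 'a \<Rightarrow> real" and b p l n i p' l' n' i' :: "'a set"
begin

text \<open>
  If \<open>a\<close> is in both predecessors, \<open>a + c\<close> in \<open>i\<close> and \<open>a + d\<close> in \<open>i'\<close>, then \<open>a + c + d\<close> is in both \<open>i\<close> and \<open>i'\<close>,
  because \<open>i\<close> contains \<open>n\<close> and \<open>i'\<close> contains \<open>n'\<close>. Conversely, the components in \<open>i\<close> and \<open>i'\<close> of an element of
  \<open>l \<inter> l'\<close> both lie in \<open>p \<inter> p'\<close>, and their components in \<open>l \<inter> l'\<close> are in the predecessors.
\<close>

lemma predecessor_sum:
  assumes "manin_triple UNIV B i i'" shows "direct_sum_of predecessor swap.predecessor (l \<inter> l')"
proof -
  have int: "i \<inter> i' = {0}" using assms triple_iff_Int by blast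
  have sL: "subspace (l \<inter> l')" using subspace_inter s.subspace_l s'.subspace_l by blast
  have "a = 0" if a: "a \<in> predecessor" "a \<in> swap.predecessor" for a
  proof -
    obtain c where c: "a \<in> l \<inter> l'" "c \<in> l \<inter> n'" "a + c \<in> i" using a(1) by (auto simp: predecessor_def)
    obtain d where d: "d \<in> l' \<inter> n" "a + d \<in> i'" using a(2) by (auto simp: swap.predecessor_def)
    have di: "d \<in> i" and ci: "c \<in> i'" using c d s.n_i s'.n_i by blast+
    have "(a + c) + d \<in> i" by (rule re.subspace_add[OF s.subspace_i c(3) di])
    moreover have "(a + d) + c \<in> i'" by (rule re.subspace_add[OF s'.subspace_i d(2) ci])
    moreover have "(a + d) + c = (a + c) + d" by (simp add: add_ac)
    ultimately have "a + c + d \<in> i \<inter> i'" by simp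
    then have "a + c + d = 0" unfolding int by blast
    then show ?thesis using components_zero[of a c d] c d by blast
  qed
  moreover have "0 \<in> predecessor" "0 \<in> swap.predecessor"
    using re.subspace_0 predecessor_subalgebra swap.predecessor_subalgebra unfolding re.subalgebra_def by blast+
  ultimately have "predecessor \<inter> swap.predecessor = {0}" by blast
  moreover have "l \<inter> l' = {u + v | u v. u \<in> predecessor \<and> v \<in> swap.predecessor}"
  proof
    show "{u + v | u v. u \<in> predecessor \<and> v \<in> swap.predecessor} \<subseteq> l \<inter> l'"
      using predecessor_subset swap.predecessor_subset subspace_add[OF sL] by blast
    show "l \<inter> l' \<subseteq> {u + v | u v. u \<in> predecessor \<and> v \<in> swap.predecessor}"
    proof
      fix x assume x: "x \<in> l \<inter> l'"
      have "UNIV = {u + v | u v. u \<in> i \<and> v \<in> i'}" using assms by (simp add: manin_triple_def direct_sum_of_def)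
      then obtain y y' where y: "x = y + y'" "y \<in> i" "y' \<in> i'" by blast
      have xp: "x \<in> p" "x \<in> p'" and yp: "y \<in> p" "y' \<in> p'" using x y s.l_p s'.l_p s.i_p s'.i_p by blast+
      have "x - y' \<in> p'" using xp yp subspace_diff[OF s'.subspace_p] by blast
      moreover have "x - y \<in> p" using xp yp subspace_diff[OF s.subspace_p] by blast
      ultimately have yp': "y \<in> p'" "y' \<in> p" using y(1) by simp_all
      obtain a c d where a: "y = a + c + d" "a \<in> l \<inter> l'" "c \<in> l \<inter> n'" "d \<in> n \<inter> l'"
        using p_p'_split[OF yp(1) yp'(1)] by blast
      obtain a' c' d' where a': "y' = a' + c' + d'" "a' \<in> l \<inter> l'" "c' \<in> l \<inter> n'" "d' \<in> n \<inter> l'"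
        using p_p'_split[OF yp'(2) yp(2)] by blast
      have "y - d \<in> i" using y(2) a(4) s.n_i re.subspace_diff[OF s.subspace_i] by blast
      then have "a + c \<in> i" using a(1) by simp
      then have ap: "a \<in> predecessor" unfolding predecessor_def using a by blast
      have "y' - c' \<in> i'" using y(3) a'(3) s'.n_i re.subspace_diff[OF s'.subspace_i] by blast
      then have "a' + d' \<in> i'" using a'(1) by (simp add: algebra_simps)
      then have ap': "a' \<in> swap.predecessor" unfolding swap.predecessor_def using a' by blast
      have "(a + a' - x) + (c + c') + (d + d') = 0" using y(1) a(1) a'(1) by simp
      moreover have "a + a' - x \<in> l \<inter> l'" using a a' x by (intro subspace_diff[OF sL] subspace_add[OF sL])
      moreover have "c + c' \<in> l \<inter> n'"
        using a a' subspace_add[OF subspace_inter[OF s.subspace_l s'.subspace_n]] by blast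
      moreover have "d + d' \<in> n \<inter> l'"
        using a a' subspace_add[OF subspace_inter[OF s.subspace_n s'.subspace_l]] by blast
      ultimately have "a + a' - x = 0" using components_zero by blast
      then have "x = a + a'" by simp
      then show "x \<in> {u + v | u v. u \<in> predecessor \<and> v \<in> swap.predecessor}" using ap ap' by blast
    qed
  qed
  ultimately show ?thesis by (simp add: direct_sum_of_def)
qed

lemma predecessor_triple:
  assumes "manin_triple UNIV B i i'" shows "manin_triple (l \<inter> l') B predecessor swap.predecessor"
proof -
  have sum: "direct_sum_of predecessor swap.predecessor (l \<inter> l')" by (rule predecessor_sum[OF assms])
  have sL: "subspace (l \<inter> l')" using subspace_inter s.subspace_l s'.subspace_l by blast
  have subs: "re.subspace predecessor" "re.subspace swap.predecessor"
    using predecessor_subalgebra swap.predecessor_subalgebra by (simp_all add: re.subalgebra_def)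
  have iso: "\<And>x y. x \<in> predecessor \<Longrightarrow> y \<in> predecessor \<Longrightarrow> B x y = 0"
    "\<And>x y. x \<in> swap.predecessor \<Longrightarrow> y \<in> swap.predecessor \<Longrightarrow> B x y = 0"
    using predecessor_isotropic swap.predecessor_isotropic by (simp_all add: isotropic_def)
  have dec: "predecessor \<inter> swap.predecessor = {0}" "l \<inter> l' = {u + v | u v. u \<in> predecessor \<and> v \<in> swap.predecessor}"
    using sum by (simp_all add: direct_sum_of_def)
  obtain E where E: "rf.orth_basis (l \<inter> l') E" "2 * card {e\<in>E. B e e > 0} = re.dim (l \<inter> l')"
      "2 * card {e\<in>E. B e e < 0} = re.dim (l \<inter> l')"
    using rf.hyperbolic_signature[OF subs iso dec l_l'_nondegenerate] by blast
  then have "has_signature (l \<inter> l') B (dim (l \<inter> l')) (dim (l \<inter> l'))"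
    unfolding has_signature_def using re_dim[OF sL] by (intro exI[of _ E]) (simp add: rf.orth_basis_def)
  then have "manin_form (l \<inter> l') B"
    unfolding manin_form_def using B_add B_scale B_sym B_inv by blast
  then show ?thesis
    using sum predecessor_subalgebra swap.predecessor_subalgebra predecessor_isotropic swap.predecessor_isotropic
    by (simp add: manin_triple_def)
qed

theorem predecessor_criterion:
  "manin_triple UNIV B i i' \<longleftrightarrow>
    (predecessor \<subseteq> l \<inter> l' \<and> swap.predecessor \<subseteq> l \<inter> l' \<and> manin_triple (l \<inter> l') B predecessor swap.predecessor) \<and>
    (n \<inter> (i' \<inter> l') = {0} \<and> n' \<inter> (i \<inter> l) = {0})"
proof
  assume t: "manin_triple UNIV B i i'"
  then have int: "i \<inter> i' = {0}" using triple_iff_Int by blast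
  have z: "0 \<in> n" "0 \<in> n'" "0 \<in> l" "0 \<in> l'" "0 \<in> i" "0 \<in> i'"
    using subspace_0 s.subspace_n s'.subspace_n s.subspace_l s'.subspace_l
      re.subspace_0[OF s.subspace_i] re.subspace_0[OF s'.subspace_i] by blast+
  have "n \<inter> (i' \<inter> l') = {0}" "n' \<inter> (i \<inter> l) = {0}" using int s.n_i s'.n_i z by blast+
  then show "(predecessor \<subseteq> l \<inter> l' \<and> swap.predecessor \<subseteq> l \<inter> l' \<and> manin_triple (l \<inter> l') B predecessor swap.predecessor) \<and>
    (n \<inter> (i' \<inter> l') = {0} \<and> n' \<inter> (i \<inter> l) = {0})"
    using predecessor_triple[OF t] predecessor_subset swap.predecessor_subset by blast
next
  assume r: "(predecessor \<subseteq> l \<inter> l' \<and> swap.predecessor \<subseteq> l \<inter> l' \<and> manin_triple (l \<inter> l') B predecessor swap.predecessor) \<and>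
    (n \<inter> (i' \<inter> l') = {0} \<and> n' \<inter> (i \<inter> l) = {0})"
  have int1: "predecessor \<inter> swap.predecessor = {0}" using r by (simp add: manin_triple_def direct_sum_of_def)
  have "x = 0" if x: "x \<in> i" "x \<in> i'" for x
  proof -
    have xp: "x \<in> p" "x \<in> p'" using x s.i_p s'.i_p by blast+
    obtain a c d where a: "x = a + c + d" "a \<in> l \<inter> l'" "c \<in> l \<inter> n'" "d \<in> n \<inter> l'"
      using p_p'_split[OF xp] by blast
    have "x - d \<in> i" using x a s.n_i re.subspace_diff[OF s.subspace_i] by blast
    then have ac: "a + c \<in> i" using a by simp
    have "x - c \<in> i'" using x a s'.n_i re.subspace_diff[OF s'.subspace_i] by blast
    then have ad: "a + d \<in> i'" using a by (simp add: algebra_simps)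
    have "a \<in> predecessor" unfolding predecessor_def using a ac by blast
    moreover have "a \<in> swap.predecessor" unfolding swap.predecessor_def using a ad by blast
    ultimately have a0: "a = 0" using int1 by blast
    have "c \<in> n' \<inter> (i \<inter> l)" using a ac a0 by simp
    moreover have "d \<in> n \<inter> (i' \<inter> l')" using a ad a0 by simp
    ultimately have "c = 0" "d = 0" using r by blast+
    then show ?thesis using a a0 by simp
  qed
  moreover have "0 \<in> i" "0 \<in> i'" using re.subspace_0[OF s.subspace_i] re.subspace_0[OF s'.subspace_i] by blast+
  ultimately have "i \<inter> i' = {0}" by blast
  then show "manin_triple UNIV B i i'" using triple_iff_Int by blast
qed

end

theorem mainTheorem3:
  fixes scale :: "complex \<Rightarrow> 'a::ab_group_add \<Rightarrow> 'a"
    and bracket :: "'a \<Rightarrow> 'a \<Rightarrow> 'a"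
    and j0 b0 b0' p p' l l' n n' :: "'a set"
    and B :: "'a \<Rightarrow> 'a \<Rightarrow> real"
    and i i' m m' h h' ht ht' i1 i1' :: "'a set"
  assumes "fd_complex_lie_algebra scale bracket"
    and "lie_algebra.reductive scale bracket UNIV"
    and "lie_algebra.cartan scale bracket j0"
    and "lie_algebra.borel scale bracket b0" and "j0 \<subseteq> b0"
    and "lie_algebra.opposite_borel scale bracket j0 b0 b0'"
    and "lie_algebra.parabolic scale bracket p" and "b0 \<subseteq> p"
    and "lie_algebra.parabolic scale bracket p'" and "b0' \<subseteq> p'"
    and "lie_algebra.langlands_decomposition scale bracket p l n" and "j0 \<subseteq> l"
    and "lie_algebra.langlands_decomposition scale bracket p' l' n'" and "j0 \<subseteq> l'"
    and "fd_complex_lie_algebra.manin_form scale bracket UNIV B"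
    and "fd_complex_lie_algebra.lagrangian scale bracket B i"
    and "fd_complex_lie_algebra.lagrangian scale bracket B i'"
    and "fd_complex_lie_algebra.under scale bracket i p"
    and "fd_complex_lie_algebra.under scale bracket i' p'"
    and "m = lie_algebra.brackets scale bracket l l"
    and "m' = lie_algebra.brackets scale bracket l' l'"
    and "h = i \<inter> m" and "h' = i' \<inter> m'"
    and "ht = i \<inter> l" and "ht' = i' \<inter> l'"
    and "i1 = lie_algebra.weight_proj scale bracket j0 n' ` (ht \<inter> p')"
    and "i1' = lie_algebra.weight_proj scale bracket j0 n ` (ht' \<inter> p)"
  shows "fd_complex_lie_algebra.manin_triple scale bracket UNIV B i i' \<longleftrightarrow>
    (i1 \<subseteq> l \<inter> l' \<and> i1' \<subseteq> l \<inter> l' \<and>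
     fd_complex_lie_algebra.manin_triple scale bracket (l \<inter> l') B i1 i1') \<and>
    (n \<inter> h' = {0} \<and> n' \<inter> h = {0})"
proof -
  interpret G: fd_complex_lie_algebra scale bracket by (rule assms(1))
  have abel: "bracket x y = 0" if "x \<in> j0" "y \<in> j0" for x y
    by (rule G.cartan_in_opposite_borel(3)[OF assms(3,6) that])
  have sub_j0: "G.subspace j0" and nor: "G.normalizer j0 = j0"
    using assms(3) by (auto simp: G.cartan_def G.subalgebra_def)
  have cr: "G.completely_reducible UNIV UNIV" using assms(2) by (simp add: G.reductive_def)
  have bor': "G.borel b0'" using assms(6) unfolding G.opposite_borel_def by blast
  have B: "G.manin_form UNIV B" by (rule assms(15))
  interpret C: manin_form_with_borel scale bracket j0 B b0'
  proof unfold_locales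
    show "G.subspace j0" by (rule sub_j0)
    show "bracket x y = 0" if "x \<in> j0" "y \<in> j0" for x y by (rule abel[OF that])
    show "G.completely_reducible UNIV UNIV" by (rule cr)
    show "G.normalizer j0 = j0" by (rule nor)
    show "B (x + y) z = B x z + B y z" "B (scale (complex_of_real r) x) y = r * B x y" "B x y = B y x"
      "B (bracket x y) z = - B y (bracket x z)" for x y z r
      using B unfolding G.manin_form_def by blast+
    show "x = 0" if "\<And>y. B x y = 0" for x by (rule G.manin_nondegenerate[OF B that])
    show "G.borel b0'" by (rule bor')
    show "j0 \<subseteq> b0'" by (rule G.cartan_in_opposite_borel(1)[OF assms(3,6)])
    show "b0' \<subseteq> G.span (\<Union>{b0' \<inter> G.weight_space j0 \<alpha> | \<alpha>. True})"
      using G.cartan_in_opposite_borel(2)[OF assms(3,6)] by (rule equalityD1)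
    show "G.manin_form UNIV B" by (rule B)
  qed
  have lag: "G.re.subalgebra i" "G.re.subalgebra i'" using assms(16,17) by (auto simp: G.lagrangian_def)
  have par: "G.subalgebra p" "G.subalgebra p'" using assms(7,9) by (auto simp: G.parabolic_def)
  interpret s: parabolic_lagrangian scale bracket j0 B b0' p l n i
    by unfold_locales (rule par assms G.under_subset[OF lag(1)])+
  interpret s': parabolic_lagrangian scale bracket j0 B b0' p' l' n' i'
    by unfold_locales (rule par assms G.under_subset[OF lag(2)])+
  have nn: "n \<inter> n' = {0}"
    by (rule C.opposite_nilradicals_Int[OF assms(4,5,6,8,10) s.subspace_n s.stable_H(2) s.H_n s.B_n_p
        s'.subspace_n s'.stable_H(2) s'.B_n_p])
  interpret P: manin_pair_symmetric scale bracket j0 B b0' p l n i p' l' n' i'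
    by unfold_locales (use nn in auto)
  have i1: "i1 = P.predecessor" using P.predecessor_eq by (simp add: assms(24,26) Int_assoc)
  have i1': "i1' = P.swap.predecessor" using P.swap.predecessor_eq by (simp add: assms(25,27) Int_assoc)
  have h: "n' \<inter> h = n' \<inter> (i \<inter> l)" using P.Int_derived_eq by (simp add: assms(20,22))
  have h': "n \<inter> h' = n \<inter> (i' \<inter> l')" using P.swap.Int_derived_eq by (simp add: assms(21,23))
  show ?thesis unfolding i1 i1' h h' by (rule P.predecessor_criterion)
qed

end
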